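(* Let $g_0$ be the round metric on $S^6$ and let $J_C$ be the Cayley almost-complex structure on $S^6$. Let $J$ be an almost-complex structure on $S^6$ which is conformally equivalent to $J_C$, i.e. $J=\phi^*J_C=(d\phi)^{-1}\circ J_C\circ d\phi$ for some conformal diffeomorphism $\phi$ of $(S^6,g_0)$. Then for every metric $g=\lambda g_0$, with $\lambda:S^6\to(0,\infty)$ smooth, $J$ is an energy minimizer with respect to $g$: $E_g(J)\le E_g(J')$ for every almost-complex structure $J'$ on $S^6$ that is orthogonal with respect to $g$.
   Context: An orthogonal almost-complex structure on a Riemannian manifold $(M,g)$ is a bundle automorphism $J:TM\to TM$, orthogonal with respect to $g$, with $J^2=-\mathrm{id}_{TM}$. Its Kähler form is $\omega=g(J\cdot,\cdot)$ and, for $M$ compact, its energy is $E_g(J)=\int_M\|\nabla\omega\|^2\,vol$, where $\nabla$, the norm and $vol$ are the Levi-Civita connection, the tensor norm and the volume element determined by $g$. The Cayley almost-complex structure $J_C$ on the unit sphere $S^6\subset\mathbb R^7=\mathrm{Im}\,\mathbb O$ (imaginary Cayley numbers/octonions) is $(J_C)_x(v)=x\times v$ for $x\in S^6$, $v\in T_xS^6=x^\perp$, where $\times$ is the Cayley cross product $a\times b=\mathrm{Im}(ab)$. It is orthogonal with respect to the round metric. *)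

theory Defs
  imports "HOL-Analysis.Analysis"
begin

subsection \<open>Octonions and the Cayley cross product\<close>

text \<open>
  Quaternions and octonions arise from the complex numbers by Cayley--Dickson doubling,
  \<open>(a, b) (c, d) = (a c - d* b, d a + b c*)\<close>.
\<close>

type_synonym quat = "complex \<times> complex"
type_synonym oct = "quat \<times> quat"

definition quat_cnj :: "quat \<Rightarrow> quat" where
  "quat_cnj p = (cnj (fst p), - snd p)"

definition quat_mult :: "quat \<Rightarrow> quat \<Rightarrow> quat" where
  "quat_mult p q = (fst p * fst q - cnj (snd q) * snd p, snd q * fst p + snd p * cnj (fst q))"

definition oct_mult :: "oct \<Rightarrow> oct \<Rightarrow> oct" where
  "oct_mult a b =
     (quat_mult (fst a) (fst b) - quat_mult (quat_cnj (snd b)) (snd a),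
      quat_mult (snd b) (fst a) + quat_mult (snd a) (quat_cnj (fst b)))"

text \<open>
  The seven imaginary coordinates identify the purely imaginary octonions with \<open>\<real>\<^sup>7\<close>:
  \<open>oct_of_im\<close> is the inclusion and \<open>oct_im\<close> the imaginary part.
\<close>

definition oct_of_im :: "real^7 \<Rightarrow> oct" where
  "oct_of_im x = ((Complex 0 (x$1), Complex (x$2) (x$3)), (Complex (x$4) (x$5), Complex (x$6) (x$7)))"

definition oct_im :: "oct \<Rightarrow> real^7" where
  "oct_im a = vector [Im (fst (fst a)), Re (snd (fst a)), Im (snd (fst a)),
     Re (fst (snd a)), Im (fst (snd a)), Re (snd (snd a)), Im (snd (snd a))]"

definition cayley_cross :: "real^7 \<Rightarrow> real^7 \<Rightarrow> real^7" where
  "cayley_cross a b = oct_im (oct_mult (oct_of_im a) (oct_of_im b))"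


subsection \<open>Smooth maps\<close>

primrec Ck_on :: "nat \<Rightarrow> 'a::euclidean_space set \<Rightarrow> ('a \<Rightarrow> 'b::real_normed_vector) \<Rightarrow> bool" where
  "Ck_on 0 U f \<longleftrightarrow> continuous_on U f"
| "Ck_on (Suc k) U f \<longleftrightarrow> (\<forall>x\<in>U. f differentiable (at x)) \<and>
     (\<forall>v. Ck_on k U (\<lambda>x. frechet_derivative f (at x) v))"

text \<open>
  Smoothness on an arbitrary subset of a Euclidean space: local extendability to a smooth map
  on an open set. On an embedded submanifold this is the usual notion.
\<close>

definition smooth_on :: "'a::euclidean_space set \<Rightarrow> ('a \<Rightarrow> 'b::real_normed_vector) \<Rightarrow> bool" where
  "smooth_on S f \<longleftrightarrow> (\<forall>x\<in>S. \<exists>U F. open U \<and> x \<in> U \<and> (\<forall>k. Ck_on k U F) \<and> (\<forall>y\<in>U \<inter> S. F y = f y))"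


subsection \<open>The sphere\<close>

text \<open>
  Objects on the sphere are represented by functions on the ambient space; only their values
  on \<open>S6\<close> and on tangent vectors matter.
\<close>

abbreviation S6 :: "(real^7) set" where
  "S6 \<equiv> sphere 0 1"

definition tangent :: "real^7 \<Rightarrow> (real^7) set" where
  "tangent x = {v. v \<bullet> x = 0}"

definition tangent_bundle :: "((real^7) \<times> (real^7)) set" where
  "tangent_bundle = {(x, v). x \<in> S6 \<and> v \<in> tangent x}"

text \<open>
  The derivative within the sphere is not unique as a linear map of the ambient space, but its
  restriction to \<open>tangent x\<close> is, and it is only applied there.
\<close>

definition sphere_deriv :: "(real^7 \<Rightarrow> 'b::real_normed_vector) \<Rightarrow> real^7 \<Rightarrow> real^7 \<Rightarrow> 'b" where
  "sphere_deriv f x = frechet_derivative f (at x within S6)"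

definition vector_field :: "(real^7 \<Rightarrow> real^7) \<Rightarrow> bool" where
  "vector_field X \<longleftrightarrow> smooth_on S6 X \<and> (\<forall>x\<in>S6. X x \<in> tangent x)"

text \<open>
  This ambient expression is the derivation commutator \<open>X Y - Y X\<close> applied to the coordinate
  functions.
\<close>

definition lie_bracket :: "(real^7 \<Rightarrow> real^7) \<Rightarrow> (real^7 \<Rightarrow> real^7) \<Rightarrow> real^7 \<Rightarrow> real^7" where
  "lie_bracket X Y x = sphere_deriv Y x (X x) - sphere_deriv X x (Y x)"


subsection \<open>Riemannian metrics on the sphere\<close>

type_synonym metric = "real^7 \<Rightarrow> real^7 \<Rightarrow> real^7 \<Rightarrow> real"

definition round_metric :: metric where
  "round_metric x u v = u \<bullet> v"

definition is_levi_civita ::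
    "metric \<Rightarrow> ((real^7 \<Rightarrow> real^7) \<Rightarrow> (real^7 \<Rightarrow> real^7) \<Rightarrow> real^7 \<Rightarrow> real^7) \<Rightarrow> bool" where
  "is_levi_civita g D \<longleftrightarrow>
     (\<forall>X Y. vector_field X \<longrightarrow> vector_field Y \<longrightarrow> vector_field (D X Y)) \<and>
     (\<forall>X X' Y. vector_field X \<longrightarrow> vector_field X' \<longrightarrow> vector_field Y \<longrightarrow>
        (\<forall>x\<in>S6. D (\<lambda>y. X y + X' y) Y x = D X Y x + D X' Y x)) \<and>
     (\<forall>f X Y. smooth_on S6 f \<longrightarrow> vector_field X \<longrightarrow> vector_field Y \<longrightarrow>
        (\<forall>x\<in>S6. D (\<lambda>y. f y *\<^sub>R X y) Y x = f x *\<^sub>R D X Y x)) \<and>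
     (\<forall>X Y Y'. vector_field X \<longrightarrow> vector_field Y \<longrightarrow> vector_field Y' \<longrightarrow>
        (\<forall>x\<in>S6. D X (\<lambda>y. Y y + Y' y) x = D X Y x + D X Y' x)) \<and>
     (\<forall>f X Y. smooth_on S6 f \<longrightarrow> vector_field X \<longrightarrow> vector_field Y \<longrightarrow>
        (\<forall>x\<in>S6. D X (\<lambda>y. f y *\<^sub>R Y y) x = sphere_deriv f x (X x) *\<^sub>R Y x + f x *\<^sub>R D X Y x)) \<and>
     (\<forall>X Y. vector_field X \<longrightarrow> vector_field Y \<longrightarrow>
        (\<forall>x\<in>S6. D X Y x - D Y X x = lie_bracket X Y x)) \<and>
     (\<forall>X Y Z. vector_field X \<longrightarrow> vector_field Y \<longrightarrow> vector_field Z \<longrightarrow>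
        (\<forall>x\<in>S6. sphere_deriv (\<lambda>y. g y (Y y) (Z y)) x (X x) =
           g x (D X Y x) (Z x) + g x (Y x) (D X Z x)))"

text \<open>
  By the Koszul formula the values of \<open>levi_civita g X Y\<close> on \<open>S6\<close> are determined for all vector
  fields \<open>X\<close>, \<open>Y\<close>, so the choice is immaterial.
\<close>

definition levi_civita ::
    "metric \<Rightarrow> (real^7 \<Rightarrow> real^7) \<Rightarrow> (real^7 \<Rightarrow> real^7) \<Rightarrow> real^7 \<Rightarrow> real^7" where
  "levi_civita g = (SOME D. is_levi_civita g D)"

definition orthonormal_frame :: "metric \<Rightarrow> real^7 \<Rightarrow> (nat \<Rightarrow> real^7) \<Rightarrow> bool" where
  "orthonormal_frame g x e \<longleftrightarrow> (\<forall>i<6. e i \<in> tangent x) \<and>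
     (\<forall>i<6. \<forall>j<6. g x (e i) (e j) = (if i = j then 1 else 0))"

text \<open>
  The squared norm of a covariant 3-tensor on \<open>tangent x\<close>; it does not depend on the frame.
\<close>

definition tensor3_norm_sq ::
    "metric \<Rightarrow> real^7 \<Rightarrow> (real^7 \<Rightarrow> real^7 \<Rightarrow> real^7 \<Rightarrow> real) \<Rightarrow> real" where
  "tensor3_norm_sq g x T =
     (let e = (SOME e. orthonormal_frame g x e)
      in \<Sum>i<6. \<Sum>j<6. \<Sum>k<6. (T (e i) (e j) (e k))\<^sup>2)"

text \<open>
  Inverse stereographic projection is a chart covering the sphere up to one point. The
  volume element of \<open>g\<close> is \<open>sqrt (det g\<^sub>i\<^sub>j) dy\<close> in this chart. The measure has space \<open>S6\<close>, so
  that values of integrands off the sphere play no role.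
\<close>

definition inv_stereo :: "real^6 \<Rightarrow> real^7" where
  "inv_stereo y = (1 / (1 + (norm y)\<^sup>2)) *\<^sub>R
     vector [2 * y$1, 2 * y$2, 2 * y$3, 2 * y$4, 2 * y$5, 2 * y$6, (norm y)\<^sup>2 - 1]"

definition chart_metric :: "metric \<Rightarrow> real^6 \<Rightarrow> real^6^6" where
  "chart_metric g y = (\<chi> i j. g (inv_stereo y)
     (frechet_derivative inv_stereo (at y) (axis i 1))
     (frechet_derivative inv_stereo (at y) (axis j 1)))"

definition vol :: "metric \<Rightarrow> (real^7) measure" where
  "vol g = distr (density lborel (\<lambda>y. ennreal (sqrt (det (chart_metric g y)))))
     (restrict_space borel S6) inv_stereo"


subsection \<open>Almost-complex structures and their energy\<close>

definition almost_complex :: "(real^7 \<Rightarrow> real^7 \<Rightarrow> real^7) \<Rightarrow> bool" where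
  "almost_complex J \<longleftrightarrow>
     smooth_on tangent_bundle (\<lambda>(x, v). J x v) \<and>
     (\<forall>x\<in>S6. \<forall>v\<in>tangent x. J x v \<in> tangent x) \<and>
     (\<forall>x\<in>S6. \<forall>u\<in>tangent x. \<forall>v\<in>tangent x. \<forall>a b. J x (a *\<^sub>R u + b *\<^sub>R v) = a *\<^sub>R J x u + b *\<^sub>R J x v) \<and>
     (\<forall>x\<in>S6. \<forall>v\<in>tangent x. J x (J x v) = - v)"

definition orthogonal_almost_complex :: "metric \<Rightarrow> (real^7 \<Rightarrow> real^7 \<Rightarrow> real^7) \<Rightarrow> bool" where
  "orthogonal_almost_complex g J \<longleftrightarrow> almost_complex J \<and>
     (\<forall>x\<in>S6. \<forall>u\<in>tangent x. \<forall>v\<in>tangent x. g x (J x u) (J x v) = g x u v)"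

definition kaehler_form :: "metric \<Rightarrow> (real^7 \<Rightarrow> real^7 \<Rightarrow> real^7) \<Rightarrow> real^7 \<Rightarrow> real^7 \<Rightarrow> real^7 \<Rightarrow> real" where
  "kaehler_form g J x u v = g x (J x u) v"

definition nabla_form ::
    "metric \<Rightarrow> (real^7 \<Rightarrow> real^7 \<Rightarrow> real^7 \<Rightarrow> real) \<Rightarrow>
     (real^7 \<Rightarrow> real^7) \<Rightarrow> (real^7 \<Rightarrow> real^7) \<Rightarrow> (real^7 \<Rightarrow> real^7) \<Rightarrow> real^7 \<Rightarrow> real" where
  "nabla_form g \<omega> X Y Z x = sphere_deriv (\<lambda>y. \<omega> y (Y y) (Z y)) x (X x)
     - \<omega> x (levi_civita g X Y x) (Z x) - \<omega> x (Y x) (levi_civita g X Z x)"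

text \<open>
  The value of \<open>nabla_form\<close> at \<open>x\<close> only depends on the values of the three fields at \<open>x\<close>.
  A tangent vector at \<open>x\<close> is extended to a vector field by projecting it to the tangent spaces.
\<close>

definition tangential_field :: "real^7 \<Rightarrow> real^7 \<Rightarrow> real^7" where
  "tangential_field v y = v - (v \<bullet> y) *\<^sub>R y"

definition nabla_form_at ::
    "metric \<Rightarrow> (real^7 \<Rightarrow> real^7 \<Rightarrow> real^7 \<Rightarrow> real) \<Rightarrow> real^7 \<Rightarrow> real^7 \<Rightarrow> real^7 \<Rightarrow> real^7 \<Rightarrow> real" where
  "nabla_form_at g \<omega> x u v w =
     nabla_form g \<omega> (tangential_field u) (tangential_field v) (tangential_field w) x"

definition energy :: "metric \<Rightarrow> (real^7 \<Rightarrow> real^7 \<Rightarrow> real^7) \<Rightarrow> real" where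
  "energy g J = (\<integral>x. tensor3_norm_sq g x (nabla_form_at g (kaehler_form g J) x) \<partial>vol g)"

definition energy_minimizer :: "metric \<Rightarrow> (real^7 \<Rightarrow> real^7 \<Rightarrow> real^7) \<Rightarrow> bool" where
  "energy_minimizer g J \<longleftrightarrow> orthogonal_almost_complex g J \<and>
     (\<forall>J'. orthogonal_almost_complex g J' \<longrightarrow> energy g J \<le> energy g J')"


subsection \<open>Conformal equivalence\<close>

definition cayley_structure :: "real^7 \<Rightarrow> real^7 \<Rightarrow> real^7" where
  "cayley_structure x v = cayley_cross x v"

definition conformal_diffeo :: "(real^7 \<Rightarrow> real^7) \<Rightarrow> bool" where
  "conformal_diffeo \<phi> \<longleftrightarrow>
     bij_betw \<phi> S6 S6 \<and> smooth_on S6 \<phi> \<and> smooth_on S6 (inv_into S6 \<phi>) \<and>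
     (\<exists>\<mu>. \<forall>x\<in>S6. \<mu> x > 0 \<and> (\<forall>u\<in>tangent x. \<forall>v\<in>tangent x.
        round_metric (\<phi> x) (sphere_deriv \<phi> x u) (sphere_deriv \<phi> x v) = \<mu> x * round_metric x u v))"

definition pullback_structure ::
    "(real^7 \<Rightarrow> real^7) \<Rightarrow> (real^7 \<Rightarrow> real^7 \<Rightarrow> real^7) \<Rightarrow> real^7 \<Rightarrow> real^7 \<Rightarrow> real^7" where
  "pullback_structure \<phi> J x v =
     inv_into (tangent x) (sphere_deriv \<phi> x) (J (\<phi> x) (sphere_deriv \<phi> x v))"

definition conformally_equivalent ::
    "(real^7 \<Rightarrow> real^7 \<Rightarrow> real^7) \<Rightarrow> (real^7 \<Rightarrow> real^7 \<Rightarrow> real^7) \<Rightarrow> bool" where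
  "conformally_equivalent J J' \<longleftrightarrow>
     (\<exists>\<phi>. conformal_diffeo \<phi> \<and> (\<forall>x\<in>S6. \<forall>v\<in>tangent x. J x v = pullback_structure \<phi> J' x v))"

end

theory Submission
  imports Defs
begin


text \<open>
  The proof is a calibration argument. For \<open>J\<close> orthogonal, \<open>F = \<nabla>\<omega>\<close> lies in the space of three-tensors
  that are skew in the last two slots and compatible with \<open>J\<close>. On it the quadratic form
  \<open>N(F) = \<bar>tr F\<bar>\<^sup>2 - \<Sum> F\<^sub>a\<^sub>b\<^sub>c F\<^sub>b\<^sub>a\<^sub>c\<close> satisfies \<open>N(F) \<le> \<bar>F\<bar>\<^sup>2\<close>: in real dimension six the difference is
  the square of the part of the symmetrization \<open>F\<^sub>a\<^sub>b\<^sub>c + F\<^sub>b\<^sub>a\<^sub>c\<close> that is not of conformal type. Equality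
  means that \<open>F\<close> is of Gray-Hervella type \<open>W\<^sub>1 + W\<^sub>4\<close>. In the metric \<open>\<lambda> g\<^sub>0\<close> the form \<open>N(\<nabla>\<omega>)\<close> is a null
  Lagrangian: with respect to the round volume it equals \<open>div(- 2 \<lambda>\<^sup>2 J \<delta>J) + 24 \<lambda>\<^sup>2 + 4 \<bar>d\<lambda>\<bar>\<^sup>2\<close>, so its
  integral bounds every energy from below by the same number. Finally the Cayley structure has totally
  skew \<open>\<nabla>\<omega>\<close>, and a pullback by a conformal map only adds a conformal term, so equality holds there.
\<close>

subsection \<open>Calculus of smooth maps\<close>

text \<open>Covariant calculus is avoided: objects on the sphere are extended to R^7 minus the
  origin, constant along rays. There partial derivatives commute, and the curvature of the sphere
  returns as constants. In 24 = 30 - 6, the 30 comes from differentiating \<open>K^T K = P\<close>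
  twice (\<open>P\<close> the tangential projection), the 6 from normal components of the derivative
  of J. The relation \<open>K^T K = P\<close>, which is orthogonality, expresses the swapped
  contraction in N through the divergence of J and its derivative. Dimension six enters twice. The
  squared norm of a three-tensor scales by \<open>\<lambda>^-3\<close> and the volume by
  \<open>\<lambda>^3\<close>, so all integrals live on the round sphere. And the sum-of-squares
  identity carries the coefficient 4/(dim - 2) on |tr F|^2, which must be 1 to match the null
  Lagrangian. Equality for the pullback rests on
  \<open>d\<phi> (J v) = \<phi> \<times> d\<phi> v\<close>. Differentiated along v itself, it loses
  the term \<open>d\<phi> v \<times> d\<phi> v\<close> and leaves only the Hessian of
  \<open>\<phi>\<close>, which the conformal factor determines.\<close>

abbreviation pd :: "'a::real_normed_vector \<Rightarrow> ('a \<Rightarrow> 'b::real_normed_vector) \<Rightarrow> 'a \<Rightarrow> 'b" where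
  "pd v f x \<equiv> frechet_derivative f (at x) v"

lemma pd_eqI: "(f has_derivative f') (at x) \<Longrightarrow> pd v f x = f' v"
  by (metis frechet_derivative_at)

lemma differentiable_has_pd:
  "f differentiable (at x) \<Longrightarrow> (f has_derivative (\<lambda>v. pd v f x)) (at x)"
  by (metis frechet_derivative_works)

section \<open>Closure properties of C^k maps\<close>

lemma Ck_on_cong:
  assumes "open U" and "\<And>x. x \<in> U \<Longrightarrow> f x = g x" and "Ck_on k U f"
  shows "Ck_on k U g"
  using assms(2,3)
proof (induction k arbitrary: f g)
  case 0
  then show ?case using continuous_on_cong by force
next
  case (Suc k)
  have diff: "g differentiable (at x)" if "x \<in> U" for x
    using Suc.prems that assms(1)
    by (metis (no_types, lifting) Ck_on.simps(2) differentiable_def has_derivative_transform_within_open)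
  have "Ck_on k U (pd v g)" for v
    by (rule Suc.IH[of "pd v f"])
      (use Suc.prems assms(1) frechet_derivative_transform_within_open[of f _ U g] in auto)
  with diff show ?case by simp
qed

lemma Ck_on_subset: "Ck_on k U f \<Longrightarrow> V \<subseteq> U \<Longrightarrow> Ck_on k V f"
  by (induction k arbitrary: f) (auto intro: continuous_on_subset)

lemma Ck_on_continuous: "Ck_on k U f \<Longrightarrow> continuous_on U f"
  by (cases k)
    (auto intro!: continuous_at_imp_continuous_on differentiable_imp_continuous_within)

lemma Ck_on_Suc_D: "Ck_on (Suc k) U f \<Longrightarrow> Ck_on k U f"
proof (induction k arbitrary: f)
  case 0 then show ?case using Ck_on_continuous[of "Suc 0" U f] by simp
next
  case (Suc k) then show ?case by (metis Ck_on.simps(2))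
qed

lemma Ck_on_local:
  assumes "\<And>x. x \<in> U \<Longrightarrow> \<exists>W. open W \<and> x \<in> W \<and> Ck_on k W f"
  shows "Ck_on k U f"
  using assms
proof (induction k arbitrary: f)
  case 0
  have "continuous (at x) f" if "x \<in> U" for x
    using 0[OF that] continuous_on_eq_continuous_at by (metis Ck_on.simps(1))
  then show ?case by (simp add: continuous_at_imp_continuous_on)
next
  case (Suc k)
  then show ?case by (metis Ck_on.simps(2))
qed

lemma Ck_on_const: "Ck_on k U (\<lambda>x. c)"
  by (induction k arbitrary: c) auto

lemma Ck_on_bounded_linear:
  assumes "bounded_linear h" shows "Ck_on k U h"
proof (cases k)
  case 0 then show ?thesis using assms by (simp add: linear_continuous_on)
next
  case (Suc j)
  have "pd v h = (\<lambda>x. h v)" for v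
    using pd_eqI[OF bounded_linear_imp_has_derivative[OF assms]] by auto
  then show ?thesis
    using Suc assms by (auto simp: Ck_on_const bounded_linear_imp_differentiable)
qed

lemma Ck_on_add:
  assumes "open U" "Ck_on k U f" "Ck_on k U g" shows "Ck_on k U (\<lambda>x. f x + g x)"
  using assms(2,3)
proof (induction k arbitrary: f g)
  case 0 then show ?case by (auto intro: continuous_on_add)
next
  case (Suc k)
  have eq: "pd v (\<lambda>x. f x + g x) x = pd v f x + pd v g x" if "x \<in> U" for v x
    using Suc.prems that by (intro pd_eqI has_derivative_add differentiable_has_pd) auto
  have "Ck_on k U (pd v (\<lambda>x. f x + g x))" for v
    by (rule Ck_on_cong[OF assms(1) eq[symmetric]])
      (use Suc in \<open>auto intro!: Suc.IH\<close>)
  with Suc.prems show ?case by (auto intro: differentiable_add)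
qed

lemma Ck_on_bilinear:
  assumes "open U" "bounded_bilinear B" "Ck_on k U f" "Ck_on k U g"
  shows "Ck_on k U (\<lambda>x. B (f x) (g x))"
  using assms(3,4)
proof (induction k arbitrary: f g)
  case 0 then show ?case by (auto intro: bounded_bilinear.continuous_on[OF assms(2)])
next
  case (Suc k)
  have der: "((\<lambda>x. B (f x) (g x)) has_derivative (\<lambda>v. B (f x) (pd v g x) + B (pd v f x) (g x))) (at x)"
    if "x \<in> U" for x
    using Suc.prems that
    by (intro bounded_bilinear.FDERIV[OF assms(2)] differentiable_has_pd) auto
  have "Ck_on k U (pd v (\<lambda>x. B (f x) (g x)))" for v
    by (rule Ck_on_cong[OF assms(1) pd_eqI[OF der, symmetric]])
      (use Suc.prems Ck_on_Suc_D[OF Suc.prems(1)] Ck_on_Suc_D[OF Suc.prems(2)] in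
        \<open>auto intro!: Ck_on_add[OF assms(1)] Suc.IH\<close>)
  with der show ?case by (auto simp: differentiable_def)
qed

lemma Ck_on_sum:
  assumes "open U" "\<And>i. i \<in> I \<Longrightarrow> Ck_on k U (f i)"
  shows "Ck_on k U (\<lambda>x. \<Sum>i\<in>I. f i x)"
  using assms(2)
  by (induction I rule: infinite_finite_induct) (auto simp: Ck_on_const Ck_on_add[OF assms(1)])

lemma pd_basis_expansion:
  fixes f :: "'a::euclidean_space \<Rightarrow> 'b::real_normed_vector"
  assumes "f differentiable (at x)"
  shows "pd w f x = (\<Sum>b\<in>Basis. (w \<bullet> b) *\<^sub>R pd b f x)"
proof -
  interpret linear "\<lambda>v. pd v f x" using linear_frechet_derivative[OF assms] .
  have "pd w f x = pd (\<Sum>b\<in>Basis. (w \<bullet> b) *\<^sub>R b) f x" by (simp add: euclidean_representation)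
  then show ?thesis by (simp add: sum scaleR)
qed

text \<open>A partial derivative of the composition is a sum over \<open>Basis\<close> of products
  whose factors are partial derivatives of \<open>F\<close> composed with the same \<open>G\<close>.
  So the induction generalises \<open>F\<close> only, and the middle space has to be
  Euclidean.\<close>

lemma Ck_on_compose:
  fixes G :: "'a::euclidean_space \<Rightarrow> 'b::euclidean_space" and F :: "'b \<Rightarrow> 'c::real_normed_vector"
  assumes U: "open U" and "G ` U \<subseteq> W" and "Ck_on k W F" "Ck_on k U G"
  shows "Ck_on k U (\<lambda>x. F (G x))"
  using assms(3,4)
proof (induction k arbitrary: F)
  case 0 then show ?case using assms(2) continuous_on_compose2 by auto
next
  case (Suc k)
  have W: "G x \<in> W" if "x \<in> U" for x using assms(2) that by auto
  have der: "((\<lambda>x. F (G x)) has_derivative (\<lambda>v. pd (pd v G x) F (G x))) (at x)" if "x \<in> U" for x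
  proof -
    have "G differentiable (at x)" "F differentiable (at (G x))" using Suc.prems that W[OF that] by auto
    from has_derivative_compose[OF this[THEN differentiable_has_pd]] show ?thesis .
  qed
  have eq: "(\<Sum>b\<in>Basis. (pd v G x \<bullet> b) *\<^sub>R pd b F (G x)) = pd v (\<lambda>x. F (G x)) x" if "x \<in> U" for v x
  proof -
    have "F differentiable (at (G x))" using Suc.prems W[OF that] by simp
    from pd_basis_expansion[OF this, of "pd v G x"] show ?thesis by (simp only: pd_eqI[OF der[OF that]])
  qed
  have "Ck_on k U (pd v (\<lambda>x. F (G x)))" for v
  proof (rule Ck_on_cong[OF U eq], assumption, rule Ck_on_sum[OF U])
    fix b :: 'b
    have "Ck_on k U (\<lambda>x. pd v G x \<bullet> b)"
      by (rule Ck_on_bilinear[OF U bounded_bilinear_inner _ Ck_on_const]) (use Suc.prems in simp)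
    moreover have "Ck_on k U (\<lambda>x. pd b F (G x))"
      by (rule Suc.IH) (use Suc.prems(1) Ck_on_Suc_D[OF Suc.prems(2)] in simp_all)
    ultimately show "Ck_on k U (\<lambda>x. (pd v G x \<bullet> b) *\<^sub>R pd b F (G x))"
      by (rule Ck_on_bilinear[OF U bounded_bilinear_scaleR])
  qed
  with der show ?case by (auto simp: differentiable_def)
qed

text \<open>Openness is built in so that the closure rules chain without side conditions. In
  contrast to \<open>smooth_on\<close>, the function itself is differentiated, not a local extension
  of it.\<close>

definition smooth :: "'a::euclidean_space set \<Rightarrow> ('a \<Rightarrow> 'b::real_normed_vector) \<Rightarrow> bool" where
  "smooth U f \<longleftrightarrow> open U \<and> (\<forall>k. Ck_on k U f)"

lemma smooth_open: "smooth U f \<Longrightarrow> open U" by (simp add: smooth_def)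

lemma smooth_Ck_Suc: "smooth U f \<Longrightarrow> Ck_on (Suc k) U f"
  by (simp only: smooth_def)

lemma smooth_differentiable: "smooth U f \<Longrightarrow> x \<in> U \<Longrightarrow> f differentiable (at x)"
  using smooth_Ck_Suc[of U f 0] by simp

lemma smooth_has_pd: "smooth U f \<Longrightarrow> x \<in> U \<Longrightarrow> (f has_derivative (\<lambda>v. pd v f x)) (at x)"
  by (metis smooth_differentiable differentiable_has_pd)

lemma smooth_pd: "smooth U f \<Longrightarrow> smooth U (pd v f)"
  using smooth_Ck_Suc[of U f] smooth_open[of U f] unfolding smooth_def[of U "pd v f"] by simp

lemma smooth_continuous_on: "smooth U f \<Longrightarrow> continuous_on U f"
  using Ck_on_continuous[of 0 U f] by (simp add: smooth_def)

lemma smooth_const: "open U \<Longrightarrow> smooth U (\<lambda>x. c)"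
  unfolding smooth_def by (intro conjI allI Ck_on_const)

lemma smooth_linear: "open U \<Longrightarrow> bounded_linear h \<Longrightarrow> smooth U h"
  unfolding smooth_def by (intro conjI allI Ck_on_bounded_linear)

lemma smooth_ident: "open U \<Longrightarrow> smooth U (\<lambda>x. x)"
  by (rule smooth_linear[OF _ bounded_linear_ident])

lemma smooth_add: "smooth U f \<Longrightarrow> smooth U g \<Longrightarrow> smooth U (\<lambda>x. f x + g x)"
  using Ck_on_add[of U _ f g] unfolding smooth_def by simp

lemma smooth_bilinear:
  "bounded_bilinear B \<Longrightarrow> smooth U f \<Longrightarrow> smooth U g \<Longrightarrow> smooth U (\<lambda>x. B (f x) (g x))"
  using Ck_on_bilinear[of U B _ f g] unfolding smooth_def by simp

lemmas smooth_scaleR = smooth_bilinear[OF bounded_bilinear_scaleR]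
lemmas smooth_inner = smooth_bilinear[OF bounded_bilinear_inner]
lemmas smooth_mult = smooth_bilinear[OF bounded_bilinear_mult]

lemma smooth_compose_linear:
  fixes h :: "'b::real_normed_vector \<Rightarrow> 'c::real_normed_vector"
  assumes "bounded_linear h" "smooth U f" shows "smooth U (\<lambda>x. h (f x))"
proof -
  \<comment> \<open>The composition rule asks for a Euclidean middle space. Reading \<open>h\<close>
    as a bilinear map with first argument frozen at 1 gives the result for any normed space.\<close>
  have "bounded_bilinear (\<lambda>(a::real) y. a *\<^sub>R h y)"
    using bounded_bilinear.comp[OF bounded_bilinear_scaleR bounded_linear_ident assms(1)] .
  from smooth_bilinear[OF this smooth_const[OF smooth_open[OF assms(2)]] assms(2), of 1]
  show ?thesis by simp
qed

lemma smooth_minus: "smooth U f \<Longrightarrow> smooth U (\<lambda>x. - f x)"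
  using smooth_compose_linear[OF bounded_linear_minus[OF bounded_linear_ident]] .

lemma smooth_diff:
  assumes "smooth U f" "smooth U g" shows "smooth U (\<lambda>x. f x - g x)"
  using smooth_add[OF assms(1) smooth_minus[OF assms(2)]] by simp

lemma smooth_sum: "open U \<Longrightarrow> (\<And>i. i \<in> I \<Longrightarrow> smooth U (f i)) \<Longrightarrow> smooth U (\<lambda>x. \<Sum>i\<in>I. f i x)"
  using Ck_on_sum[of U I _ f] unfolding smooth_def by simp

lemma smooth_compose:
  fixes G :: "'a::euclidean_space \<Rightarrow> 'b::euclidean_space" and F :: "'b \<Rightarrow> 'c::real_normed_vector"
  assumes "smooth W F" "smooth U G" "G ` U \<subseteq> W"
  shows "smooth U (\<lambda>x. F (G x))"
proof -
  have "Ck_on k U (\<lambda>x. F (G x))" for k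
    by (rule Ck_on_compose[OF _ assms(3)]) (use assms in \<open>auto simp: smooth_def\<close>)
  with assms(2) show ?thesis by (simp add: smooth_def)
qed

lemma smooth_Pair:
  fixes f :: "'a::euclidean_space \<Rightarrow> 'b::real_normed_vector" and g :: "'a \<Rightarrow> 'c::real_normed_vector"
  assumes "smooth U f" "smooth U g" shows "smooth U (\<lambda>x. (f x, g x))"
proof -
  have l: "bounded_linear (\<lambda>a::'b. (a, 0::'c))" and r: "bounded_linear (\<lambda>b::'c. (0::'b, b))"
    by (rule bounded_linear_Pair[OF bounded_linear_ident bounded_linear_zero],
        rule bounded_linear_Pair[OF bounded_linear_zero bounded_linear_ident])
  from smooth_add[OF smooth_compose_linear[OF l assms(1)] smooth_compose_linear[OF r assms(2)]]
  show ?thesis by simp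
qed

lemma smooth_cong:
  assumes "\<And>x. x \<in> U \<Longrightarrow> f x = g x" "smooth U f" shows "smooth U g"
proof -
  have "Ck_on k U g" for k by (rule Ck_on_cong[OF _ assms(1)]) (use assms(2) in \<open>auto simp: smooth_def\<close>)
  with assms(2) show ?thesis by (simp add: smooth_def)
qed

lemma smooth_subset: "smooth U f \<Longrightarrow> open V \<Longrightarrow> V \<subseteq> U \<Longrightarrow> smooth V f"
  unfolding smooth_def by (metis Ck_on_subset)

lemma smooth_local:
  assumes "open U" "\<And>x. x \<in> U \<Longrightarrow> \<exists>W. x \<in> W \<and> smooth W f" shows "smooth U f"
proof -
  have "Ck_on k U f" for k
    using assms(2) by (intro Ck_on_local) (auto simp: smooth_def)
  with assms(1) show ?thesis by (simp add: smooth_def)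
qed

lemma smooth_pd_field:
  fixes f :: "'a::euclidean_space \<Rightarrow> 'b::real_normed_vector"
  assumes "smooth U f" "smooth U X" shows "smooth U (\<lambda>x. pd (X x) f x)"
proof (rule smooth_cong)
  note op = smooth_open[OF assms(1)]
  show "(\<Sum>b\<in>Basis. (X x \<bullet> b) *\<^sub>R pd b f x) = pd (X x) f x" if "x \<in> U" for x
    using pd_basis_expansion[OF smooth_differentiable[OF assms(1) that], of "X x"] by simp
  show "smooth U (\<lambda>x. \<Sum>b\<in>Basis. (X x \<bullet> b) *\<^sub>R pd b f x)"
    by (rule smooth_sum[OF op], rule smooth_scaleR[OF smooth_inner[OF assms(2) smooth_const[OF op]]
          smooth_pd[OF assms(1)]])
qed

text \<open>The derivative is a product of the function with itself, so the induction hypothesis for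
  the function bounds its own derivative class. The square root below works the same way, through
  \<open>inverse (sqrt x)\<close>.\<close>

lemma smooth_inverse_real: "smooth (- {0}) (inverse :: real \<Rightarrow> real)"
proof -
  have op: "open (- {0::real})" by (rule open_Compl) simp
  have "Ck_on k (- {0}) (inverse :: real \<Rightarrow> real)" for k
  proof (induction k)
    case 0 show ?case by (auto intro!: continuous_intros)
  next
    case (Suc k)
    have der: "((inverse :: real \<Rightarrow> real) has_derivative (\<lambda>h. - (inverse x * h * inverse x))) (at x)"
      if "x \<in> - {0}" for x :: real
      using has_derivative_inverse'[of x UNIV] that by auto
    have "Ck_on k (- {0}) (\<lambda>x::real. (- v) * (inverse x * inverse x))" for v
      by (rule Ck_on_bilinear[OF op bounded_bilinear_mult Ck_on_const
            Ck_on_bilinear[OF op bounded_bilinear_mult Suc.IH Suc.IH]])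
    then have "Ck_on k (- {0}) (pd v (inverse :: real \<Rightarrow> real))" for v
      by (rule Ck_on_cong[OF op, rotated]) (subst pd_eqI[OF der], auto)
    with der show ?case by (auto simp: differentiable_def)
  qed
  with op show ?thesis by (simp add: smooth_def)
qed

lemma smooth_sqrt: "smooth {0<..} sqrt"
proof -
  have op: "open {0::real<..}" by simp
  have "Ck_on k {0<..} sqrt" for k
  proof (induction k)
    case 0 show ?case by (auto intro!: continuous_intros)
  next
    case (Suc k)
    have der: "(sqrt has_derivative (\<lambda>h. (h / 2) * inverse (sqrt x))) (at x)" if "x \<in> {0<..}" for x
      using that by (auto intro!: derivative_eq_intros simp: has_field_derivative_def field_simps)
    have inv: "Ck_on k {0<..} (\<lambda>x. inverse (sqrt x))"
      by (rule Ck_on_compose[OF op _ _ Suc.IH, of "- {0}" inverse])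
        (use smooth_inverse_real in \<open>auto simp: smooth_def\<close>)
    have "Ck_on k {0<..} (\<lambda>x. (v / 2) * inverse (sqrt x))" for v
      by (rule Ck_on_bilinear[OF op bounded_bilinear_mult Ck_on_const inv])
    then have "Ck_on k {0<..} (pd v sqrt)" for v
      by (rule Ck_on_cong[OF op, rotated]) (subst pd_eqI[OF der], auto)
    with der show ?case by (auto simp: differentiable_def)
  qed
  then show ?thesis by (simp add: smooth_def)
qed

lemma smooth_inverse:
  fixes f :: "'a::euclidean_space \<Rightarrow> real"
  shows "smooth U f \<Longrightarrow> (\<And>x. x \<in> U \<Longrightarrow> f x \<noteq> 0) \<Longrightarrow> smooth U (\<lambda>x. inverse (f x))"
  by (rule smooth_compose[OF smooth_inverse_real]) auto

lemma smooth_norm: "smooth (- {0}) (norm :: 'a::euclidean_space \<Rightarrow> real)"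
proof -
  have op: "open (- {0::'a})" by (rule open_Compl) simp
  have "smooth (- {0}) (\<lambda>x::'a. sqrt (x \<bullet> x))"
    by (rule smooth_compose[OF smooth_sqrt smooth_inner[OF smooth_ident[OF op] smooth_ident[OF op]]]) auto
  then show ?thesis by (simp flip: norm_eq_sqrt_inner)
qed

lemma smooth_sgn: "smooth (- {0}) (sgn :: 'a::euclidean_space \<Rightarrow> 'a)"
proof -
  have op: "open (- {0::'a})" by (rule open_Compl) simp
  have "smooth (- {0}) (\<lambda>x::'a. inverse (norm x) *\<^sub>R x)"
    by (rule smooth_scaleR[OF smooth_inverse[OF smooth_norm] smooth_ident[OF op]]) auto
  then show ?thesis by (simp flip: sgn_div_norm)
qed

text \<open>
  Both orders of differentiation are limits of the same double difference, evaluated through the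
  mean value theorem.
\<close>

lemma pd_pd_commute_real:
  fixes f :: "'a::euclidean_space \<Rightarrow> real"
  assumes f: "smooth U f" and x: "x \<in> U"
  shows "pd u (pd v f) x = pd v (pd u f) x"
proof -
  obtain r where r: "r > 0" "ball x r \<subseteq> U" using smooth_open[OF f] x openE by blast
  \<comment> \<open>Below this step size the whole parallelogram at \<open>x\<close> lies in
    \<open>ball x r\<close>. The summand 1 keeps the quotient positive when both directions are
    zero.\<close>
  define d where "d = r / (norm u + norm v + 1)"
  have d: "d > 0" unfolding d_def using r(1) by (simp add: add_nonneg_pos)
  have inU: "x + s *\<^sub>R a + t *\<^sub>R b \<in> U"
    if "\<bar>s\<bar> < d" "\<bar>t\<bar> < d" "{a, b} = {u, v}" for s t a b
  proof -
    have ab: "norm a + norm b \<le> norm u + norm v" using that(3) by (auto simp: doubleton_eq_iff)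
    have "norm (s *\<^sub>R a + t *\<^sub>R b) \<le> \<bar>s\<bar> * norm a + \<bar>t\<bar> * norm b"
      by (metis norm_triangle_ineq norm_scaleR)
    also have "\<dots> \<le> d * norm a + d * norm b" using that by (intro add_mono mult_right_mono) auto
    also have "\<dots> \<le> d * (norm u + norm v)" using ab d by (simp flip: distrib_left)
    also have "\<dots> < d * (norm u + norm v + 1)" using d by simp
    also have "\<dots> = r" unfolding d_def by (smt (verit) norm_ge_zero nonzero_mult_div_cancel_left times_divide_eq_left mult.commute)
    finally have "norm (s *\<^sub>R a + t *\<^sub>R b) < r" .
    then have "x + s *\<^sub>R a + t *\<^sub>R b \<in> ball x r"
      by (simp add: mem_ball dist_commute[of x]) (simp add: dist_norm add.assoc)
    with r show ?thesis by auto
  qed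
  define q where "q = (\<lambda>t. f (x + t *\<^sub>R u + t *\<^sub>R v) - f (x + t *\<^sub>R u) - f (x + t *\<^sub>R v) + f x)"
  have mvt: "\<exists>s s'. 0 < s \<and> s < t \<and> 0 < s' \<and> s' < t \<and>
      f (x + t *\<^sub>R a + t *\<^sub>R b) - f (x + t *\<^sub>R a) - f (x + t *\<^sub>R b) + f x
        = t * t * pd b (pd a f) (x + s *\<^sub>R a + s' *\<^sub>R b)"
    if t: "0 < t" "t < d" and ab: "{a, b} = {u, v}" for t a b
  proof -
    define g where "g = (\<lambda>s. f (x + s *\<^sub>R a + t *\<^sub>R b) - f (x + s *\<^sub>R a))"
    have line: "((\<lambda>s. h (y + s *\<^sub>R c)) has_real_derivative pd c h (y + s *\<^sub>R c)) (at s)"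
      if "smooth U h" "y + s *\<^sub>R c \<in> U" for h :: "'a \<Rightarrow> real" and y c s
    proof -
      have lin: "linear (\<lambda>v. pd v h (y + s *\<^sub>R c))"
        using linear_frechet_derivative smooth_differentiable[OF that] by blast
      have "((\<lambda>s. y + s *\<^sub>R c) has_derivative (\<lambda>k. k *\<^sub>R c)) (at s)"
        by (auto intro!: derivative_eq_intros)
      from has_derivative_compose[OF this smooth_has_pd[OF that]]
      show ?thesis using linear_scale[OF lin]
        by (simp add: has_field_derivative_def mult_commute_abs)
    qed
    have "\<exists>s>0. s < t \<and> g t - g 0 = (t - 0) * (pd a f (x + s *\<^sub>R a + t *\<^sub>R b) - pd a f (x + s *\<^sub>R a))"
    proof (rule MVT2[OF t(1)])
      fix s :: real assume s: "0 \<le> s" "s \<le> t"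
      have 1: "x + t *\<^sub>R b + s *\<^sub>R a \<in> U" "x + s *\<^sub>R a \<in> U"
        using inU[of s t a b] inU[of s 0 a b] s t ab by (auto simp: algebra_simps)
      show "(g has_real_derivative (pd a f (x + s *\<^sub>R a + t *\<^sub>R b) - pd a f (x + s *\<^sub>R a))) (at s)"
        unfolding g_def using DERIV_diff[OF line[OF f 1(1)] line[OF f 1(2)]]
        by (simp add: algebra_simps)
    qed
    then obtain s where s: "0 < s" "s < t"
      and gs: "g t - g 0 = t * (pd a f (x + s *\<^sub>R a + t *\<^sub>R b) - pd a f (x + s *\<^sub>R a))" by auto
    have "\<exists>s'>0. s' < t \<and> pd a f (x + s *\<^sub>R a + t *\<^sub>R b) - pd a f (x + s *\<^sub>R a + 0 *\<^sub>R b)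
        = (t - 0) * pd b (pd a f) (x + s *\<^sub>R a + s' *\<^sub>R b)"
      by (rule MVT2[OF t(1)], rule line[OF smooth_pd[OF f]]) (rule inU, use s t ab in auto)
    then obtain s' where "0 < s'" "s' < t"
      and "pd a f (x + s *\<^sub>R a + t *\<^sub>R b) - pd a f (x + s *\<^sub>R a) = t * pd b (pd a f) (x + s *\<^sub>R a + s' *\<^sub>R b)"
      by auto
    then show ?thesis using s gs unfolding g_def
      by (intro exI[of _ s] exI[of _ s']) (simp add: algebra_simps)
  qed
  have lim: "((\<lambda>t. q t / (t * t)) \<longlongrightarrow> pd b (pd a f) x) (at_right 0)" if ab: "{a, b} = {u, v}" for a b
  proof (rule tendstoI)
    fix e :: real assume e: "e > 0"
    have "continuous (at x) (pd b (pd a f))"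
      using smooth_continuous_on[OF smooth_pd[OF smooth_pd[OF f]]] smooth_open[OF f] x
        continuous_on_eq_continuous_at by blast
    then obtain k where k: "k > 0" "\<And>y. dist y x < k \<Longrightarrow> dist (pd b (pd a f) y) (pd b (pd a f) x) < e"
      using e unfolding continuous_at_eps_delta by blast
    define m where "m = min d (k / (norm a + norm b + 1))"
    have m: "m > 0" unfolding m_def using d k(1) by (simp add: add_nonneg_pos)
    have "dist (q t / (t * t)) (pd b (pd a f) x) < e" if t: "0 < t" "t < m" for t
    proof -
      have td: "t < d" using t m_def by auto
      obtain s s' where s: "0 < s" "s < t" "0 < s'" "s' < t"
        and eq: "f (x + t *\<^sub>R a + t *\<^sub>R b) - f (x + t *\<^sub>R a) - f (x + t *\<^sub>R b) + f x
        = t * t * pd b (pd a f) (x + s *\<^sub>R a + s' *\<^sub>R b)"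
        using mvt[OF t(1) td ab] by blast
      have "q t = f (x + t *\<^sub>R a + t *\<^sub>R b) - f (x + t *\<^sub>R a) - f (x + t *\<^sub>R b) + f x"
        using ab unfolding q_def by (auto simp: doubleton_eq_iff algebra_simps)
      with eq t have q: "q t / (t * t) = pd b (pd a f) (x + s *\<^sub>R a + s' *\<^sub>R b)" by simp
      have "norm (s *\<^sub>R a + s' *\<^sub>R b) \<le> \<bar>s\<bar> * norm a + \<bar>s'\<bar> * norm b"
        by (metis norm_triangle_ineq norm_scaleR)
      also have "\<dots> \<le> t * norm a + t * norm b" using s by (intro add_mono mult_right_mono) auto
      also have "\<dots> < t * (norm a + norm b + 1)" using t by (simp add: algebra_simps)
      also have "\<dots> \<le> (k / (norm a + norm b + 1)) * (norm a + norm b + 1)"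
        using t unfolding m_def by (intro mult_right_mono) auto
      also have "\<dots> = k" by (smt (verit) norm_ge_zero nonzero_mult_div_cancel_right times_divide_eq_left)
      finally have "dist (x + s *\<^sub>R a + s' *\<^sub>R b) x < k" by (simp add: dist_norm add.assoc)
      then show ?thesis using k(2) q by simp
    qed
    then show "\<forall>\<^sub>F t in at_right 0. dist (q t / (t * t)) (pd b (pd a f) x) < e"
      unfolding eventually_at_right_field using m by blast
  qed
  have "{v, u} = {u, v}" by auto
  from tendsto_unique[OF _ lim[OF this] lim[OF refl]] show ?thesis by simp
qed

lemma pd_compose_linear:
  assumes "bounded_linear h" "f differentiable (at x)"
  shows "pd v (\<lambda>y. h (f y)) x = h (pd v f x)"
  by (intro pd_eqI bounded_linear.has_derivative[OF assms(1)] differentiable_has_pd assms)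

lemma pd_pd_commute:
  fixes f :: "'a::euclidean_space \<Rightarrow> 'b::euclidean_space"
  assumes f: "smooth U f" and x: "x \<in> U"
  shows "pd u (pd v f) x = pd v (pd u f) x"
proof (rule euclidean_eqI)
  fix b :: 'b
  have bl: "bounded_linear (\<lambda>y. y \<bullet> b)" by (rule bounded_linear_inner_left)
  have 1: "pd w (\<lambda>y. f y \<bullet> b) y = pd w f y \<bullet> b" if "y \<in> U" for y w
    using pd_compose_linear[OF bl smooth_differentiable[OF f that]] .
  have "pd w (pd w' f) x \<bullet> b = pd w (pd w' (\<lambda>y. f y \<bullet> b)) x" for w w'
  proof -
    have "pd w (pd w' f) x \<bullet> b = pd w (\<lambda>y. pd w' f y \<bullet> b) x"
      by (rule pd_compose_linear[OF bl smooth_differentiable[OF smooth_pd[OF f] x], symmetric])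
    also have "\<dots> = pd w (pd w' (\<lambda>y. f y \<bullet> b)) x"
      by (rule fun_cong[OF frechet_derivative_transform_within_open[OF _ smooth_open[OF f] x]])
        (use 1 smooth_differentiable[OF smooth_compose_linear[OF bl smooth_pd[OF f]] x] in auto)
    finally show ?thesis .
  qed
  with pd_pd_commute_real[OF smooth_compose_linear[OF bl f] x]
  show "pd u (pd v f) x \<bullet> b = pd v (pd u f) x \<bullet> b" by simp
qed

subsection \<open>Differentiation on the sphere\<close>

lemma open_punctured: "open (- {0::'a::euclidean_space})"
  by (rule open_Compl) simp

lemma sphere_nonzero: "x \<in> S6 \<Longrightarrow> x \<noteq> 0" by auto

lemma sgn_sphere: "x \<in> S6 \<Longrightarrow> sgn x = x" by (simp add: sgn_div_norm)

lemma sgn_in_sphere: "y \<noteq> 0 \<Longrightarrow> sgn y \<in> S6" by (simp add: norm_sgn)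

lemma sphere_inner_self: "x \<in> S6 \<Longrightarrow> x \<bullet> x = 1" by (simp add: norm_eq_1)

lemma tangential_field_tangent: "x \<in> S6 \<Longrightarrow> tangential_field v x \<in> tangent x"
  by (simp add: tangent_def tangential_field_def inner_diff_left sphere_inner_self)

lemma tangential_field_id: "v \<in> tangent x \<Longrightarrow> tangential_field v x = v"
  by (simp add: tangent_def tangential_field_def)

lemma tangential_field_self: "x \<in> S6 \<Longrightarrow> tangential_field x x = 0"
  by (simp add: tangential_field_def sphere_inner_self)

lemma linear_tangential_field: "linear (\<lambda>v. tangential_field v x)"
  by (rule linearI) (simp_all add: tangential_field_def algebra_simps)

lemma tangent_subspace: "subspace (tangent x)"
  by (simp add: subspace_def tangent_def inner_add_left)

text \<open>The radially constant extension \<open>f (sgn y)\<close> is the device that replaces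
  calculus on the sphere by partial derivatives on an open set. Each local extension of
  \<open>f\<close> is precomposed with \<open>sgn\<close>, so the choice of extension
  disappears.\<close>

lemma smooth_hat:
  assumes "smooth_on S6 f" shows "smooth (- {0}) (\<lambda>y. f (sgn y))"
proof (rule smooth_local[OF open_punctured])
  fix y :: "real^7" assume y: "y \<in> - {0}"
  then have sy: "sgn y \<in> S6" by (simp add: norm_sgn)
  then obtain U F where U: "open U" "sgn y \<in> U" "\<forall>k. Ck_on k U F" "\<forall>z\<in>U \<inter> S6. F z = f z"
    using assms unfolding smooth_on_def by blast
  define W where "W = sgn -` U \<inter> - {0::real^7}"
  have W: "open W" unfolding W_def
    by (rule continuous_open_preimage[OF smooth_continuous_on[OF smooth_sgn] open_punctured U(1), unfolded Int_commute[of "- {0}"]])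
  have "smooth W (\<lambda>z. F (sgn z))"
    by (rule smooth_compose[of U F W sgn])
      (use U W smooth_subset[OF smooth_sgn W] in \<open>auto simp: W_def smooth_def\<close>)
  then have "smooth W (\<lambda>z. f (sgn z))"
    by (rule smooth_cong[rotated]) (use U(4) in \<open>auto simp: W_def norm_sgn\<close>)
  moreover have "y \<in> W" using y U(2) by (simp add: W_def)
  ultimately show "\<exists>W. y \<in> W \<and> smooth W (\<lambda>z. f (sgn z))" by (intro exI[of _ W] conjI)
qed

lemma smooth_on_sphereI:
  assumes "smooth (- {0}) F" "\<And>x. x \<in> S6 \<Longrightarrow> F x = f x" shows "smooth_on S6 f"
  unfolding smooth_on_def
proof
  fix x :: "real^7" assume "x \<in> S6"
  then show "\<exists>U F. open U \<and> x \<in> U \<and> (\<forall>k. Ck_on k U F) \<and> (\<forall>y\<in>U \<inter> S6. F y = f y)"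
    using assms unfolding smooth_def by (intro exI[of _ "- {0}"] exI[of _ F]) auto
qed

lemma continuous_sphere: "smooth (- {0}) f \<Longrightarrow> continuous_on S6 f"
  by (rule continuous_on_subset[OF smooth_continuous_on]) auto

lemma smooth_on_sphere_continuous:
  fixes f :: "real^7 \<Rightarrow> 'b::real_normed_vector"
  assumes "smooth_on S6 f" shows "continuous_on S6 f"
  by (rule continuous_on_eq[OF continuous_sphere[OF smooth_hat[OF assms]]]) (simp add: sgn_sphere)

lemma has_derivative_sgn_sphere:
  fixes x :: "real^7" assumes "x \<in> S6" shows "(sgn has_derivative (\<lambda>v. tangential_field v x)) (at x)"
proof -
  have nz: "x \<noteq> 0" and n1: "norm x = 1" using assms by auto
  have nd: "(norm has_derivative (\<lambda>h. h \<bullet> x)) (at x)"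
    using has_derivative_norm[OF nz] by (simp add: sgn_sphere[OF assms])
  have "((\<lambda>y. inverse (norm y) *\<^sub>R y) has_derivative (\<lambda>v. tangential_field v x)) (at x)"
    using nz n1 nd
    by (auto intro!: derivative_eq_intros simp: tangential_field_def inner_commute)
  then show ?thesis by (simp flip: sgn_div_norm)
qed

text \<open>\<open>sphere_deriv\<close> is an arbitrary choice among derivatives within
  \<open>S6\<close>. On a tangent vector it is pinned down by the curve
  \<open>sgn (x + t *\<^sub>R u)\<close>, which stays on the sphere and has velocity
  \<open>u\<close> at 0.\<close>

lemma sphere_deriv_eq_pd:
  assumes x: "x \<in> S6" and u: "u \<in> tangent x" and F: "F differentiable (at x)"
    and eq: "\<And>y. y \<in> S6 \<Longrightarrow> F y = f y"
  shows "sphere_deriv f x u = pd u F x"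
proof -
  define c where "c = (\<lambda>t::real. sgn (x + t *\<^sub>R u))"
  have ne: "x + t *\<^sub>R u \<noteq> 0" for t
  proof
    assume "x + t *\<^sub>R u = 0"
    then have "(x + t *\<^sub>R u) \<bullet> x = 0" by simp
    with u sphere_inner_self[OF x] show False by (simp add: tangent_def inner_add_left)
  qed
  have c0: "c 0 = x" unfolding c_def using sgn_sphere[OF x] by simp
  have line: "((\<lambda>t. x + t *\<^sub>R u) has_derivative (\<lambda>t. t *\<^sub>R u)) (at 0)"
    by (auto intro!: derivative_eq_intros)
  have sgn': "(sgn has_derivative (\<lambda>v. tangential_field v x)) (at (x + 0 *\<^sub>R u))"
    using has_derivative_sgn_sphere[OF x] by simp
  have tu: "tangential_field (t *\<^sub>R u) x = t *\<^sub>R u" for t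
    by (rule tangential_field_id) (use u in \<open>simp add: tangent_def\<close>)
  have cd: "(c has_derivative (\<lambda>t. t *\<^sub>R u)) (at 0)"
    using has_derivative_compose[OF line sgn'] unfolding c_def tu .
  have "(F has_derivative (\<lambda>v. pd v F x)) (at x within S6)"
    by (rule has_derivative_at_withinI[OF differentiable_has_pd[OF F]])
  then have fd: "(f has_derivative (\<lambda>v. pd v F x)) (at x within S6)"
    by (rule has_derivative_transform[OF x, rotated]) (simp add: eq)
  then have "(f has_derivative sphere_deriv f x) (at x within S6)"
    unfolding sphere_deriv_def using frechet_derivative_works differentiable_def by metis
  then have "(f has_derivative sphere_deriv f x) (at (c 0) within c ` UNIV)"
    unfolding c0 by (rule has_derivative_subset) (auto simp: c_def norm_sgn ne)
  from has_derivative_in_compose[OF cd this]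
  have 1: "((\<lambda>t. f (c t)) has_derivative (\<lambda>t. sphere_deriv f x (t *\<^sub>R u))) (at 0)" .
  have "(F has_derivative (\<lambda>v. pd v F x)) (at (c 0))" unfolding c0 by (rule differentiable_has_pd[OF F])
  from has_derivative_compose[OF cd this]
  have "((\<lambda>t. F (c t)) has_derivative (\<lambda>t. pd (t *\<^sub>R u) F x)) (at 0)" .
  moreover have "(\<lambda>t. F (c t)) = (\<lambda>t. f (c t))" by (rule ext, rule eq) (simp add: c_def norm_sgn ne)
  ultimately have "((\<lambda>t. f (c t)) has_derivative (\<lambda>t. pd (t *\<^sub>R u) F x)) (at 0)" by simp
  from has_derivative_unique[OF 1 this] have "sphere_deriv f x (1 *\<^sub>R u) = pd (1 *\<^sub>R u) F x" by metis
  then show ?thesis by simp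
qed

lemma sphere_deriv_eq_pd_smooth:
  assumes "x \<in> S6" "u \<in> tangent x" "smooth (- {0}) F" "\<And>y. y \<in> S6 \<Longrightarrow> F y = f y"
  shows "sphere_deriv f x u = pd u F x"
  by (rule sphere_deriv_eq_pd[OF assms(1,2) smooth_differentiable[OF assms(3)] assms(4)])
    (use assms(1) in auto)

lemma sphere_deriv_hat:
  assumes "smooth_on S6 f" "x \<in> S6" "u \<in> tangent x"
  shows "sphere_deriv f x u = pd u (\<lambda>y. f (sgn y)) x"
  by (rule sphere_deriv_eq_pd_smooth[OF assms(2,3) smooth_hat[OF assms(1)]]) (simp add: sgn_sphere)

lemma pd_homogeneous:
  fixes F :: "'a::real_normed_vector \<Rightarrow> 'b::real_normed_vector"
  assumes hom: "\<And>z. F (c *\<^sub>R z) = F z" and c: "c \<noteq> 0" and F: "F differentiable (at y)"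
  shows "pd v F (c *\<^sub>R y) = (1 / c) *\<^sub>R pd v F y"
proof -
  have "((\<lambda>z. (1 / c) *\<^sub>R z) has_derivative (\<lambda>v. (1 / c) *\<^sub>R v)) (at (c *\<^sub>R y))"
    by (auto intro!: derivative_eq_intros)
  moreover have "(F has_derivative (\<lambda>v. pd v F y)) (at ((1 / c) *\<^sub>R (c *\<^sub>R y)))"
    using differentiable_has_pd[OF F] c by simp
  ultimately have "((\<lambda>z. F ((1 / c) *\<^sub>R z)) has_derivative (\<lambda>v. pd ((1 / c) *\<^sub>R v) F y)) (at (c *\<^sub>R y))"
    by (rule has_derivative_compose)
  moreover have "F ((1 / c) *\<^sub>R z) = F z" for z using hom[of "(1 / c) *\<^sub>R z"] c by simp
  ultimately have "(F has_derivative (\<lambda>v. pd ((1 / c) *\<^sub>R v) F y)) (at (c *\<^sub>R y))" by simp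
  from pd_eqI[OF this] show ?thesis by (simp add: linear_scale[OF linear_frechet_derivative[OF F]])
qed

lemma pd_radial:
  assumes hom: "\<And>c z. c > 0 \<Longrightarrow> F (c *\<^sub>R z) = F z" and F: "F differentiable (at y)"
  shows "pd y F y = 0"
proof -
  have line: "((\<lambda>t. t *\<^sub>R y) has_derivative (\<lambda>t. t *\<^sub>R y)) (at (1::real))"
    by (auto intro!: derivative_eq_intros)
  have "(F has_derivative (\<lambda>v. pd v F y)) (at (1 *\<^sub>R y))" using differentiable_has_pd[OF F] by simp
  from has_derivative_compose[OF line this]
  have "((\<lambda>t. F (t *\<^sub>R y)) has_derivative (\<lambda>t. pd (t *\<^sub>R y) F y)) (at 1)" .
  moreover have "((\<lambda>t. F (t *\<^sub>R y)) has_derivative (\<lambda>t. 0)) (at (1::real))"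
    by (rule has_derivative_transform_within_open[of "\<lambda>_. F y" _ _ UNIV "{0<..}"]) (simp_all add: hom)
  ultimately have "(\<lambda>t. pd (t *\<^sub>R y) F y) = (\<lambda>t::real. 0)" by (rule has_derivative_unique)
  from fun_cong[OF this, of 1] show ?thesis by simp
qed

lemma sgn_scale_pos: "c > 0 \<Longrightarrow> sgn (c *\<^sub>R z) = sgn (z::'a::real_normed_vector)"
  by (simp add: sgn_div_norm)

lemma pd_hat_radial:
  "smooth_on S6 f \<Longrightarrow> x \<noteq> 0 \<Longrightarrow> pd x (\<lambda>y. f (sgn y)) x = 0"
  by (rule pd_radial[of "\<lambda>y. f (sgn y)"])
    (auto simp only: sgn_scale_pos intro!: smooth_differentiable[OF smooth_hat])

lemma pd_linear: "f differentiable (at x) \<Longrightarrow> linear (\<lambda>v. pd v f x)"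
  by (rule linear_frechet_derivative)

lemma pd_hat_tangential:
  assumes "smooth_on S6 f" "x \<in> S6"
  shows "pd (tangential_field v x) (\<lambda>y. f (sgn y)) x = pd v (\<lambda>y. f (sgn y)) x"
proof -
  have x0: "x \<noteq> 0" using assms(2) by auto
  then have "(\<lambda>y. f (sgn y)) differentiable (at x)"
    by (intro smooth_differentiable[OF smooth_hat[OF assms(1)]]) auto
  note lin = pd_linear[OF this]
  show ?thesis unfolding tangential_field_def
    by (simp add: linear_diff[OF lin] linear_scale[OF lin] pd_hat_radial[OF assms(1) x0])
qed

lemma smooth_tangential_hat: "smooth (- {0}) (\<lambda>y. tangential_field v (sgn y))"
  unfolding tangential_field_def
  by (rule smooth_diff[OF smooth_const[OF open_punctured] smooth_scaleR[OF smooth_inner[OF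
    smooth_const[OF open_punctured] smooth_sgn] smooth_sgn]])

lemma vector_field_tangential: "vector_field (tangential_field v)"
proof -
  have "smooth (- {0}) (tangential_field v)"
    unfolding tangential_field_def
    by (rule smooth_diff[OF smooth_const[OF open_punctured] smooth_scaleR[OF smooth_inner[OF
      smooth_const[OF open_punctured] smooth_ident[OF open_punctured]] smooth_ident[OF open_punctured]]])
  then show ?thesis unfolding vector_field_def
    by (auto intro: smooth_on_sphereI tangential_field_tangent)
qed

text \<open>The derivative is purely normal, so projection fields of tangent vectors are parallel at
  \<open>x\<close> for the round connection. This is what makes them convenient extensions for
  computing \<open>\<nabla>\<omega>\<close> at a point.\<close>

lemma pd_tangential_field:
  assumes "x \<in> S6" "u \<in> tangent x" "v \<in> tangent x"
  shows "pd u (\<lambda>y. tangential_field v (sgn y)) x = - (u \<bullet> v) *\<^sub>R x"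
proof -
  have "(sgn has_derivative (\<lambda>v. tangential_field v x)) (at x)" by (rule has_derivative_sgn_sphere[OF assms(1)])
  then have "((\<lambda>y. v - (v \<bullet> sgn y) *\<^sub>R sgn y) has_derivative
      (\<lambda>w. - ((v \<bullet> x) *\<^sub>R tangential_field w x + (v \<bullet> tangential_field w x) *\<^sub>R x))) (at x)"
    by (auto intro!: derivative_eq_intros simp: sgn_sphere[OF assms(1)])
  then have "((\<lambda>y. tangential_field v (sgn y)) has_derivative
      (\<lambda>w. - ((v \<bullet> x) *\<^sub>R tangential_field w x + (v \<bullet> tangential_field w x) *\<^sub>R x))) (at x)"
    by (simp only: tangential_field_def[of v])
  from pd_eqI[OF this, of u] show ?thesis
    using assms by (simp add: tangential_field_id) (simp add: tangent_def inner_commute)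
qed

text \<open>Smoothness of J is given on the tangent bundle as a subset of R^7 x R^7. The map
  \<open>?G\<close> sends the punctured space into that bundle, so local extensions of J can be
  composed with it.\<close>

lemma smooth_structure_hat:
  assumes "almost_complex J"
  shows "smooth (- {0}) (\<lambda>y. J (sgn y) (tangential_field v (sgn y)))"
proof (rule smooth_local[OF open_punctured])
  let ?G = "\<lambda>y::real^7. (sgn y, tangential_field v (sgn y))"
  have G: "smooth (- {0}) ?G" by (rule smooth_Pair[OF smooth_sgn smooth_tangential_hat])
  fix y :: "real^7" assume y: "y \<in> - {0}"
  have TB: "?G z \<in> tangent_bundle" if "z \<noteq> 0" for z
    using that tangential_field_tangent[OF sgn_in_sphere[OF that]] by (simp add: tangent_bundle_def norm_sgn)
  have "smooth_on tangent_bundle (\<lambda>(x, v). J x v)" using assms by (simp add: almost_complex_def)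
  then obtain U F where U: "open U" "?G y \<in> U" "\<forall>k. Ck_on k U F" "\<forall>z\<in>U \<inter> tangent_bundle. F z = (\<lambda>(x, v). J x v) z"
    using TB[of y] y unfolding smooth_on_def by blast
  define W where "W = ?G -` U \<inter> - {0::real^7}"
  have W: "open W" unfolding W_def
    by (rule continuous_open_preimage[OF smooth_continuous_on[OF G] open_punctured U(1), unfolded Int_commute[of "- {0}"]])
  have "smooth W (\<lambda>z. F (?G z))"
    by (rule smooth_compose[of U F W ?G])
      (use U W smooth_subset[OF G W] in \<open>auto simp: W_def smooth_def\<close>)
  then have "smooth W (\<lambda>z. J (sgn z) (tangential_field v (sgn z)))"
    by (rule smooth_cong[rotated]) (use U(4) TB in \<open>auto simp: W_def\<close>)
  moreover have "y \<in> W" using y U(2) by (simp add: W_def)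
  ultimately show "\<exists>W. y \<in> W \<and> smooth W (\<lambda>z. J (sgn z) (tangential_field v (sgn z)))"
    by (intro exI[of _ W] conjI)
qed

subsection \<open>The calibrating quadratic form on three-tensors\<close>

lemma linear_contraction:
  fixes l :: "'a::euclidean_space \<Rightarrow> real"
  assumes "linear l" shows "(\<Sum>b\<in>Basis. (v \<bullet> b) * l b) = l v"
proof -
  have "l v = l (\<Sum>b\<in>Basis. (v \<bullet> b) *\<^sub>R b)" by (simp add: euclidean_representation)
  also have "\<dots> = (\<Sum>b\<in>Basis. (v \<bullet> b) * l b)" using assms by (simp add: linear_sum linear_scale)
  finally show ?thesis by simp
qed

text \<open>
  \<open>M\<close> is an orthogonal complex structure on the range of the orthogonal projection \<open>P\<close>, a space of
  dimension six.
\<close>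

locale hermitian =
  fixes P M :: "'a::euclidean_space \<Rightarrow> 'a"
  assumes P_linear: "linear P" and M_linear: "linear M"
    and P_sym: "P u \<bullet> v = u \<bullet> P v" and P_P: "P (P u) = P u"
    and M_skew: "M u \<bullet> v = - (u \<bullet> M v)" and M_M: "M (M u) = - P u" and M_P: "M (P u) = M u"
    and P_trace: "(\<Sum>b\<in>Basis. P b \<bullet> b) = 6"
begin

lemma P_M: "P (M u) = M u"
proof -
  have "P (M u) = - M (M (M u))" using M_M[of "M u"] by simp
  then show ?thesis by (simp add: M_M linear_neg[OF M_linear] M_P)
qed

lemma M_M_inner: "M u \<bullet> M v = P u \<bullet> v"
  by (simp add: M_skew M_M P_sym)

text \<open>The algebraic type of \<open>\<nabla>\<omega>\<close>: forced by \<open>J\<^sup>2 = -1\<close> and the orthogonality of \<open>J\<close>.\<close>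

definition torsion_type :: "('a \<Rightarrow> 'a \<Rightarrow> 'a \<Rightarrow> real) \<Rightarrow> bool" where
  "torsion_type F \<longleftrightarrow> (\<forall>v w. linear (\<lambda>u. F u v w)) \<and> (\<forall>u w. linear (\<lambda>v. F u v w)) \<and> (\<forall>u v. linear (\<lambda>w. F u v w)) \<and>
     (\<forall>u v w. F u v w = - F u w v) \<and> (\<forall>u v w. F u (M v) w = F u v (M w)) \<and>
     (\<forall>u v w. F (P u) v w = F u v w) \<and> (\<forall>u v w. F u (P v) w = F u v w)"

text \<open>Here and in \<open>inner3\<close> the sums run over a basis of the ambient space. For
  tensors that factor through \<open>P\<close> the complement of its range contributes nothing, so
  these are the traces and norms of tensors on that range.\<close>

definition trace3 :: "('a \<Rightarrow> 'a \<Rightarrow> 'a \<Rightarrow> real) \<Rightarrow> 'a" where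
  "trace3 F = (\<Sum>c\<in>Basis. (\<Sum>a\<in>Basis. F a a c) *\<^sub>R c)"

definition inner3 :: "('a \<Rightarrow> 'a \<Rightarrow> 'a \<Rightarrow> real) \<Rightarrow> ('a \<Rightarrow> 'a \<Rightarrow> 'a \<Rightarrow> real) \<Rightarrow> real" where
  "inner3 F G = (\<Sum>a\<in>Basis. \<Sum>b\<in>Basis. \<Sum>c\<in>Basis. F a b c * G a b c)"

definition calib :: "('a \<Rightarrow> 'a \<Rightarrow> 'a \<Rightarrow> real) \<Rightarrow> real" where
  "calib F = trace3 F \<bullet> trace3 F - inner3 F (\<lambda>u v w. F v u w)"

text \<open>
  \<open>conf_tensor h\<close> is the change of \<open>\<nabla>\<omega>\<close> under a conformal change of metric, and \<open>conf_sym (M h)\<close>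
  its symmetrization.
\<close>

definition conf_tensor :: "'a \<Rightarrow> 'a \<Rightarrow> 'a \<Rightarrow> 'a \<Rightarrow> real" where
  "conf_tensor h u v w = (M v \<bullet> h) * (P u \<bullet> w) - (u \<bullet> M v) * (h \<bullet> w) - (v \<bullet> h) * (M u \<bullet> w)
     + (P u \<bullet> v) * (M h \<bullet> w)"

definition conf_sym :: "'a \<Rightarrow> 'a \<Rightarrow> 'a \<Rightarrow> 'a \<Rightarrow> real" where
  "conf_sym \<alpha> u v w = 2 * (P u \<bullet> v) * (\<alpha> \<bullet> w) - (v \<bullet> \<alpha>) * (P u \<bullet> w) - (u \<bullet> \<alpha>) * (P v \<bullet> w)
     - (M v \<bullet> \<alpha>) * (M u \<bullet> w) - (M u \<bullet> \<alpha>) * (M v \<bullet> w)"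

lemma torsion_typeD:
  assumes "torsion_type F"
  shows "linear (\<lambda>u. F u v w)" "linear (\<lambda>v. F u v w)" "linear (\<lambda>w. F u v w)"
    "F u v w = - F u w v" "F u (M v) w = F u v (M w)" "F (P u) v w = F u v w" "F u (P v) w = F u v w"
    "F u v (P w) = F u v w" "F u v v = 0" "F u v (M v) = 0"
proof -
  note D = assms[unfolded torsion_type_def]
  show "linear (\<lambda>u. F u v w)" "linear (\<lambda>v. F u v w)" "linear (\<lambda>w. F u v w)"
    "F u (M v) w = F u v (M w)" "F (P u) v w = F u v w" "F u (P v) w = F u v w"
    using D by blast+
  have sk: "F u v w = - F u w v" for u v w using D by blast
  show "F u v w = - F u w v" by (rule sk)
  show "F u v (P w) = F u v w" using D sk by metis
  show "F u v v = 0" using sk[of u v v] by simp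
  have "F u (M v) v = F u v (M v)" using D by blast
  then show "F u v (M v) = 0" using sk[of u v "M v"] by simp
qed

lemma trace3_inner:
  assumes "torsion_type F" shows "trace3 F \<bullet> w = (\<Sum>a\<in>Basis. F a a w)"
proof -
  have "trace3 F \<bullet> w = (\<Sum>c\<in>Basis. \<Sum>a\<in>Basis. (w \<bullet> c) * F a a c)"
    unfolding trace3_def inner_sum_left inner_scaleR_left sum_distrib_right inner_commute[of w]
    by (simp only: mult.commute)
  also have "\<dots> = (\<Sum>a\<in>Basis. \<Sum>c\<in>Basis. (w \<bullet> c) * F a a c)" by (rule sum.swap)
  also have "\<dots> = (\<Sum>a\<in>Basis. F a a w)" by (simp only: linear_contraction[OF torsion_typeD(3)[OF assms]])
  finally show ?thesis .
qed

lemma torsion_type_sum3: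
  assumes F: "torsion_type F"
  shows "(\<Sum>a\<in>Basis. F a \<alpha> a) = - (trace3 F \<bullet> \<alpha>)"
  by (subst torsion_typeD(4)[OF F]) (simp add: sum_negf trace3_inner[OF F])

text \<open>\<open>conf_sym\<close> and \<open>conf_tensor\<close> are sums of products of a
  covector with a bilinear form. Pairing such a product with \<open>F\<close> collapses to a single
  contraction of \<open>F\<close>; this lemma and the next two treat the three positions of the
  covector.\<close>

lemma contract_bc:
  assumes F: "torsion_type F"
  shows "inner3 F (\<lambda>u v w. (v \<bullet> \<alpha>) * (Q u \<bullet> w)) = (\<Sum>a\<in>Basis. F a \<alpha> (Q a))"
proof -
  have "(\<Sum>c\<in>Basis. F a b c * ((b \<bullet> \<alpha>) * (Q a \<bullet> c))) = (\<alpha> \<bullet> b) * F a b (Q a)" for a b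
    using arg_cong[OF linear_contraction[OF torsion_typeD(3)[OF F], of "Q a" a b], of "\<lambda>t. (\<alpha> \<bullet> b) * t"]
    by (simp only: sum_distrib_left inner_commute[of b \<alpha>] mult_ac)
  then show ?thesis unfolding inner3_def
    by (simp only: linear_contraction[OF torsion_typeD(2)[OF F]])
qed

lemma contract_ac:
  assumes F: "torsion_type F"
  shows "inner3 F (\<lambda>u v w. (u \<bullet> \<alpha>) * (Q v \<bullet> w)) = (\<Sum>a\<in>Basis. (a \<bullet> \<alpha>) * (\<Sum>b\<in>Basis. F a b (Q b)))"
proof -
  have "(\<Sum>c\<in>Basis. F a b c * ((a \<bullet> \<alpha>) * (Q b \<bullet> c))) = (a \<bullet> \<alpha>) * F a b (Q b)" for a b
    using arg_cong[OF linear_contraction[OF torsion_typeD(3)[OF F], of "Q b" a b], of "\<lambda>t. (a \<bullet> \<alpha>) * t"]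
    by (simp only: sum_distrib_left mult_ac)
  then show ?thesis unfolding inner3_def by (simp add: sum_distrib_left)
qed

lemma contract_ab:
  assumes F: "torsion_type F"
  shows "inner3 F (\<lambda>u v w. (Q u \<bullet> v) * (\<alpha> \<bullet> w)) = (\<Sum>a\<in>Basis. F a (Q a) \<alpha>)"
proof -
  have "(\<Sum>c\<in>Basis. F a b c * ((Q a \<bullet> b) * (\<alpha> \<bullet> c))) = (Q a \<bullet> b) * F a b \<alpha>" for a b
    using arg_cong[OF linear_contraction[OF torsion_typeD(3)[OF F], of \<alpha> a b], of "\<lambda>t. (Q a \<bullet> b) * t"]
    by (simp only: sum_distrib_left mult_ac)
  then show ?thesis unfolding inner3_def
    by (simp only: linear_contraction[OF torsion_typeD(2)[OF F]])
qed

lemma inner3_add_right: "inner3 F (\<lambda>u v w. G u v w + H u v w) = inner3 F G + inner3 F H"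
  by (simp add: inner3_def distrib_left sum.distrib)

lemma inner3_diff_right: "inner3 F (\<lambda>u v w. G u v w - H u v w) = inner3 F G - inner3 F H"
  by (simp add: inner3_def right_diff_distrib sum_subtractf)

lemma inner3_scale_right: "inner3 F (\<lambda>u v w. c * G u v w) = c * inner3 F G"
  by (simp add: inner3_def sum_distrib_left mult_ac)

lemma inner3_commute: "inner3 F G = inner3 G F"
  by (simp add: inner3_def mult_ac)

lemma inner3_swap: "inner3 (\<lambda>u v w. F v u w) (\<lambda>u v w. G v u w) = inner3 F G"
  unfolding inner3_def by (rule sum.swap)

text \<open>Two of the five terms contract the skew slots of \<open>F\<close> with \<open>P\<close>
  or \<open>M\<close> and vanish. The other three give 2, 1 and 1 times the trace term, the last one
  after moving \<open>M\<close> across the two skew slots.\<close>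

lemma inner3_conf_sym:
  assumes F: "torsion_type F" and \<alpha>: "P \<alpha> = \<alpha>"
  shows "inner3 F (conf_sym \<alpha>) = 4 * (trace3 F \<bullet> \<alpha>)"
proof -
  note D = torsion_typeD[OF F]
  have eq: "conf_sym \<alpha> = (\<lambda>u v w. 2 * ((P u \<bullet> v) * (\<alpha> \<bullet> w)) - (v \<bullet> \<alpha>) * (P u \<bullet> w) - (u \<bullet> \<alpha>) * (P v \<bullet> w)
     + (v \<bullet> M \<alpha>) * (M u \<bullet> w) + (u \<bullet> M \<alpha>) * (M v \<bullet> w))"
    by (intro ext) (simp add: conf_sym_def M_skew)
  have 3: "(\<Sum>a\<in>Basis. F a (M \<alpha>) (M a)) = trace3 F \<bullet> \<alpha>"
  proof -
    have "F a (M \<alpha>) (M a) = - F a \<alpha> a" for a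
      using D(5)[of a "M \<alpha>" a] by (simp add: M_M \<alpha> linear_neg[OF D(2)])
    then show ?thesis by (simp add: sum_negf torsion_type_sum3[OF F])
  qed
  show ?thesis unfolding eq inner3_add_right inner3_diff_right inner3_scale_right
      contract_ab[OF F] contract_bc[OF F] contract_ac[OF F] 3 D(7,8,9,10)
    using torsion_type_sum3[OF F, of \<alpha>] trace3_inner[OF F, of \<alpha>] by simp
qed

lemma inner3_conf_tensor:
  assumes F: "torsion_type F"
  shows "inner3 F (conf_tensor h) = 4 * (trace3 F \<bullet> M h)"
proof -
  note D = torsion_typeD[OF F]
  have eq: "conf_tensor h = (\<lambda>u v w. (M u \<bullet> v) * (h \<bullet> w) + (P u \<bullet> v) * (M h \<bullet> w)
      - (v \<bullet> M h) * (P u \<bullet> w) - (v \<bullet> h) * (M u \<bullet> w))"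
    by (intro ext) (simp add: conf_tensor_def M_skew)
  have 3: "(\<Sum>a\<in>Basis. F a h (M a)) = - (trace3 F \<bullet> M h)"
    unfolding D(5)[symmetric] by (rule torsion_type_sum3[OF F])
  show ?thesis unfolding eq inner3_add_right inner3_diff_right inner3_scale_right
      contract_ab[OF F] contract_bc[OF F] 3 D(5) D(7,8)
    using torsion_type_sum3[OF F, of "M h"] trace3_inner[OF F, of "M h"] by simp
qed

lemma P_commute: "P v \<bullet> u = P u \<bullet> v"
  by (metis P_sym inner_commute)

lemma conf_sym_commute: "conf_sym \<alpha> v u w = conf_sym \<alpha> u v w"
  by (simp add: conf_sym_def P_commute[of v u])

lemma torsion_type_conf_tensor:
  assumes h: "P h = h" shows "torsion_type (conf_tensor h)"
proof -
  have Ph: "P u \<bullet> h = u \<bullet> h" "h \<bullet> P u = h \<bullet> u" for u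
    using P_sym[of u h] P_sym[of h u] h by simp_all
  have skew: "conf_tensor h u v w = - conf_tensor h u w v" for u v w
    unfolding conf_tensor_def M_skew[of v h] M_skew[of w h] M_skew[of u v] M_skew[of u w]
      M_skew[of h v] M_skew[of h w] inner_commute[of h v] inner_commute[of h w]
      inner_commute[of v "M h"] inner_commute[of w "M h"] M_skew[of h v] M_skew[of h w]
    by simp
  have compat: "conf_tensor h u (M v) w = conf_tensor h u v (M w)" for u v w
  proof -
    have 1: "M (M v) \<bullet> h = - (v \<bullet> h)" by (simp add: M_M Ph)
    have 2: "u \<bullet> M (M v) = - (P u \<bullet> v)" by (simp add: M_M P_sym)
    have 3: "P u \<bullet> M v = u \<bullet> M v" "P u \<bullet> M w = u \<bullet> M w" by (simp_all add: P_sym P_M)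
    have 4: "M u \<bullet> M w = P u \<bullet> w" "M h \<bullet> M w = h \<bullet> w" by (simp_all add: M_M_inner h)
    show ?thesis unfolding conf_tensor_def 1 2 3 4 by (simp add: M_skew[of u w] M_skew[of h w])
  qed
  have P: "conf_tensor h (P u) v w = conf_tensor h u v w" "conf_tensor h u (P v) w = conf_tensor h u v w" for u v w
    by (simp_all add: conf_tensor_def M_P P_P Ph P_sym[of u "M v"] P_M P_sym[of u "P v"])
      (simp add: P_sym P_P)
  show ?thesis unfolding torsion_type_def
  proof (intro conjI allI P compat)
    show "conf_tensor h u v w = - conf_tensor h u w v" for u v w by (rule skew)
  qed (rule linearI; simp add: conf_tensor_def linear_add[OF M_linear] linear_add[OF P_linear]
      linear_scale[OF M_linear] linear_scale[OF P_linear] inner_add_left inner_add_right algebra_simps)+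
qed

lemma conf_sym_eq:
  assumes h: "P h = h" shows "conf_tensor h u v w + conf_tensor h v u w = conf_sym (M h) u v w"
proof -
  have PM: "P u \<bullet> h = u \<bullet> h" "P v \<bullet> h = v \<bullet> h" "u \<bullet> M v = - (v \<bullet> M u)"
    using P_sym[of _ h] h M_skew[of u v] by (simp_all add: inner_commute)
  have 1: "M v \<bullet> h = - (v \<bullet> M h)" "M u \<bullet> h = - (u \<bullet> M h)" by (simp_all add: M_skew)
  show ?thesis unfolding conf_tensor_def conf_sym_def M_M_inner PM 1 P_commute[of v u]
    by (simp add: algebra_simps)
qed

text \<open>The dimension enters the algebra here: the contractions give 2 * 6 - 2 - 2 = 8. Hence a
  tensor whose symmetrization is \<open>conf_sym \<alpha>\<close> has trace 4 times
  \<open>\<alpha>\<close>.\<close>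

lemma conf_sym_trace:
  assumes \<alpha>: "P \<alpha> = \<alpha>" shows "(\<Sum>a\<in>Basis. conf_sym \<alpha> a a w) = 8 * (\<alpha> \<bullet> w)"
proof -
  have lin: "linear (\<lambda>a. P a \<bullet> w)" "linear (\<lambda>a. M a \<bullet> w)"
    using linear_compose[OF P_linear bounded_linear.linear[OF bounded_linear_inner_left]]
      linear_compose[OF M_linear bounded_linear.linear[OF bounded_linear_inner_left]]
    by (simp_all add: o_def)
  have 1: "(\<Sum>a\<in>Basis. (\<alpha> \<bullet> a) * (P a \<bullet> w)) = \<alpha> \<bullet> w"
    using linear_contraction[OF lin(1)] \<alpha> by simp
  have 2: "(\<Sum>a\<in>Basis. (M \<alpha> \<bullet> a) * (M a \<bullet> w)) = - (\<alpha> \<bullet> w)"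
    using linear_contraction[OF lin(2), of "M \<alpha>"] by (simp add: M_M \<alpha>)
  have "conf_sym \<alpha> a a w = 2 * ((P a \<bullet> a) * (\<alpha> \<bullet> w)) - 2 * ((\<alpha> \<bullet> a) * (P a \<bullet> w)) + 2 * ((M \<alpha> \<bullet> a) * (M a \<bullet> w))" for a
    unfolding conf_sym_def M_skew[of a \<alpha>] inner_commute[of a \<alpha>] inner_commute[of a "M \<alpha>"] by simp
  then have "(\<Sum>a\<in>Basis. conf_sym \<alpha> a a w) = 2 * ((\<Sum>a\<in>Basis. P a \<bullet> a) * (\<alpha> \<bullet> w))
      - 2 * (\<Sum>a\<in>Basis. (\<alpha> \<bullet> a) * (P a \<bullet> w)) + 2 * (\<Sum>a\<in>Basis. (M \<alpha> \<bullet> a) * (M a \<bullet> w))"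
    by (simp add: sum.distrib sum_subtractf sum_distrib_left sum_distrib_right)
  with 1 2 P_trace show ?thesis by simp
qed

lemma trace3_of_sym:
  assumes F: "torsion_type F" and \<alpha>: "P \<alpha> = \<alpha>"
    and sym: "\<And>u v w. F u v w + F v u w = conf_sym \<alpha> u v w"
  shows "trace3 F = 4 *\<^sub>R \<alpha>"
proof -
  have "2 * (trace3 F \<bullet> w) = 8 * (\<alpha> \<bullet> w)" for w
  proof -
    have "(\<Sum>a\<in>Basis. F a a w + F a a w) = 8 * (\<alpha> \<bullet> w)" by (simp only: sym conf_sym_trace[OF \<alpha>])
    then show ?thesis unfolding sum.distrib trace3_inner[OF F] by simp
  qed
  then have "trace3 F \<bullet> w = (4 *\<^sub>R \<alpha>) \<bullet> w" for w by (simp add: field_simps)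
  then show ?thesis by (metis vector_eq_rdot)
qed

lemma P_trace3:
  assumes F: "torsion_type F" shows "P (trace3 F) = trace3 F"
proof -
  have "P (trace3 F) \<bullet> w = trace3 F \<bullet> w" for w
    by (simp add: P_sym trace3_inner[OF F] torsion_typeD(8)[OF F])
  then show ?thesis by (metis vector_eq_rdot)
qed

lemma inner3_conf_sym_self:
  assumes \<alpha>: "P \<alpha> = \<alpha>" shows "inner3 (conf_sym \<alpha>) (conf_sym \<alpha>) = 32 * (\<alpha> \<bullet> \<alpha>)"
proof -
  \<comment> \<open>With \<open>M h = \<alpha>\<close>, \<open>conf_sym \<alpha>\<close> becomes the
    symmetrization of a tensor of torsion type. Its norm is then twice a pairing that
    \<open>inner3_conf_sym\<close> already evaluates, so the five terms need not be squared.\<close>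
  define h where "h = - M \<alpha>"
  have h: "P h = h" "M h = \<alpha>" unfolding h_def
    by (simp_all add: P_M M_M \<alpha> linear_neg[OF P_linear] linear_neg[OF M_linear])
  note B = torsion_type_conf_tensor[OF h(1)]
  have tr: "trace3 (conf_tensor h) = 4 *\<^sub>R \<alpha>"
    using trace3_of_sym[OF B \<alpha>] conf_sym_eq[OF h(1)] h(2) by simp
  have eq: "conf_sym \<alpha> = (\<lambda>u v w. conf_tensor h u v w + conf_tensor h v u w)"
    by (intro ext) (simp add: conf_sym_eq[OF h(1)] h(2))
  have sw: "(\<lambda>u v w. conf_sym \<alpha> v u w) = conf_sym \<alpha>"
    by (intro ext) (simp add: eq)
  have "inner3 (conf_sym \<alpha>) (conf_sym \<alpha>)
      = inner3 (conf_sym \<alpha>) (conf_tensor h) + inner3 (conf_sym \<alpha>) (\<lambda>u v w. conf_tensor h v u w)"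
    by (subst (2) eq) (rule inner3_add_right)
  also have "inner3 (conf_sym \<alpha>) (\<lambda>u v w. conf_tensor h v u w) = inner3 (conf_sym \<alpha>) (conf_tensor h)"
    using inner3_swap[of "conf_sym \<alpha>" "conf_tensor h"] unfolding sw .
  also have "inner3 (conf_sym \<alpha>) (conf_tensor h) = 16 * (\<alpha> \<bullet> \<alpha>)"
    unfolding inner3_commute[of "conf_sym \<alpha>"] inner3_conf_sym[OF B \<alpha>] tr by simp
  finally show ?thesis by simp
qed

text \<open>The factor 1/4 makes the defect traceless: the symmetrization of \<open>F\<close> has
  trace 2 \<open>trace3 F\<close>, and \<open>conf_sym \<alpha>\<close> has trace 8 times
  \<open>\<alpha>\<close>. So this is the symmetrization minus its orthogonal projection to the
  conformal type.\<close>

definition defect :: "('a \<Rightarrow> 'a \<Rightarrow> 'a \<Rightarrow> real) \<Rightarrow> 'a \<Rightarrow> 'a \<Rightarrow> 'a \<Rightarrow> real" where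
  "defect F u v w = F u v w + F v u w - conf_sym ((1 / 4) *\<^sub>R trace3 F) u v w"

text \<open>Expand the square of the defect. In dimension d the same expansion would leave |tr F|^2
  with coefficient 4/(d - 2); only d = 6 turns it into the coefficient 1 that \<open>calib\<close>
  has.\<close>

lemma calib_defect:
  assumes F: "torsion_type F"
  shows "inner3 F F - calib F = inner3 (defect F) (defect F) / 2"
proof -
  define \<alpha> where "\<alpha> = (1 / 4) *\<^sub>R trace3 F"
  have \<alpha>: "P \<alpha> = \<alpha>" unfolding \<alpha>_def by (simp add: linear_scale[OF P_linear] P_trace3[OF F])
  let ?F = "\<lambda>u v w. F v u w"
  have sw: "(\<lambda>u v w. conf_sym \<alpha> v u w) = conf_sym \<alpha>"
    by (intro ext) (rule conf_sym_commute)
  have 1: "inner3 F (conf_sym \<alpha>) = 16 * (\<alpha> \<bullet> \<alpha>)"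
    unfolding inner3_conf_sym[OF F \<alpha>] by (simp add: \<alpha>_def)
  have 2: "inner3 ?F (conf_sym \<alpha>) = 16 * (\<alpha> \<bullet> \<alpha>)"
    using inner3_swap[of F "conf_sym \<alpha>"] 1 unfolding sw by simp
  have 3: "inner3 ?F ?F = inner3 F F" using inner3_swap[of F F] by simp
  have d: "defect F = (\<lambda>u v w. F u v w + F v u w - conf_sym \<alpha> u v w)"
    by (intro ext) (simp add: defect_def \<alpha>_def)
  have "inner3 (defect F) (defect F)
      = inner3 (defect F) F + inner3 (defect F) ?F - inner3 (defect F) (conf_sym \<alpha>)"
    by (subst (2) d) (simp only: inner3_diff_right inner3_add_right)
  also have "\<dots> = 2 * inner3 F F + 2 * inner3 F ?F - 4 * (16 * (\<alpha> \<bullet> \<alpha>)) + 32 * (\<alpha> \<bullet> \<alpha>)"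
    unfolding inner3_commute[of "defect F"] unfolding d
    by (simp only: inner3_diff_right inner3_add_right 1 2 3 inner3_commute[of ?F F]
        inner3_commute[of "conf_sym \<alpha>" F] inner3_commute[of "conf_sym \<alpha>" ?F] inner3_conf_sym_self[OF \<alpha>])
  finally show ?thesis unfolding calib_def by (simp add: \<alpha>_def)
qed

lemma inner3_self_nonneg: "0 \<le> inner3 F F"
  by (simp add: inner3_def sum_nonneg)

lemma calib_le: "torsion_type F \<Longrightarrow> calib F \<le> inner3 F F"
  using calib_defect[of F] inner3_self_nonneg[of "defect F"] by simp

lemma calib_eq:
  assumes F: "torsion_type F" and \<alpha>: "P \<alpha> = \<alpha>"
    and sym: "\<And>u v w. F u v w + F v u w = conf_sym \<alpha> u v w"
  shows "calib F = inner3 F F"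
proof -
  have "defect F = (\<lambda>u v w. 0)"
    by (intro ext) (simp add: defect_def trace3_of_sym[OF F \<alpha> sym] sym)
  then show ?thesis using calib_defect[OF F] by (simp add: inner3_def)
qed

lemma torsion_type_combination:
  assumes F: "torsion_type F" and G: "torsion_type G"
  shows "torsion_type (\<lambda>u v w. a * F u v w + b * G u v w)"
proof -
  have lin: "linear (\<lambda>x. a * f x + b * g x)" if "linear f" "linear g" for f g :: "'a \<Rightarrow> real"
    using that by (intro linearI) (simp_all add: linear_add linear_scale algebra_simps)
  have skew: "a * F u v w + b * G u v w = - (a * F u w v + b * G u w v)" for u v w
    using torsion_typeD(4)[OF F, of u v w] torsion_typeD(4)[OF G, of u v w] by simp
  show ?thesis unfolding torsion_type_def
  proof (intro conjI allI)
    show "a * F u v w + b * G u v w = - (a * F u w v + b * G u w v)" for u v w by (rule skew)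
    show "linear (\<lambda>u. a * F u v w + b * G u v w)" for v w
      by (rule lin[OF torsion_typeD(1)[OF F] torsion_typeD(1)[OF G]])
    show "linear (\<lambda>v. a * F u v w + b * G u v w)" for u w
      by (rule lin[OF torsion_typeD(2)[OF F] torsion_typeD(2)[OF G]])
    show "linear (\<lambda>w. a * F u v w + b * G u v w)" for u v
      by (rule lin[OF torsion_typeD(3)[OF F] torsion_typeD(3)[OF G]])
  qed (simp_all only: torsion_typeD(5-7)[OF F] torsion_typeD(5-7)[OF G])
qed

lemma trace3_combination:
  "trace3 (\<lambda>u v w. a * F u v w + b * G u v w) = a *\<^sub>R trace3 F + b *\<^sub>R trace3 G"
  unfolding trace3_def
  by (simp add: sum.distrib scaleR_left_distrib scaleR_sum_right flip: sum_distrib_left)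

text \<open>The conformal part lies in the kernel of the defect.\<close>

lemma calib_combination:
  assumes F: "torsion_type F" and h: "P h = h"
  shows "calib (\<lambda>u v w. a * F u v w + (1 / 2) * conf_tensor h u v w)
    = a\<^sup>2 * calib F + 4 * a * (trace3 F \<bullet> M h) + 4 * (h \<bullet> h)"
proof -
  let ?B = "conf_tensor h" and ?G = "\<lambda>u v w. a * F u v w + (1 / 2) * conf_tensor h u v w"
  note B = torsion_type_conf_tensor[OF h]
  have trB: "trace3 ?B = 4 *\<^sub>R M h" by (rule trace3_of_sym[OF B P_M conf_sym_eq[OF h]])
  have sym: "conf_sym (x *\<^sub>R \<alpha> + y *\<^sub>R \<beta>) u v w = x * conf_sym \<alpha> u v w + y * conf_sym \<beta> u v w" for x y \<alpha> \<beta> u v w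
    unfolding conf_sym_def inner_add_left inner_add_right inner_scaleR_left inner_scaleR_right
    by (simp add: algebra_simps)
  have "defect ?G u v w = a * defect F u v w" for u v w
  proof -
    have "(1 / 4) *\<^sub>R trace3 ?G = a *\<^sub>R ((1 / 4) *\<^sub>R trace3 F) + (1 / 2) *\<^sub>R M h"
      unfolding trace3_combination[of a F "1 / 2"] trB scaleR_right_distrib by simp
    then show ?thesis
      using conf_sym_eq[OF h, of u v w] by (simp only: defect_def sym) (simp add: field_simps)
  qed
  then have d: "inner3 (defect ?G) (defect ?G) = a\<^sup>2 * inner3 (defect F) (defect F)"
    by (simp add: inner3_def sum_distrib_left power2_eq_square mult_ac)
  have "inner3 ?G ?G = a * inner3 ?G F + (1 / 2) * inner3 ?G ?B"
    by (simp only: inner3_add_right inner3_scale_right)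
  also have "\<dots> = a * (a * inner3 F F + (1 / 2) * inner3 F ?B) + (1 / 2) * (a * inner3 ?B F + (1 / 2) * inner3 ?B ?B)"
    unfolding inner3_commute[of ?G] by (simp only: inner3_add_right inner3_scale_right)
  also have "\<dots> = a\<^sup>2 * inner3 F F + 4 * a * (trace3 F \<bullet> M h) + 4 * (h \<bullet> h)"
    unfolding inner3_commute[of ?B F] inner3_conf_tensor[OF F] inner3_conf_tensor[OF B] trB
    by (simp add: M_M_inner h power2_eq_square algebra_simps)
  finally have "inner3 ?G ?G = a\<^sup>2 * inner3 F F + 4 * a * (trace3 F \<bullet> M h) + 4 * (h \<bullet> h)" .
  \<comment> \<open>The gap between norm and calibration is half the squared defect, hence scales by
    \<open>a\<^sup>2\<close>. Only the norm had to be expanded.\<close>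
  moreover have "calib ?G = inner3 ?G ?G - a\<^sup>2 * (inner3 F F - calib F)"
    using calib_defect[OF torsion_type_combination[OF F B, of a "1 / 2"]] unfolding calib_defect[OF F] d
    by simp
  ultimately show ?thesis by (simp only: right_diff_distrib)
qed

end

subsection \<open>Integrals over Euclidean space\<close>

lemma power_swap: "((a::real) ^ m) ^ n = (a ^ n) ^ m"
  by (subst (1 2) power_mult[symmetric]) (simp only: mult.commute)

lemma one_plus_square_pos: "0 < 1 + (r::real)\<^sup>2"
  by (rule add_pos_nonneg) simp_all

text \<open>Decay of order 8 against volume growth of order 6, summed over dyadic balls. Outside
  radius 2^k the function is at most 256^-k, the ball of radius 2^(k+1) has volume 64 * 64^k times
  that of the unit ball, and the ratio 64/256 = 1/4 gives a geometric series.\<close>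

lemma integrable_inverse_power:
  "integrable lborel (\<lambda>y::real^6. 1 / (1 + (norm y)\<^sup>2) ^ 4)" (is "integrable _ ?f")
proof (rule integrableI_bounded)
  show "?f \<in> borel_measurable lborel" by measurable
  define B where "B = (\<lambda>k::nat. ball (0::real^6) (2 ^ (k + 1)))"
  define V where "V = unit_ball_vol (real 6)"
  have V: "V \<ge> 0" unfolding V_def by simp
  have bound: "ennreal (norm (?f y)) \<le> (\<Sum>k. ennreal ((1 / 256) ^ k) * indicator (B k) y)" for y
  proof -
    obtain n :: nat where "norm y < 2 ^ n" using real_arch_pow[of 2 "norm y"] by auto
    then have ex: "\<exists>k. norm y < 2 ^ (k + 1)" by (intro exI[of _ n]) (auto simp: less_le_trans)
    define k where "k = (LEAST k. norm y < 2 ^ (k + 1))"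
    have k: "norm y < 2 ^ (k + 1)" unfolding k_def using LeastI_ex[OF ex] .
    have "?f y \<le> (1 / 256) ^ k"
    proof (cases k)
      case 0
      have "1 \<le> (1 + (norm y)\<^sup>2) ^ 4" by (rule one_le_power) simp
      with 0 show ?thesis by (simp add: divide_le_eq_1)
    next
      case (Suc j)
      then have "\<not> norm y < 2 ^ (j + 1)" using not_less_Least[of j "\<lambda>k. norm y < 2 ^ (k + 1)"] k_def by simp
      then have "2 ^ k \<le> norm y" using Suc by simp
      then have "(2 ^ k)\<^sup>2 \<le> (norm y)\<^sup>2" by (intro power_mono) auto
      then have "(2 ^ k)\<^sup>2 \<le> 1 + (norm y)\<^sup>2" by linarith
      then have "((2 ^ k)\<^sup>2) ^ 4 \<le> (1 + (norm y)\<^sup>2) ^ 4" by (rule power_mono) simp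
      then have "(256::real) ^ k \<le> (1 + (norm y)\<^sup>2) ^ 4"
      proof -
        have "((2 ^ k)\<^sup>2) ^ 4 = ((2 ^ k) ^ (2 * 4) :: real)" by (rule power_mult[symmetric])
        also have "\<dots> = ((2 ^ (2 * 4)) ^ k :: real)" by (rule power_swap)
        finally have "((2 ^ k)\<^sup>2) ^ 4 = ((2 ^ 8) ^ k :: real)" by simp
        with \<open>((2 ^ k)\<^sup>2) ^ 4 \<le> (1 + (norm y)\<^sup>2) ^ 4\<close> show ?thesis by simp
      qed
      then have "?f y \<le> 1 / 256 ^ k" by (intro divide_left_mono mult_pos_pos zero_less_power one_plus_square_pos) auto
      then show ?thesis by (simp add: power_one_over)
    qed
    define T where "T = (\<lambda>k. ennreal ((1 / 256) ^ k) * indicator (B k) y)"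
    have "ennreal (norm (?f y)) \<le> T k"
      using k \<open>?f y \<le> (1 / 256) ^ k\<close> by (auto simp: T_def B_def intro!: ennreal_leI)
    also have "T k = sum T {k}" by simp
    also have "\<dots> \<le> suminf T" by (rule sum_le_suminf) auto
    finally show ?thesis unfolding T_def .
  qed
  have "(\<integral>\<^sup>+ y. ennreal (norm (?f y)) \<partial>lborel) \<le> (\<integral>\<^sup>+ y. (\<Sum>k. ennreal ((1 / 256) ^ k) * indicator (B k) y) \<partial>lborel)"
    by (rule nn_integral_mono) (rule bound)
  also have "\<dots> = (\<Sum>k. \<integral>\<^sup>+ y. ennreal ((1 / 256) ^ k) * indicator (B k) y \<partial>lborel)"
    by (rule nn_integral_suminf, rule borel_measurable_times_ennreal[OF borel_measurable_const
          borel_measurable_indicator]) (simp add: B_def)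
  also have "\<dots> = (\<Sum>k. ennreal (64 * V * (1 / 4) ^ k))"
  proof (rule suminf_cong)
    fix k
    have "(\<integral>\<^sup>+ y. ennreal ((1 / 256) ^ k) * indicator (B k) y \<partial>lborel) = ennreal ((1 / 256) ^ k) * emeasure lborel (B k)"
      by (rule nn_integral_cmult_indicator) (simp add: B_def)
    also have "\<dots> = ennreal ((1 / 256) ^ k * (V * (2 ^ (k + 1)) ^ 6))"
      unfolding B_def V_def using emeasure_ball[of "2 ^ (k + 1)" "0::real^6"]
      by (simp add: ennreal_mult)
    also have "(1 / 256) ^ k * (V * (2 ^ (k + 1)) ^ 6) = 64 * V * ((1 / 256) ^ k * 64 ^ k)"
    proof -
      have "((2 ^ k) ^ 6 :: real) = (2 ^ 6) ^ k" by (rule power_swap)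
      then show ?thesis by (simp add: power_mult_distrib)
    qed
    also have "(1 / 256) ^ k * 64 ^ k = (1 / 4 :: real) ^ k"
      by (simp flip: power_mult_distrib)
    finally show "(\<integral>\<^sup>+ y. ennreal ((1 / 256) ^ k) * indicator (B k) y \<partial>lborel) = ennreal (64 * V * (1 / 4) ^ k)" .
  qed
  also have "\<dots> < \<infinity>"
  proof -
    have "summable (\<lambda>k. 64 * V * (1 / 4) ^ k)"
      by (rule summable_mult[OF summable_geometric]) simp
    then have "(\<Sum>k. ennreal (64 * V * (1 / 4) ^ k)) \<noteq> top"
      by (rule ennreal_suminf_neq_top) (use V in simp)
    then have "(\<Sum>k. ennreal (64 * V * (1 / 4) ^ k)) < top" by (rule less_top[THEN iffD1])
    then show ?thesis by (simp only: infinity_ennreal_def)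
  qed
  finally show "(\<integral>\<^sup>+ y. ennreal (norm (?f y)) \<partial>lborel) < \<infinity>" .
qed

lemma lborel_integral_translate:
  fixes f :: "'a::euclidean_space \<Rightarrow> real"
  assumes "f \<in> borel_measurable borel"
  shows "(\<integral>y. f (c + y) \<partial>lborel) = (\<integral>y. f y \<partial>lborel)"
    and "integrable lborel (\<lambda>y. f (c + y)) \<longleftrightarrow> integrable lborel f"
proof -
  have "(\<integral>y. f y \<partial>distr lborel borel ((+) c)) = (\<integral>y. f (c + y) \<partial>lborel)"
    by (rule integral_distr) (use assms in simp_all)
  then show "(\<integral>y. f (c + y) \<partial>lborel) = (\<integral>y. f y \<partial>lborel)" by (simp add: lborel_distr_plus)
  have "integrable (distr lborel borel ((+) c)) f \<longleftrightarrow> integrable lborel (\<lambda>y. f (c + y))"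
    by (rule integrable_distr_eq) (use assms in simp_all)
  then show "integrable lborel (\<lambda>y. f (c + y)) \<longleftrightarrow> integrable lborel f" by (simp add: lborel_distr_plus)
qed

text \<open>
  The integral of a directional derivative is the limit of integrals of difference quotients, all of
  which vanish by translation invariance.
\<close>

lemma integral_directional_derivative:
  fixes G g :: "real^6 \<Rightarrow> real" and e :: "real^6"
  defines "w \<equiv> \<lambda>y::real^6. 1 / (1 + (norm y)\<^sup>2) ^ 4"
  assumes e: "norm e = 1"
    and der: "\<And>y. ((\<lambda>t. G (y + t *\<^sub>R e)) has_real_derivative g y) (at 0)"
    and meas: "G \<in> borel_measurable borel" "g \<in> borel_measurable borel"
    and bG: "\<And>y. \<bar>G y\<bar> \<le> C * w y" and bg: "\<And>y. \<bar>g y\<bar> \<le> C * w y"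
  shows "integrable lborel g" "(\<integral>y. g y \<partial>lborel) = 0"
proof -
  have w: "integrable lborel w" unfolding w_def by (rule integrable_inverse_power)
  have w0: "w y > 0" for y
  proof -
    have "(1 + (norm y)\<^sup>2) ^ 4 > 0" by (intro zero_less_power one_plus_square_pos)
    then show ?thesis unfolding w_def by simp
  qed
  have C: "C \<ge> 0" using bG[of 0] w0[of 0] by (smt (verit) zero_le_mult_iff)
  have iG: "integrable lborel G"
    by (rule Bochner_Integration.integrable_bound[OF integrable_mult_right[OF w, of C]])
      (use meas bG in \<open>auto intro!: AE_I2 intro: order_trans[OF _ abs_ge_self]\<close>)
  define s where "s = (\<lambda>(n::nat) y. (G (inverse (Suc n) *\<^sub>R e + y) - G y) * Suc n)"
  have s_meas: "s n \<in> borel_measurable lborel" for n unfolding s_def using meas by simp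
  have s_int: "(\<integral>y. s n y \<partial>lborel) = 0" for n
    unfolding s_def using iG lborel_integral_translate[OF meas(1)] by simp
  have lim: "(\<lambda>n. s n y) \<longlonglongrightarrow> g y" for y
  proof -
    have "((\<lambda>h. (G (y + (0 + h) *\<^sub>R e) - G (y + 0 *\<^sub>R e)) / h) \<longlongrightarrow> g y) (at 0)"
      using der[of y] by (simp add: DERIV_def)
    moreover have "filterlim (\<lambda>n. inverse (real (Suc n))) (at 0) sequentially"
      unfolding filterlim_at using LIMSEQ_inverse_real_of_nat by (auto simp: eventually_sequentially)
    ultimately have "(\<lambda>n. (G (y + (0 + inverse (real (Suc n))) *\<^sub>R e) - G (y + 0 *\<^sub>R e)) / inverse (real (Suc n))) \<longlonglongrightarrow> g y"
      by (rule filterlim_compose)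
    then show ?thesis unfolding s_def by (simp add: add.commute divide_inverse)
  qed
  \<comment> \<open>The mean value theorem evaluates \<open>g\<close> at a point displaced by at
    most 1, while dominated convergence needs a bound at \<open>y\<close>. Displacement changes 1 +
    |y|^2 by a factor of at most 3, and 81 = 3^4.\<close>
  have shift: "w (y + t *\<^sub>R e) \<le> 81 * w y" if "0 \<le> t" "t \<le> 1" for y t
  proof -
    have "norm y \<le> norm (y + t *\<^sub>R e) + norm (t *\<^sub>R e)"
      by (metis add_diff_cancel_right' norm_triangle_ineq4)
    then have "norm y \<le> norm (y + t *\<^sub>R e) + 1" using that e by simp
    then have "(norm y)\<^sup>2 \<le> (norm (y + t *\<^sub>R e) + 1)\<^sup>2" by (intro power_mono) auto
    also have "\<dots> \<le> 2 * (norm (y + t *\<^sub>R e))\<^sup>2 + 2"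
      using sum_squares_bound[of "norm (y + t *\<^sub>R e)" 1] by (simp add: power2_sum)
    finally have "(norm y)\<^sup>2 \<le> 2 * (norm (y + t *\<^sub>R e))\<^sup>2 + 2" .
    moreover have "1 + a \<le> 3 * (1 + b)" if "a \<le> 2 * b + 2" "0 \<le> b" for a b :: real
      using that by simp
    ultimately have "1 + (norm y)\<^sup>2 \<le> 3 * (1 + (norm (y + t *\<^sub>R e))\<^sup>2)"
      using zero_le_power2 by blast
    then have "(1 + (norm y)\<^sup>2) ^ 4 \<le> (3 * (1 + (norm (y + t *\<^sub>R e))\<^sup>2)) ^ 4" by (intro power_mono) auto
    then have "(1 + (norm y)\<^sup>2) ^ 4 \<le> 81 * (1 + (norm (y + t *\<^sub>R e))\<^sup>2) ^ 4" by (simp only: power_mult_distrib) simp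
    moreover have "0 < (1 + (norm y)\<^sup>2) ^ 4" "0 < (1 + (norm (y + t *\<^sub>R e))\<^sup>2) ^ 4"
      by (intro zero_less_power one_plus_square_pos)+
    ultimately show ?thesis unfolding w_def by (simp add: divide_simps)
  qed
  have bound: "norm (s n y) \<le> (C * 81) * w y" for n y
  proof -
    let ?h = "inverse (real (Suc n))"
    have h: "0 < ?h" "?h \<le> 1" by (auto simp: inverse_le_1_iff)
    have "\<exists>t>0. t < ?h \<and> G (y + ?h *\<^sub>R e) - G (y + 0 *\<^sub>R e) = (?h - 0) * g (y + t *\<^sub>R e)"
    proof (rule MVT2[OF h(1)])
      fix t :: real
      show "((\<lambda>t. G (y + t *\<^sub>R e)) has_real_derivative g (y + t *\<^sub>R e)) (at t)"
        using der[of "y + t *\<^sub>R e"] DERIV_shift[of "\<lambda>t. G (y + t *\<^sub>R e)" "g (y + t *\<^sub>R e)" 0 t]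
        by (simp add: algebra_simps)
    qed
    then obtain t where t: "0 < t" "t < ?h" "G (y + ?h *\<^sub>R e) - G y = ?h * g (y + t *\<^sub>R e)" by auto
    then have "s n y = g (y + t *\<^sub>R e)" unfolding s_def by (simp add: add.commute)
    moreover have "\<bar>g (y + t *\<^sub>R e)\<bar> \<le> C * (81 * w y)"
      using bg[of "y + t *\<^sub>R e"] mult_left_mono[OF shift[of t y] C] t h by linarith
    ultimately show ?thesis by simp
  qed
  note dom = _ s_meas integrable_mult_right[OF w, of "C * 81"] AE_I2[OF lim] AE_I2[OF bound]
  have gm: "g \<in> borel_measurable lborel" using meas by simp
  show "integrable lborel g" by (rule integrable_dominated_convergence[OF dom]) (rule gm)
  have "(\<lambda>n. \<integral>y. s n y \<partial>lborel) \<longlonglongrightarrow> (\<integral>y. g y \<partial>lborel)"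
    by (rule integral_dominated_convergence[OF dom]) (rule gm)
  then show "(\<integral>y. g y \<partial>lborel) = 0" unfolding s_int by (rule LIMSEQ_unique[OF _ tendsto_const])
qed

subsection \<open>Orthonormal frames of the tangent spaces\<close>

text \<open>If the remainder \<open>r\<close> were nonzero, then \<open>r\<close>, \<open>x\<close>
  and the six frame vectors would be eight independent vectors in R^7. The index type is left open
  because frames are indexed by numbers below 6 and by the basis of R^6.\<close>

lemma orthonormal_frame_expansion:
  fixes e :: "'i \<Rightarrow> real^7"
  assumes x: "x \<in> S6" and I: "finite I" "card I = 6"
    and tan: "\<And>i. i \<in> I \<Longrightarrow> e i \<in> tangent x"
    and on: "\<And>i j. i \<in> I \<Longrightarrow> j \<in> I \<Longrightarrow> e i \<bullet> e j = (if i = j then 1 else 0)"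
  shows "v = (\<Sum>i\<in>I. (v \<bullet> e i) *\<^sub>R e i) + (v \<bullet> x) *\<^sub>R x"
proof (rule ccontr)
  assume neq: "\<not> ?thesis"
  define r where "r = v - (\<Sum>i\<in>I. (v \<bullet> e i) *\<^sub>R e i) - (v \<bullet> x) *\<^sub>R x"
  have r0: "r \<noteq> 0" using neq unfolding r_def by (auto simp: algebra_simps)
  have ex: "e i \<bullet> x = 0" if "i \<in> I" for i using tan[OF that] by (simp add: tangent_def)
  have re: "r \<bullet> e i = 0" if i: "i \<in> I" for i
  proof -
    have "(\<Sum>j\<in>I. (v \<bullet> e j) *\<^sub>R e j) \<bullet> e i = (\<Sum>j\<in>I. if j = i then v \<bullet> e j else 0)"
      unfolding inner_sum_left by (rule sum.cong) (auto simp: on i)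
    also have "\<dots> = v \<bullet> e i" using I i by simp
    finally show ?thesis unfolding r_def using ex[OF i] by (simp add: inner_diff_left inner_commute[of x])
  qed
  have rx: "r \<bullet> x = 0"
    unfolding r_def by (simp add: inner_diff_left inner_sum_left ex sphere_inner_self[OF x])
  have inj: "inj_on e I"
    by (rule inj_onI) (metis on zero_neq_one)
  define B where "B = insert r (insert x (e ` I))"
  have e0: "e i \<bullet> e i = 1" if "i \<in> I" for i using on that by simp
  have xB: "x \<notin> e ` I" using ex sphere_inner_self[OF x] by (metis imageE zero_neq_one)
  have rB: "r \<notin> insert x (e ` I)" using re rx r0 by (metis imageE inner_eq_zero_iff insertE)
  have card: "card B = 8" unfolding B_def using I xB rB inj by (simp add: card_image)
  have "pairwise orthogonal B"
    unfolding pairwise_def B_def orthogonal_def using re rx ex on by (auto simp: inner_commute)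
  moreover have "0 \<notin> B" unfolding B_def using r0 sphere_nonzero[OF x] e0 by force
  ultimately have "independent B" by (rule pairwise_orthogonal_independent)
  then have "card B \<le> DIM(real^7)" by (rule independent_card_le)
  then show False using card by simp
qed

text \<open>Basis independence of the trace of a bilinear form, for the orthonormal basis formed by
  the frame and \<open>x\<close>. It converts ambient sums into tangential ones plus an explicit
  normal entry.\<close>

lemma sum_Basis_frame:
  fixes e :: "'i \<Rightarrow> real^7"
  assumes x: "x \<in> S6" and I: "finite I" "card I = 6"
    and tan: "\<And>i. i \<in> I \<Longrightarrow> e i \<in> tangent x"
    and on: "\<And>i j. i \<in> I \<Longrightarrow> j \<in> I \<Longrightarrow> e i \<bullet> e j = (if i = j then 1 else 0)"
    and lin: "\<And>v. linear (\<lambda>u. A u v)" "\<And>u. linear (\<lambda>v. A u v :: real)"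
  shows "(\<Sum>b\<in>Basis. A b b) = (\<Sum>i\<in>I. A (e i) (e i)) + A x x"
proof -
  have con: "(\<Sum>b\<in>Basis. (b \<bullet> v) * A b v) = A v v" for v
  proof -
    have "A v v = A (\<Sum>b\<in>Basis. (v \<bullet> b) *\<^sub>R b) v" by (simp add: euclidean_representation)
    then show ?thesis
      by (simp only: linear_sum[OF lin(1)] linear_scale[OF lin(1)]) (simp add: inner_commute)
  qed
  have "A b b = (\<Sum>i\<in>I. (b \<bullet> e i) * A b (e i)) + (b \<bullet> x) * A b x" for b
  proof -
    have "A b b = A b ((\<Sum>i\<in>I. (b \<bullet> e i) *\<^sub>R e i) + (b \<bullet> x) *\<^sub>R x)"
      using orthonormal_frame_expansion[OF x I tan on, of b] by simp
    then show ?thesis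
      by (simp only: linear_add[OF lin(2)] linear_sum[OF lin(2)] linear_scale[OF lin(2)]) simp
  qed
  then have "(\<Sum>b\<in>Basis. A b b) = (\<Sum>b\<in>Basis. (\<Sum>i\<in>I. (b \<bullet> e i) * A b (e i)) + (b \<bullet> x) * A b x)"
    by simp
  also have "\<dots> = (\<Sum>i\<in>I. \<Sum>b\<in>Basis. (b \<bullet> e i) * A b (e i)) + (\<Sum>b\<in>Basis. (b \<bullet> x) * A b x)"
    unfolding sum.distrib by (subst sum.swap) (rule refl)
  finally show ?thesis unfolding con .
qed

subsection \<open>Stereographic coordinates\<close>

lemma exhaust_6:
  fixes x :: 6 shows "x = 1 \<or> x = 2 \<or> x = 3 \<or> x = 4 \<or> x = 5 \<or> x = 6"
proof (induct x)
  case (of_int z)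
  then have "z = 0 \<or> z = 1 \<or> z = 2 \<or> z = 3 \<or> z = 4 \<or> z = 5" by fastforce
  then show ?case by auto
qed

lemma exhaust_7:
  fixes x :: 7 shows "x = 1 \<or> x = 2 \<or> x = 3 \<or> x = 4 \<or> x = 5 \<or> x = 6 \<or> x = 7"
proof (induct x)
  case (of_int z)
  then have "z = 0 \<or> z = 1 \<or> z = 2 \<or> z = 3 \<or> z = 4 \<or> z = 5 \<or> z = 6" by fastforce
  then show ?case by auto
qed

lemma UNIV_6: "UNIV = {1, 2, 3, 4, 5, 6::6}" using exhaust_6 by auto
lemma UNIV_7: "UNIV = {1, 2, 3, 4, 5, 6, 7::7}" using exhaust_7 by auto

lemma sum_6: "sum f (UNIV::6 set) = f 1 + f 2 + f 3 + f 4 + f 5 + f 6"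
  unfolding UNIV_6 by (simp add: ac_simps)
lemma sum_7: "sum f (UNIV::7 set) = f 1 + f 2 + f 3 + f 4 + f 5 + f 6 + f 7"
  unfolding UNIV_7 by (simp add: ac_simps)

lemma forall_7: "(\<forall>i::7. P i) \<longleftrightarrow> P 1 \<and> P 2 \<and> P 3 \<and> P 4 \<and> P 5 \<and> P 6 \<and> P 7"
  by (metis exhaust_7)

lemma vector_7:
  "(vector [a1,a2,a3,a4,a5,a6,a7] :: ('a::zero)^7)$1 = a1"
  "(vector [a1,a2,a3,a4,a5,a6,a7] :: ('a::zero)^7)$2 = a2"
  "(vector [a1,a2,a3,a4,a5,a6,a7] :: ('a::zero)^7)$3 = a3"
  "(vector [a1,a2,a3,a4,a5,a6,a7] :: ('a::zero)^7)$4 = a4"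
  "(vector [a1,a2,a3,a4,a5,a6,a7] :: ('a::zero)^7)$5 = a5"
  "(vector [a1,a2,a3,a4,a5,a6,a7] :: ('a::zero)^7)$6 = a6"
  "(vector [a1,a2,a3,a4,a5,a6,a7] :: ('a::zero)^7)$7 = a7"
  unfolding vector_def by simp_all

definition embed6 :: "real^6 \<Rightarrow> real^7" where
  "embed6 y = vector [y$1, y$2, y$3, y$4, y$5, y$6, 0]"

definition pole :: "real^7" where
  "pole = vector [0, 0, 0, 0, 0, 0, 1]"

text \<open>The conformal factor of the chart: the round metric pulls back to
  \<open>rho\<^sup>2\<close> times the flat one, see \<open>d_stereo_inner\<close>. Together with
  the relation \<open>rho y * (y \<bullet> y) = 2 - rho y\<close> it keeps the chart computations
  polynomial.\<close>

definition rho :: "real^6 \<Rightarrow> real" where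
  "rho y = 2 / (1 + (norm y)\<^sup>2)"

definition d_stereo :: "real^6 \<Rightarrow> real^6 \<Rightarrow> real^7" where
  "d_stereo y h = rho y *\<^sub>R embed6 h - ((rho y)\<^sup>2 * (y \<bullet> h)) *\<^sub>R (embed6 y - pole)"

lemma linear_embed: "linear embed6"
  by (rule linearI) (simp_all add: embed6_def vec_eq_iff forall_7 vector_7)

lemma embed_inner: "embed6 a \<bullet> embed6 b = a \<bullet> b"
  by (simp add: inner_vec_def sum_6 sum_7 embed6_def vector_7)

lemma embed_pole: "embed6 a \<bullet> pole = 0" "pole \<bullet> embed6 a = 0" "pole \<bullet> pole = 1"
  by (simp_all add: inner_vec_def sum_7 embed6_def pole_def vector_7)

lemma rho_pos: "0 < rho y"
  unfolding rho_def using one_plus_square_pos[of "norm y"] by simp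

lemma rho_norm: "rho y * (norm y)\<^sup>2 = 2 - rho y" "rho y * (y \<bullet> y) = 2 - rho y"
proof -
  have "1 + (norm y)\<^sup>2 \<noteq> 0" using one_plus_square_pos[of "norm y"] by linarith
  then show "rho y * (norm y)\<^sup>2 = 2 - rho y" unfolding rho_def by (simp add: field_simps)
  then show "rho y * (y \<bullet> y) = 2 - rho y" by (simp add: power2_norm_eq_inner)
qed

lemma inv_stereo_eq: "inv_stereo y = rho y *\<^sub>R embed6 y + (1 - rho y) *\<^sub>R pole"
proof -
  have "1 + (norm y)\<^sup>2 \<noteq> 0" using one_plus_square_pos[of "norm y"] by linarith
  then have "((norm y)\<^sup>2 - 1) / (1 + (norm y)\<^sup>2) = 1 - 2 / (1 + (norm y)\<^sup>2)" by (simp add: field_simps)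
  then show ?thesis
    by (simp add: vec_eq_iff forall_7 inv_stereo_def rho_def embed6_def pole_def vector_7)
qed

lemma has_derivative_rho: "(rho has_derivative (\<lambda>h. - ((rho y)\<^sup>2 * (y \<bullet> h)))) (at y)"
proof -
  have nz: "1 + y \<bullet> y \<noteq> 0" using one_plus_square_pos[of "norm y"] by (simp add: power2_norm_eq_inner)
  have "((\<lambda>y. 2 * inverse (1 + y \<bullet> y)) has_derivative (\<lambda>h. - ((2 / (1 + y \<bullet> y))\<^sup>2 * (y \<bullet> h)))) (at y)"
    using nz by (auto intro!: derivative_eq_intros simp: power2_eq_square inner_commute field_simps)
  then show ?thesis unfolding rho_def by (simp add: power2_norm_eq_inner divide_inverse)
qed

lemma has_derivative_embed: "(embed6 has_derivative embed6) (at y)"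
  by (rule bounded_linear_imp_has_derivative[OF linear_conv_bounded_linear[THEN iffD1, OF linear_embed]])

lemma has_derivative_inv_stereo: "(inv_stereo has_derivative d_stereo y) (at y)"
proof -
  have "((\<lambda>y. rho y *\<^sub>R embed6 y + (1 - rho y) *\<^sub>R pole) has_derivative d_stereo y) (at y)"
    by (auto intro!: derivative_eq_intros has_derivative_rho has_derivative_embed
        simp: d_stereo_def algebra_simps)
  moreover have "inv_stereo = (\<lambda>y. rho y *\<^sub>R embed6 y + (1 - rho y) *\<^sub>R pole)"
    by (rule ext) (rule inv_stereo_eq)
  ultimately show ?thesis by simp
qed

lemma inv_stereo_sphere: "inv_stereo y \<in> S6"
proof -
  have "inv_stereo y \<bullet> inv_stereo y = rho y * (rho y * (y \<bullet> y)) + (1 - rho y) * (1 - rho y)"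
    unfolding inv_stereo_eq by (simp add: inner_add_left inner_add_right embed_inner embed_pole)
  also have "\<dots> = 1" unfolding rho_norm by (simp add: algebra_simps)
  finally show ?thesis by (simp add: norm_eq_1)
qed

lemma embed_pole_square: "rho y * ((embed6 y - pole) \<bullet> (embed6 y - pole)) = 2"
  using rho_norm(2)[of y]
  by (simp add: inner_diff_left inner_diff_right embed_inner embed_pole distrib_left)

lemma d_stereo_inner: "d_stereo y h \<bullet> d_stereo y k = (rho y)\<^sup>2 * (h \<bullet> k)"
proof -
  let ?r = "rho y" and ?q = "embed6 y - pole"
  have q: "?q \<bullet> embed6 a = y \<bullet> a" "embed6 a \<bullet> ?q = y \<bullet> a" for a
    by (simp_all add: inner_diff_left inner_diff_right embed_inner embed_pole inner_commute)
  have "d_stereo y h \<bullet> d_stereo y k = ?r\<^sup>2 * (h \<bullet> k) - 2 * ?r ^ 3 * (y \<bullet> h) * (y \<bullet> k)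
      + ?r ^ 3 * (y \<bullet> h) * (y \<bullet> k) * (?r * (?q \<bullet> ?q))"
    unfolding d_stereo_def inner_diff_left[of _ "_ *\<^sub>R ?q"] inner_diff_right[of _ _ "_ *\<^sub>R ?q"]
    by (simp only: inner_scaleR_left inner_scaleR_right q embed_inner)
      (simp add: power2_eq_square power3_eq_cube algebra_simps)
  also have "\<dots> = ?r\<^sup>2 * (h \<bullet> k)" unfolding embed_pole_square by simp
  finally show ?thesis .
qed

lemma d_stereo_tangent: "d_stereo y h \<in> tangent (inv_stereo y)"
proof -
  have "d_stereo y h \<bullet> inv_stereo y = rho y * (y \<bullet> h) * (rho y - (rho y * (rho y * (y \<bullet> y))) + rho y * (1 - rho y))"
    unfolding d_stereo_def inv_stereo_eq
    by (simp add: inner_add_left inner_add_right inner_diff_left embed_inner embed_pole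
        power2_eq_square inner_commute algebra_simps)
  also have "\<dots> = 0" unfolding rho_norm by (simp add: algebra_simps)
  finally show ?thesis by (simp add: tangent_def)
qed

lemma continuous_inv_stereo: "continuous_on UNIV inv_stereo"
  by (rule has_derivative_continuous_on) (use has_derivative_inv_stereo in auto)

lemma continuous_rho: "continuous_on UNIV rho"
  by (rule has_derivative_continuous_on) (use has_derivative_rho in auto)

lemma continuous_embed: "continuous_on UNIV embed6"
  by (rule has_derivative_continuous_on) (use has_derivative_embed in auto)

lemma continuous_on_inv_stereo_comp:
  "continuous_on S6 f \<Longrightarrow> continuous_on UNIV (\<lambda>y. f (inv_stereo y))"
  by (rule continuous_on_compose2[OF _ continuous_inv_stereo]) (use inv_stereo_sphere in auto)

lemma continuous_d_stereo: "continuous_on UNIV (\<lambda>y. d_stereo y h)"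
  unfolding d_stereo_def by (intro continuous_intros continuous_rho continuous_embed)

lemma has_real_derivative_line:
  assumes "(G has_derivative D) (at y)"
  shows "((\<lambda>t. G (y + t *\<^sub>R e)) has_real_derivative D e) (at 0)"
proof -
  have line: "((\<lambda>t. y + t *\<^sub>R e) has_derivative (\<lambda>t. t *\<^sub>R e)) (at (0::real))"
    by (auto intro!: derivative_eq_intros)
  have "(G has_derivative D) (at (y + 0 *\<^sub>R e))" using assms by simp
  from has_derivative_compose[OF line this]
  have "((\<lambda>t. G (y + t *\<^sub>R e)) has_derivative (\<lambda>t. D (t *\<^sub>R e))) (at 0)" .
  moreover have "D (t *\<^sub>R e) = D e * t" for t
    using linear_scale[OF has_derivative_linear[OF assms]] by simp
  ultimately show ?thesis by (simp add: has_field_derivative_def)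
qed

section \<open>The divergence theorem on the sphere, in the chart\<close>

lemma continuous_bounded_sphere:
  assumes "continuous_on S6 f" shows "\<exists>C. (\<forall>x\<in>S6. norm (f x) \<le> C) \<and> C \<ge> 0"
proof -
  have "compact (f ` S6)" by (rule compact_continuous_image[OF assms compact_sphere])
  then have "bounded (f ` S6)" by (rule compact_imp_bounded)
  then obtain C where "\<forall>z\<in>f ` S6. norm z \<le> C" unfolding bounded_iff by (elim exE)
  then have "\<And>x. x \<in> S6 \<Longrightarrow> norm (f x) \<le> C" by blast
  then have "\<And>x. x \<in> S6 \<Longrightarrow> norm (f x) \<le> max C 0" by (simp add: le_max_iff_disj)
  then show ?thesis by (intro exI[of _ "max C 0"]) simp
qed

lemma norm_pd_le:
  fixes f :: "'a::euclidean_space \<Rightarrow> 'b::real_normed_vector"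
  assumes "f differentiable (at x)" shows "norm (pd u f x) \<le> norm u * (\<Sum>b\<in>Basis. norm (pd b f x))"
proof -
  have "norm (pd u f x) \<le> (\<Sum>b\<in>Basis. norm ((u \<bullet> b) *\<^sub>R pd b f x))"
    using norm_sum[of "\<lambda>b. (u \<bullet> b) *\<^sub>R pd b f x" Basis] unfolding pd_basis_expansion[OF assms, of u, symmetric] .
  also have "\<dots> \<le> (\<Sum>b\<in>Basis. norm u * norm (pd b f x))"
    by (rule sum_mono) (simp add: Basis_le_norm mult_right_mono)
  finally show ?thesis by (simp add: sum_distrib_left)
qed

lemma embed_pole_bounds: "rho y * norm (embed6 y - pole) \<le> 2" "rho y * norm y \<le> 2" "rho y \<le> 2"
proof -
  show r: "rho y \<le> 2" unfolding rho_def by (simp add: divide_le_eq one_plus_square_pos)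
  have "(rho y * norm (embed6 y - pole))\<^sup>2 = rho y * (rho y * ((embed6 y - pole) \<bullet> (embed6 y - pole)))"
    by (simp add: power2_eq_square power2_norm_eq_inner[symmetric] mult_ac)
  also have "\<dots> \<le> 2\<^sup>2" unfolding embed_pole_square using r by simp
  finally show 1: "rho y * norm (embed6 y - pole) \<le> 2" by (rule power2_le_imp_le) simp
  have "(norm y)\<^sup>2 \<le> (norm (embed6 y - pole))\<^sup>2"
    by (simp add: power2_norm_eq_inner inner_diff_left inner_diff_right embed_inner embed_pole)
  then have "norm y \<le> norm (embed6 y - pole)" by (rule power2_le_imp_le) simp
  then have "rho y * norm y \<le> rho y * norm (embed6 y - pole)" using rho_pos[of y] by (intro mult_left_mono) auto
  with 1 show "rho y * norm y \<le> 2" by linarith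
qed

text \<open>Pairing with a tangent field U gives the chart component of U times the volume density:
  the i-th component is \<open>rho^-2 (U \<bullet> d_stereo y i)\<close>, and the density is
  \<open>rho^6\<close>. The chart divergence is the sum of the i-th partial derivatives of these
  products.\<close>

definition w_field :: "real^6 \<Rightarrow> real^6 \<Rightarrow> real^7" where
  "w_field i y = (rho y ^ 4) *\<^sub>R d_stereo y i"

definition dw_field :: "real^6 \<Rightarrow> real^6 \<Rightarrow> real^6 \<Rightarrow> real^7" where
  "dw_field i y h = - (5 * rho y ^ 6 * (y \<bullet> h)) *\<^sub>R embed6 i - (rho y ^ 6 * (y \<bullet> i)) *\<^sub>R embed6 h
     + (6 * rho y ^ 7 * (y \<bullet> h) * (y \<bullet> i) - rho y ^ 6 * (h \<bullet> i)) *\<^sub>R (embed6 y - pole)"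

lemma has_derivative_w_field: "(w_field i has_derivative dw_field i y) (at y)"
proof -
  have pow: "((\<lambda>y. rho y ^ n) has_derivative (\<lambda>h. - (real n * rho y ^ (n + 1) * (y \<bullet> h)))) (at y)" if "n > 0" for n
    by (rule has_derivative_eq_rhs[OF has_derivative_power[OF has_derivative_rho]])
      (use that in \<open>auto simp: fun_eq_iff power2_eq_square mult_ac simp flip: power_Suc power_add\<close>)
  have eq: "w_field i = (\<lambda>y. (rho y ^ 5) *\<^sub>R embed6 i - (rho y ^ 6 * (y \<bullet> i)) *\<^sub>R (embed6 y - pole))"
    by (rule ext) (simp add: w_field_def d_stereo_def scaleR_right_diff_distrib flip: power_Suc power_Suc2 power_add mult.assoc)
  show ?thesis unfolding eq
    by (rule has_derivative_eq_rhs)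
      (rule has_derivative_diff[OF has_derivative_scaleR[OF pow has_derivative_const]
         has_derivative_scaleR[OF has_derivative_mult[OF pow has_derivative_inner_left[OF has_derivative_ident]]
           has_derivative_diff[OF has_derivative_embed has_derivative_const]]],
       simp, simp, simp add: fun_eq_iff dw_field_def algebra_simps)
qed

lemma dw_field_diag:
  assumes "i \<in> Basis"
  shows "dw_field i y i = - (6 * rho y ^ 6) *\<^sub>R ((y \<bullet> i) *\<^sub>R embed6 i)
    + (6 * rho y ^ 7 * ((y \<bullet> i) * (y \<bullet> i)) - rho y ^ 6) *\<^sub>R (embed6 y - pole)"
proof -
  have "- (5 * a) *\<^sub>R v - a *\<^sub>R v = - (6 * a) *\<^sub>R v" for a and v :: "real^7"
  proof -
    have "- (5 * a) *\<^sub>R v - a *\<^sub>R v = (- (5 * a) - a) *\<^sub>R v" by (rule scaleR_left_diff_distrib[symmetric])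
    also have "- (5 * a) - a = - (6 * a)" by simp
    finally show ?thesis .
  qed
  from this[of "rho y ^ 6 * (y \<bullet> i)" "embed6 i"] show ?thesis
    unfolding dw_field_def using assms by (simp add: mult_ac)
qed

text \<open>The total derivative of the frame weights is normal to the sphere (a mean curvature
  term). A tangent field does not see it, so only the derivative of the field itself remains in the
  divergence.\<close>

lemma sum_dw_field: "(\<Sum>i\<in>Basis. dw_field i y i) = - (6 * rho y ^ 6) *\<^sub>R inv_stereo y"
proof -
  let ?r = "rho y" and ?q = "embed6 y - pole"
  have 1: "(\<Sum>i\<in>Basis. (y \<bullet> i) *\<^sub>R embed6 i) = embed6 y"
    by (simp add: linear_sum[OF linear_embed] linear_scale[OF linear_embed, symmetric] euclidean_representation
        flip: linear_sum[OF linear_embed])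
  have 2: "(\<Sum>i\<in>Basis. (y \<bullet> i) * (y \<bullet> i)) = y \<bullet> y" by (rule euclidean_inner[symmetric])
  have "(\<Sum>i\<in>Basis. dw_field i y i)
      = (\<Sum>i\<in>Basis. - (6 * ?r ^ 6) *\<^sub>R ((y \<bullet> i) *\<^sub>R embed6 i) + (6 * ?r ^ 7 * ((y \<bullet> i) * (y \<bullet> i)) - ?r ^ 6) *\<^sub>R ?q)"
    by (rule sum.cong[OF refl dw_field_diag])
  also have "\<dots> = - (6 * ?r ^ 6) *\<^sub>R embed6 y + (6 * ?r ^ 7 * (y \<bullet> y) - 6 * ?r ^ 6) *\<^sub>R ?q"
    unfolding sum.distrib scaleR_sum_right[symmetric] 1 scaleR_sum_left[symmetric] sum_subtractf
      sum_distrib_left[symmetric] 2 by simp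
  also have "6 * ?r ^ 7 * (y \<bullet> y) = 6 * ?r ^ 6 * (?r * (y \<bullet> y))" by (simp flip: power_Suc2 mult.assoc)
  also have "- (6 * ?r ^ 6) *\<^sub>R embed6 y + (6 * ?r ^ 6 * (?r * (y \<bullet> y)) - 6 * ?r ^ 6) *\<^sub>R ?q
      = - (6 * ?r ^ 6) *\<^sub>R inv_stereo y"
    unfolding rho_norm inv_stereo_eq by (simp add: algebra_simps)
  finally show ?thesis .
qed

lemma norm_d_stereo: "norm (d_stereo y h) = rho y * norm h"
  using d_stereo_inner[of y h h] rho_pos[of y]
  by (simp add: norm_eq_sqrt_inner real_sqrt_mult)

lemma norm_dw_field:
  assumes "i \<in> Basis" shows "norm (dw_field i y i) \<le> 76 * rho y ^ 4"
proof -
  let ?r = "rho y" and ?q = "embed6 y - pole"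
  have r: "0 < ?r" "?r \<le> 2" using rho_pos embed_pole_bounds by auto
  have e1: "norm (embed6 i) = 1" using embed_inner[of i i] assms by (simp add: norm_eq_1)
  have yi: "\<bar>y \<bullet> i\<bar> \<le> norm y" by (rule Basis_le_norm[OF assms])
  have ryi: "?r * \<bar>y \<bullet> i\<bar> \<le> 2"
    using mult_left_mono[OF yi, of ?r] r embed_pole_bounds(2)[of y] by linarith
  have "dw_field i y i = - (6 * ?r ^ 6 * (y \<bullet> i)) *\<^sub>R embed6 i + (6 * ?r ^ 7 * (y \<bullet> i) * (y \<bullet> i) - ?r ^ 6) *\<^sub>R ?q"
    unfolding dw_field_diag[OF assms] by (simp add: mult.assoc)
  then have "norm (dw_field i y i) \<le> 6 * ?r ^ 6 * \<bar>y \<bullet> i\<bar> + \<bar>6 * ?r ^ 7 * (y \<bullet> i) * (y \<bullet> i) - ?r ^ 6\<bar> * norm ?q"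
    using norm_triangle_ineq[of "- (6 * ?r ^ 6 * (y \<bullet> i)) *\<^sub>R embed6 i" "(6 * ?r ^ 7 * (y \<bullet> i) * (y \<bullet> i) - ?r ^ 6) *\<^sub>R ?q"] r
    by (simp add: e1 abs_mult)
  also have "\<dots> \<le> 6 * ?r ^ 6 * \<bar>y \<bullet> i\<bar> + (6 * ?r ^ 7 * \<bar>y \<bullet> i\<bar> * \<bar>y \<bullet> i\<bar> + ?r ^ 6) * norm ?q"
    using r by (intro add_left_mono mult_right_mono) (auto simp: mult.assoc intro!: order_trans[OF abs_triangle_ineq4])
  \<comment> \<open>Each of the two unbounded quantities, the coordinate of \<open>y\<close> and
    \<open>norm ?q\<close>, is paired with one factor \<open>?r\<close>, and these products are at
    most 2. The total is 24 + 26 * 2 = 76, with the decay \<open>?r ^ 4\<close> left over.\<close>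
  also have "\<dots> = ?r ^ 4 * (6 * ?r * (?r * \<bar>y \<bullet> i\<bar>) + (6 * (?r * \<bar>y \<bullet> i\<bar>) * (?r * \<bar>y \<bullet> i\<bar>) + ?r) * (?r * norm ?q))"
    by (simp add: algebra_simps power_numeral_reduce)
  also have "\<dots> \<le> ?r ^ 4 * (6 * 2 * 2 + (6 * 2 * 2 + 2) * 2)"
    using r ryi embed_pole_bounds(1)[of y] by (intro mult_left_mono add_mono mult_mono) auto
  also have "\<dots> = 76 * ?r ^ 4" by simp
  finally show ?thesis .
qed

text \<open>In the chart the integrand is a sum of partial derivatives of
  \<open>U \<bullet> w_field i\<close>, each decaying fast enough for its integral to vanish. Such
  decay of both functions and derivatives also accounts for the point missing from the
  chart.\<close>

lemma sphere_divergence: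
  fixes U :: "real^7 \<Rightarrow> real^7"
  assumes U: "smooth (- {0}) U" and tan: "\<And>y. y \<noteq> 0 \<Longrightarrow> U y \<bullet> y = 0"
  shows "integrable lborel (\<lambda>y. rho y ^ 6 * (\<Sum>b\<in>Basis. pd b U (inv_stereo y) \<bullet> b))" (is "integrable _ ?f")
    and "(\<integral>y. rho y ^ 6 * (\<Sum>b\<in>Basis. pd b U (inv_stereo y) \<bullet> b) \<partial>lborel) = 0"
proof -
  let ?x = inv_stereo
  have x: "?x y \<in> S6" for y by (rule inv_stereo_sphere)
  have x0: "?x y \<in> - {0}" for y using sphere_nonzero[OF x] by simp
  have dU: "U differentiable (at (?x y))" for y by (rule smooth_differentiable[OF U x0])
  have S: "S6 \<subseteq> - {0}" by auto
  have cU: "continuous_on S6 U" "continuous_on S6 (pd b U)" for b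
    by (rule continuous_on_subset[OF smooth_continuous_on[OF U] S],
        rule continuous_on_subset[OF smooth_continuous_on[OF smooth_pd[OF U]] S])
  from continuous_bounded_sphere[OF cU(1)] obtain C0 where C0: "\<forall>x\<in>S6. norm (U x) \<le> C0" "C0 \<ge> 0"
    by (elim exE conjE)
  have "continuous_on S6 (\<lambda>x. \<Sum>b\<in>Basis. norm (pd b U x))"
    by (intro continuous_on_sum continuous_on_norm cU)
  from continuous_bounded_sphere[OF this]
  obtain C1 where C1: "\<forall>x\<in>S6. norm (\<Sum>b\<in>Basis. norm (pd b U x)) \<le> C1" "C1 \<ge> 0"
    by (elim exE conjE)
  define C where "C = max C0 C1"
  have CU: "norm (U (?x y)) \<le> C" "norm (pd u U (?x y)) \<le> norm u * C" for y and u :: "real^7"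
  proof -
    show "norm (U (?x y)) \<le> C" using bspec[OF C0(1) x[of y]] unfolding C_def by linarith
    have "(\<Sum>b\<in>Basis. norm (pd b U (?x y))) \<le> C"
      using bspec[OF C1(1) x[of y]] unfolding C_def by (simp add: abs_le_iff le_max_iff_disj)
    with norm_pd_le[OF dU[of y], of u] show "norm (pd u U (?x y)) \<le> norm u * C"
      by (meson mult_left_mono norm_ge_zero order_trans)
  qed
  have C: "C \<ge> 0" unfolding C_def using C0(2) by simp
  define g where "g = (\<lambda>i y. U (?x y) \<bullet> dw_field i y i + pd (d_stereo y i) U (?x y) \<bullet> w_field i y)"
  have der: "((\<lambda>t. U (?x (y + t *\<^sub>R i)) \<bullet> w_field i (y + t *\<^sub>R i)) has_real_derivative g i y) (at 0)" for i y
  proof -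
    have "((\<lambda>y. U (?x y)) has_derivative (\<lambda>h. pd (d_stereo y h) U (?x y))) (at y)"
      by (rule has_derivative_compose[OF has_derivative_inv_stereo differentiable_has_pd[OF dU]])
    from has_derivative_inner[OF this has_derivative_w_field[of i y]]
    have "((\<lambda>y. U (?x y) \<bullet> w_field i y) has_derivative
        (\<lambda>h. U (?x y) \<bullet> dw_field i y h + pd (d_stereo y h) U (?x y) \<bullet> w_field i y)) (at y)" .
    from has_real_derivative_line[OF this, of i] show ?thesis unfolding g_def .
  qed
  have c1: "continuous_on UNIV (\<lambda>y. U (?x y))" "continuous_on UNIV (\<lambda>y. pd b U (?x y))" for b
    by (rule continuous_on_inv_stereo_comp[OF cU(1)], rule continuous_on_inv_stereo_comp[OF cU(2)])
  have c2: "continuous_on UNIV (w_field i)" for i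
    unfolding w_field_def by (intro continuous_intros continuous_rho continuous_d_stereo)
  have c3: "continuous_on UNIV (\<lambda>y. dw_field i y i)" for i
    unfolding dw_field_def by (intro continuous_intros continuous_rho continuous_embed)
  have c4: "continuous_on UNIV (\<lambda>y. pd (d_stereo y i) U (?x y))" for i
  proof -
    have "(\<lambda>y. pd (d_stereo y i) U (?x y)) = (\<lambda>y. \<Sum>b\<in>Basis. (d_stereo y i \<bullet> b) *\<^sub>R pd b U (?x y))"
      by (rule ext) (rule pd_basis_expansion[OF dU])
    then show ?thesis
      by (simp only:) (intro continuous_on_sum continuous_on_scaleR continuous_on_inner
          continuous_on_const continuous_d_stereo c1)
  qed
  have meas: "(\<lambda>y. U (?x y) \<bullet> w_field i y) \<in> borel_measurable borel" "g i \<in> borel_measurable borel" for i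
    unfolding g_def
    by (rule borel_measurable_continuous_onI; intro continuous_on_add continuous_on_inner c1 c2 c3 c4)+
  have rho4: "rho y ^ 4 = 16 * (1 / (1 + (norm y)\<^sup>2) ^ 4)" for y
    unfolding rho_def by (simp add: power_divide)
  have nw: "norm (w_field i y) = rho y ^ 4 * rho y" if "i \<in> Basis" for i y
    unfolding w_field_def using that rho_pos[of y] by (simp add: norm_d_stereo)
  have r: "0 \<le> rho y" "rho y \<le> 2" for y using rho_pos[of y] embed_pole_bounds(3)[of y] by auto
  \<comment> \<open>\<open>rho^4\<close> is 16 times the integrable weight, and 1280 = 16 * 80,
    where 80 = 76 + 2 * 2 is what the estimate of \<open>g\<close> below needs. One constant has to
    serve for both bounds.\<close>
  have bG: "\<bar>U (?x y) \<bullet> w_field i y\<bar> \<le> (1280 * C) * (1 / (1 + (norm y)\<^sup>2) ^ 4)" if i: "i \<in> Basis" for i y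
  proof -
    have "\<bar>U (?x y) \<bullet> w_field i y\<bar> \<le> norm (U (?x y)) * norm (w_field i y)" by (rule Cauchy_Schwarz_ineq2)
    also have "\<dots> \<le> C * (rho y ^ 4 * rho y)" unfolding nw[OF i] using r[of y] by (intro mult_right_mono CU) auto
    also have "\<dots> \<le> C * (rho y ^ 4 * 80)" using r[of y] C by (intro mult_left_mono) auto
    finally show ?thesis by (simp add: rho4 mult.commute)
  qed
  have bg: "\<bar>g i y\<bar> \<le> (1280 * C) * (1 / (1 + (norm y)\<^sup>2) ^ 4)" if i: "i \<in> Basis" for i y
  proof -
    have "\<bar>g i y\<bar> \<le> \<bar>U (?x y) \<bullet> dw_field i y i\<bar> + \<bar>pd (d_stereo y i) U (?x y) \<bullet> w_field i y\<bar>"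
      unfolding g_def by (rule abs_triangle_ineq)
    also have "\<dots> \<le> norm (U (?x y)) * norm (dw_field i y i) + norm (pd (d_stereo y i) U (?x y)) * norm (w_field i y)"
      by (intro add_mono Cauchy_Schwarz_ineq2)
    also have "\<dots> \<le> C * (76 * rho y ^ 4) + (rho y * C) * (rho y ^ 4 * rho y)"
      unfolding nw[OF i] using r[of y] C CU(2)[where y = y and u = "d_stereo y i"] i
      by (intro add_mono mult_mono CU norm_dw_field) (auto simp: norm_d_stereo)
    also have "(rho y * C) * (rho y ^ 4 * rho y) = (C * rho y ^ 4) * (rho y * rho y)" by (simp add: mult_ac)
    also have "C * (76 * rho y ^ 4) + (C * rho y ^ 4) * (rho y * rho y) \<le> C * (76 * rho y ^ 4) + (C * rho y ^ 4) * (2 * 2)"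
      using r[of y] C by (intro add_left_mono mult_left_mono mult_mono) auto
    also have "\<dots> = 80 * C * rho y ^ 4" by simp
    finally show ?thesis by (simp add: rho4 mult.commute)
  qed
  have int: "integrable lborel (g i)" "(\<integral>y. g i y \<partial>lborel) = 0" if i: "i \<in> Basis" for i
    by (rule integral_directional_derivative[OF norm_Basis[OF i] der meas bG[OF i] bg[OF i]])+
  have sum: "(\<Sum>i\<in>Basis. g i y) = ?f y" for y
  proof -
    define A where "A = (\<lambda>u v. pd u U (?x y) \<bullet> v)"
    have Al: "linear (\<lambda>u. A u v)" "linear (\<lambda>v. A u v)" for u v
      unfolding A_def using pd_linear[OF dU[of y]]
      by (auto intro!: linearI simp: linear_add linear_scale inner_add_left inner_add_right)
    define e where "e = (\<lambda>i. (1 / rho y) *\<^sub>R d_stereo y i)"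
    have r0: "rho y \<noteq> 0" using rho_pos[of y] by simp
    have "(\<Sum>b\<in>Basis. A b b) = (\<Sum>i\<in>(Basis :: (real^6) set). A (e i) (e i)) + A (?x y) (?x y)"
    proof (rule sum_Basis_frame[where A = A and e = e, OF x])
      show "e i \<in> tangent (?x y)" for i
        using d_stereo_tangent[of y i] by (simp add: e_def tangent_def)
      show "e i \<bullet> e j = (if i = j then 1 else 0)" if "i \<in> Basis" "j \<in> Basis" for i j
        using that r0 by (simp add: e_def d_stereo_inner power2_eq_square inner_Basis)
    qed (auto intro: Al)
    \<comment> \<open>Since \<open>U\<close> is tangent to all concentric spheres, differentiating
      \<open>U z \<bullet> z = 0\<close> radially kills the normal entry. So the ambient divergence
      is the divergence on the sphere.\<close>
    moreover have "A (?x y) (?x y) = 0"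
    proof -
      have d: "((\<lambda>z. U z \<bullet> z) has_derivative (\<lambda>h. U (?x y) \<bullet> h + pd h U (?x y) \<bullet> ?x y)) (at (?x y))"
        by (rule has_derivative_inner[OF differentiable_has_pd[OF dU] has_derivative_ident])
      have "((\<lambda>z. U z \<bullet> z) has_derivative (\<lambda>h. 0)) (at (?x y))"
        by (rule has_derivative_transform_within_open[OF has_derivative_const open_punctured x0])
          (use tan in simp)
      from fun_cong[OF has_derivative_unique[OF d this], of "?x y"] tan[of "?x y"] x0[of y]
      show ?thesis by (simp add: A_def)
    qed
    moreover have "A (e i) (e i) = (1 / (rho y)\<^sup>2) * A (d_stereo y i) (d_stereo y i)" for i
      unfolding e_def by (simp add: linear_scale[OF Al(1)] linear_scale[OF Al(2)] power2_eq_square)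
    ultimately have "(\<Sum>b\<in>Basis. A b b) = (1 / (rho y)\<^sup>2) * (\<Sum>i\<in>Basis. A (d_stereo y i) (d_stereo y i))"
      by (simp add: sum_distrib_left)
    then have 1: "(\<Sum>i\<in>Basis. A (d_stereo y i) (d_stereo y i)) = (rho y)\<^sup>2 * (\<Sum>b\<in>Basis. A b b)"
      using r0 by simp
    have "(\<Sum>i\<in>Basis. g i y) = U (?x y) \<bullet> (\<Sum>i\<in>Basis. dw_field i y i) + rho y ^ 4 * (\<Sum>i\<in>Basis. A (d_stereo y i) (d_stereo y i))"
      unfolding g_def A_def w_field_def by (simp add: sum.distrib inner_sum_right sum_distrib_left)
    also have "U (?x y) \<bullet> (\<Sum>i\<in>Basis. dw_field i y i) = 0"
      unfolding sum_dw_field using tan[of "?x y"] x0[of y] by simp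
    also have "0 + rho y ^ 4 * (\<Sum>i\<in>Basis. A (d_stereo y i) (d_stereo y i)) = ?f y"
      unfolding 1 unfolding A_def by (simp flip: power_add mult.assoc)
    finally show ?thesis .
  qed
  have "integrable lborel (\<lambda>y. \<Sum>i\<in>Basis. g i y)"
    by (rule Bochner_Integration.integrable_sum) (rule int(1))
  then show "integrable lborel ?f" unfolding sum .
  have "(\<integral>y. (\<Sum>i\<in>Basis. g i y) \<partial>lborel) = 0"
    using Bochner_Integration.integral_sum[of Basis lborel g] int by simp
  then show "(\<integral>y. ?f y \<partial>lborel) = 0" unfolding sum .
qed

subsection \<open>The volume element\<close>

abbreviation (input) conf_metric :: "(real^7 \<Rightarrow> real) \<Rightarrow> metric" where
  "conf_metric l \<equiv> \<lambda>x u v. l x * round_metric x u v"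

lemma chart_metric_conformal:
  "chart_metric (conf_metric l) y = (\<chi> i j. if i = j then l (inv_stereo y) * (rho y)\<^sup>2 else 0)"
  unfolding chart_metric_def round_metric_def frechet_derivative_at[OF has_derivative_inv_stereo, symmetric]
    d_stereo_inner
  by (simp add: vec_eq_iff inner_axis_axis)

lemma sqrt_det_chart_metric:
  assumes "l (inv_stereo y) > 0"
  shows "sqrt (det (chart_metric (conf_metric l) y)) = l (inv_stereo y) ^ 3 * rho y ^ 6"
proof -
  have "det (chart_metric (conf_metric l) y) = (l (inv_stereo y) * (rho y)\<^sup>2) ^ 6"
    unfolding chart_metric_conformal by (subst det_diagonal) simp_all
  also have "\<dots> = (l (inv_stereo y) ^ 3 * rho y ^ 6)\<^sup>2"
    by (simp add: power_mult_distrib flip: power_mult)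
  finally show ?thesis using assms rho_pos[of y] by (simp add: real_sqrt_abs)
qed

text \<open>The weight of the divergence theorem is enough: \<open>rho^6\<close> is at most
  \<open>4 * rho^4\<close>, which is 64 times \<open>1 / (1 + (norm y)\<^sup>2) ^ 4\<close>.\<close>

lemma continuous_imp_integrable_chart:
  assumes "continuous_on S6 f" shows "integrable lborel (\<lambda>y. rho y ^ 6 * f (inv_stereo y) :: real)"
proof -
  from continuous_bounded_sphere[OF assms] obtain C where C: "\<forall>x\<in>S6. norm (f x) \<le> C" "C \<ge> 0"
    by (elim exE conjE)
  have "integrable lborel (\<lambda>y::real^6. (64 * C) * (1 / (1 + (norm y)\<^sup>2) ^ 4))"
    by (rule integrable_mult_right[OF integrable_inverse_power])
  then show ?thesis
  proof (rule Bochner_Integration.integrable_bound)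
    have "continuous_on UNIV (\<lambda>y. rho y ^ 6 * f (inv_stereo y))"
      by (intro continuous_intros continuous_rho continuous_on_inv_stereo_comp assms)
    then show "(\<lambda>y. rho y ^ 6 * f (inv_stereo y)) \<in> borel_measurable lborel"
      using borel_measurable_continuous_onI by simp
    show "AE y in lborel. norm (rho y ^ 6 * f (inv_stereo y)) \<le> norm ((64 * C) * (1 / (1 + (norm y)\<^sup>2) ^ 4))"
    proof (rule AE_I2)
      fix y :: "real^6"
      have r: "0 < rho y" "rho y \<le> 2" using rho_pos embed_pole_bounds(3) by auto
      have w: "rho y ^ 4 = 16 * (1 / (1 + (norm y)\<^sup>2) ^ 4)" unfolding rho_def by (simp add: power_divide)
      have "norm (rho y ^ 6 * f (inv_stereo y)) = rho y ^ 4 * (rho y * rho y) * norm (f (inv_stereo y))"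
        using r by (simp add: abs_mult flip: power_Suc2 mult.assoc)
      also have "\<dots> \<le> rho y ^ 4 * (2 * 2) * C"
        using r C bspec[OF C(1) inv_stereo_sphere[of y]] by (intro mult_mono) auto
      also have "\<dots> = (64 * C) * (1 / (1 + (norm y)\<^sup>2) ^ 4)" unfolding w by simp
      finally show "norm (rho y ^ 6 * f (inv_stereo y)) \<le> norm ((64 * C) * (1 / (1 + (norm y)\<^sup>2) ^ 4))"
        unfolding real_norm_def by (rule order_trans[OF _ abs_ge_self])
    qed
  qed
qed

lemma integral_vol:
  fixes f :: "real^7 \<Rightarrow> real"
  assumes l: "continuous_on S6 l" "\<And>x. x \<in> S6 \<Longrightarrow> l x > 0" and f: "continuous_on S6 f"
  shows "(\<integral>x. f x \<partial>vol (conf_metric l))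
    = (\<integral>y. rho y ^ 6 * (l (inv_stereo y) ^ 3 * f (inv_stereo y)) \<partial>lborel)"
proof -
  let ?d = "\<lambda>y. l (inv_stereo y) ^ 3 * rho y ^ 6"
  have lp: "l (inv_stereo y) > 0" for y by (rule l(2)[OF inv_stereo_sphere])
  have m: "inv_stereo \<in> measurable (density lborel ?d) (restrict_space borel S6)"
  proof (rule measurable_restrict_space2)
    show "inv_stereo \<in> space (density lborel ?d) \<rightarrow> S6" using inv_stereo_sphere by blast
    show "inv_stereo \<in> borel_measurable (density lborel ?d)"
      using borel_measurable_continuous_onI[OF continuous_inv_stereo] by simp
  qed
  have "continuous_on UNIV ?d"
    by (intro continuous_intros continuous_rho continuous_on_inv_stereo_comp l)
  then have dm: "?d \<in> borel_measurable lborel" using borel_measurable_continuous_onI by simp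
  have fm: "(\<lambda>y. f (inv_stereo y)) \<in> borel_measurable lborel"
    using borel_measurable_continuous_onI[OF continuous_on_inv_stereo_comp[OF f]] by simp
  have "(\<integral>x. f x \<partial>vol (conf_metric l))
      = (\<integral>x. f x \<partial>distr (density lborel ?d) (restrict_space borel S6) inv_stereo)"
    unfolding vol_def sqrt_det_chart_metric[where l = l, OF lp] ..
  also have "\<dots> = (\<integral>y. f (inv_stereo y) \<partial>density lborel ?d)"
    by (rule integral_distr[OF m borel_measurable_continuous_on_restrict[OF f]])
  also have "\<dots> = (\<integral>y. ?d y *\<^sub>R f (inv_stereo y) \<partial>lborel)"
    by (rule integral_density[OF fm dm]) (rule AE_I2, use lp rho_pos in \<open>simp add: less_imp_le\<close>)
  finally show ?thesis by (simp add: mult_ac)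
qed

lemma space_vol: "space (vol g) = S6"
  by (simp add: vol_def space_restrict_space)

subsection \<open>The Levi-Civita connection of a conformally round metric\<close>

definition grad :: "(real^7 \<Rightarrow> real) \<Rightarrow> real^7 \<Rightarrow> real^7" where
  "grad f x = (\<Sum>b\<in>Basis. pd b (\<lambda>y. f (sgn y)) x *\<^sub>R b)"

lemma grad_inner:
  assumes "smooth_on S6 f" "x \<in> S6" shows "grad f x \<bullet> u = pd u (\<lambda>y. f (sgn y)) x"
proof -
  have "(\<lambda>y. f (sgn y)) differentiable (at x)"
    by (rule smooth_differentiable[OF smooth_hat[OF assms(1)]]) (use assms(2) in auto)
  from pd_basis_expansion[OF this, of u] show ?thesis
    by (simp add: grad_def inner_sum_left inner_commute[of u] mult.commute)
qed

lemma grad_tangent: "smooth_on S6 f \<Longrightarrow> x \<in> S6 \<Longrightarrow> grad f x \<in> tangent x"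
  using grad_inner[of f x x] pd_hat_radial[of f x] by (simp add: tangent_def sphere_nonzero)

text \<open>The tangential part of the ambient derivative is the round connection. The rest is the
  standard correction for a metric e^(2f) times the round one; here 2f = log l, hence the factor
  1/(2l) in front of the gradient terms.\<close>

definition conf_connection ::
    "(real^7 \<Rightarrow> real) \<Rightarrow> (real^7 \<Rightarrow> real^7) \<Rightarrow> (real^7 \<Rightarrow> real^7) \<Rightarrow> real^7 \<Rightarrow> real^7" where
  "conf_connection l X Y x = tangential_field (pd (X x) (\<lambda>y. Y (sgn y)) x) x
     + inverse (2 * l x) *\<^sub>R ((grad l x \<bullet> X x) *\<^sub>R Y x + (grad l x \<bullet> Y x) *\<^sub>R X x - (X x \<bullet> Y x) *\<^sub>R grad l x)"

lemma vector_field_smooth: "vector_field X \<Longrightarrow> smooth_on S6 X"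
  by (simp add: vector_field_def)

lemma vector_field_inner: "vector_field X \<Longrightarrow> x \<in> S6 \<Longrightarrow> X x \<bullet> x = 0"
  by (simp add: vector_field_def tangent_def)

lemma vector_field_tangent: "vector_field X \<Longrightarrow> x \<in> S6 \<Longrightarrow> X x \<in> tangent x"
  by (simp add: vector_field_def)

lemma hat_differentiable: "smooth_on S6 f \<Longrightarrow> x \<in> S6 \<Longrightarrow> (\<lambda>y. f (sgn y)) differentiable (at x)"
  by (rule smooth_differentiable[OF smooth_hat]) auto

text \<open>Differentiate \<open>Y \<bullet> x = 0\<close>. The normal part is the second
  fundamental form and is symmetric in the two fields, so it cancels in the bracket and the
  projected connection is torsion-free.\<close>

lemma vector_field_normal_derivative:
  assumes Y: "vector_field Y" and x: "x \<in> S6" and u: "u \<in> tangent x"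
  shows "pd u (\<lambda>y. Y (sgn y)) x \<bullet> x = - (u \<bullet> Y x)"
proof -
  have d: "((\<lambda>y. Y (sgn y) \<bullet> sgn y) has_derivative
      (\<lambda>v. Y (sgn x) \<bullet> tangential_field v x + pd v (\<lambda>y. Y (sgn y)) x \<bullet> sgn x)) (at x)"
    by (rule has_derivative_inner[OF differentiable_has_pd[OF hat_differentiable[OF vector_field_smooth[OF Y] x]]
          has_derivative_sgn_sphere[OF x]])
  have "((\<lambda>y. Y (sgn y) \<bullet> sgn y) has_derivative (\<lambda>v. 0)) (at x)"
    by (rule has_derivative_transform_within_open[OF has_derivative_const open_punctured])
      (use x vector_field_inner[OF Y sgn_in_sphere] in auto)
  from fun_cong[OF has_derivative_unique[OF d this], of u] show ?thesis
    by (simp add: sgn_sphere[OF x] tangential_field_id[OF u] inner_commute)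
qed

lemma conf_connection_tangent:
  assumes "smooth_on S6 l" "vector_field X" "vector_field Y" "x \<in> S6"
  shows "conf_connection l X Y x \<in> tangent x"
  unfolding conf_connection_def
  using tangential_field_tangent[OF assms(4), of "pd (X x) (\<lambda>y. Y (sgn y)) x"]
    vector_field_tangent[OF assms(2,4)] vector_field_tangent[OF assms(3,4)] grad_tangent[OF assms(1,4)]
  by (simp add: tangent_def inner_add_left inner_diff_left)

lemma smooth_grad: "smooth_on S6 f \<Longrightarrow> smooth (- {0}) (grad f)"
  unfolding grad_def
  by (rule smooth_sum[OF open_punctured], rule smooth_scaleR[OF smooth_pd[OF smooth_hat] smooth_const[OF open_punctured]])

lemma smooth_conf_connection:
  assumes l: "smooth_on S6 l" "\<And>x. x \<in> S6 \<Longrightarrow> l x > 0" and X: "vector_field X" and Y: "vector_field Y"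
  shows "smooth_on S6 (conf_connection l X Y)"
proof (rule smooth_on_sphereI)
  let ?X = "\<lambda>y. X (sgn y)" and ?Y = "\<lambda>y. Y (sgn y)" and ?l = "\<lambda>y. l (sgn y)"
  note op = open_punctured
  note sX = smooth_hat[OF vector_field_smooth[OF X]] and sY = smooth_hat[OF vector_field_smooth[OF Y]]
  note sl = smooth_hat[OF l(1)] and sg = smooth_grad[OF l(1)]
  note sD = smooth_pd_field[OF sY sX]
  have lp: "2 * l (sgn y) \<noteq> 0" if "y \<in> - {0}" for y using l(2)[OF sgn_in_sphere[of y]] that by simp
  show "smooth (- {0}) (\<lambda>y. (pd (?X y) ?Y y - (pd (?X y) ?Y y \<bullet> y) *\<^sub>R y)
     + inverse (2 * ?l y) *\<^sub>R ((grad l y \<bullet> ?X y) *\<^sub>R ?Y y + (grad l y \<bullet> ?Y y) *\<^sub>R ?X y - (?X y \<bullet> ?Y y) *\<^sub>R grad l y))"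
    (is "smooth _ ?F")
    by (rule smooth_add[OF smooth_diff[OF sD smooth_scaleR[OF smooth_inner[OF sD smooth_ident[OF op]] smooth_ident[OF op]]]
          smooth_scaleR[OF smooth_inverse[OF smooth_mult[OF smooth_const[OF op] sl] lp]
            smooth_diff[OF smooth_add[OF smooth_scaleR[OF smooth_inner[OF sg sX] sY] smooth_scaleR[OF smooth_inner[OF sg sY] sX]]
              smooth_scaleR[OF smooth_inner[OF sX sY] sg]]]])
  show "?F x = conf_connection l X Y x" if "x \<in> S6" for x
    by (simp only: sgn_sphere[OF that] conf_connection_def tangential_field_def)
qed

lemma tangential_field_add: "tangential_field (u + v) x = tangential_field u x + tangential_field v x"
  by (rule linear_add[OF linear_tangential_field])

lemma tangential_field_scale: "tangential_field (c *\<^sub>R v) x = c *\<^sub>R tangential_field v x"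
  by (rule linear_scale[OF linear_tangential_field])

lemma is_levi_civita_conf_connection:
  assumes l: "smooth_on S6 l" "\<And>x. x \<in> S6 \<Longrightarrow> l x > 0"
  shows "is_levi_civita (conf_metric l) (conf_connection l)"
  unfolding is_levi_civita_def
proof (intro conjI allI impI ballI)
  fix X Y assume XY: "vector_field X" "vector_field Y"
  show "vector_field (conf_connection l X Y)"
    using smooth_conf_connection[OF l XY] conf_connection_tangent[OF l(1) XY] by (simp add: vector_field_def)
next
  fix X X' Y x assume v: "vector_field X" "vector_field X'" "vector_field Y" and x: "x \<in> S6"
  note lin = pd_linear[OF hat_differentiable[OF vector_field_smooth[OF v(3)] x]]
  show "conf_connection l (\<lambda>y. X y + X' y) Y x = conf_connection l X Y x + conf_connection l X' Y x"
    unfolding conf_connection_def by (simp add: linear_add[OF lin] tangential_field_add algebra_simps inner_add_left inner_add_right)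
next
  fix f :: "real^7 \<Rightarrow> real" and X Y x assume v: "smooth_on S6 f" "vector_field X" "vector_field Y" and x: "x \<in> S6"
  note lin = pd_linear[OF hat_differentiable[OF vector_field_smooth[OF v(3)] x]]
  show "conf_connection l (\<lambda>y. f y *\<^sub>R X y) Y x = f x *\<^sub>R conf_connection l X Y x"
    unfolding conf_connection_def by (simp add: linear_scale[OF lin] tangential_field_scale algebra_simps)
next
  fix X Y Y' x assume v: "vector_field X" "vector_field Y" "vector_field Y'" and x: "x \<in> S6"
  have "pd (X x) (\<lambda>y. Y (sgn y) + Y' (sgn y)) x = pd (X x) (\<lambda>y. Y (sgn y)) x + pd (X x) (\<lambda>y. Y' (sgn y)) x"
    by (rule pd_eqI[OF has_derivative_add[OF differentiable_has_pd differentiable_has_pd]])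
      (rule hat_differentiable[OF vector_field_smooth[OF v(2)] x], rule hat_differentiable[OF vector_field_smooth[OF v(3)] x])
  then show "conf_connection l X (\<lambda>y. Y y + Y' y) x = conf_connection l X Y x + conf_connection l X Y' x"
    unfolding conf_connection_def by (simp add: tangential_field_add algebra_simps inner_add_right)
next
  fix f :: "real^7 \<Rightarrow> real" and X Y x assume v: "smooth_on S6 f" "vector_field X" "vector_field Y" and x: "x \<in> S6"
  have "pd (X x) (\<lambda>y. f (sgn y) *\<^sub>R Y (sgn y)) x = f (sgn x) *\<^sub>R pd (X x) (\<lambda>y. Y (sgn y)) x + pd (X x) (\<lambda>y. f (sgn y)) x *\<^sub>R Y (sgn x)"
    by (rule pd_eqI[OF has_derivative_scaleR[OF differentiable_has_pd differentiable_has_pd]])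
      (rule hat_differentiable[OF v(1) x], rule hat_differentiable[OF vector_field_smooth[OF v(3)] x])
  moreover have "sphere_deriv f x (X x) = pd (X x) (\<lambda>y. f (sgn y)) x"
    by (rule sphere_deriv_hat[OF v(1) x vector_field_tangent[OF v(2) x]])
  ultimately show "conf_connection l X (\<lambda>y. f y *\<^sub>R Y y) x = sphere_deriv f x (X x) *\<^sub>R Y x + f x *\<^sub>R conf_connection l X Y x"
    unfolding conf_connection_def
    by (simp add: sgn_sphere[OF x] tangential_field_add tangential_field_scale
        tangential_field_id[OF vector_field_tangent[OF v(3) x]] algebra_simps)
next
  fix X Y x assume v: "vector_field X" "vector_field Y" and x: "x \<in> S6"
  let ?a = "pd (X x) (\<lambda>y. Y (sgn y)) x" and ?b = "pd (Y x) (\<lambda>y. X (sgn y)) x"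
  have "?a \<bullet> x = ?b \<bullet> x"
    using vector_field_normal_derivative[OF v(2) x vector_field_tangent[OF v(1) x]]
      vector_field_normal_derivative[OF v(1) x vector_field_tangent[OF v(2) x]] by (simp add: inner_commute)
  then have "tangential_field ?a x - tangential_field ?b x = ?a - ?b" by (simp add: tangential_field_def)
  moreover have "lie_bracket X Y x = ?a - ?b"
    unfolding lie_bracket_def
    by (simp add: sphere_deriv_hat[OF vector_field_smooth[OF v(2)] x vector_field_tangent[OF v(1) x]]
        sphere_deriv_hat[OF vector_field_smooth[OF v(1)] x vector_field_tangent[OF v(2) x]])
  moreover have "conf_connection l X Y x - conf_connection l Y X x = tangential_field ?a x - tangential_field ?b x"
    unfolding conf_connection_def inner_commute[of "Y x" "X x"] by (simp add: add.commute)
  ultimately show "conf_connection l X Y x - conf_connection l Y X x = lie_bracket X Y x" by simp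
next
  fix X Y Z x assume v: "vector_field X" "vector_field Y" "vector_field Z" and x: "x \<in> S6"
  let ?l = "\<lambda>y. l (sgn y)" and ?Y = "\<lambda>y. Y (sgn y)" and ?Z = "\<lambda>y. Z (sgn y)"
  note sl = smooth_hat[OF l(1)] and sY = smooth_hat[OF vector_field_smooth[OF v(2)]]
    and sZ = smooth_hat[OF vector_field_smooth[OF v(3)]]
  have lp: "l x \<noteq> 0" using l(2)[OF x] by simp
  have x0: "x \<in> - {0}" using x by auto
  have "sphere_deriv (\<lambda>y. l y * round_metric y (Y y) (Z y)) x (X x) = pd (X x) (\<lambda>y. ?l y * (?Y y \<bullet> ?Z y)) x"
    by (rule sphere_deriv_eq_pd_smooth[OF x vector_field_tangent[OF v(1) x] smooth_mult[OF sl smooth_inner[OF sY sZ]]])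
      (simp add: sgn_sphere round_metric_def)
  also have "\<dots> = ?l x * (?Y x \<bullet> pd (X x) ?Z x + pd (X x) ?Y x \<bullet> ?Z x) + pd (X x) ?l x * (?Y x \<bullet> ?Z x)"
    by (rule pd_eqI[OF has_derivative_mult[OF smooth_has_pd[OF sl x0]
            has_derivative_inner[OF smooth_has_pd[OF sY x0] smooth_has_pd[OF sZ x0]]]])
  also have "\<dots> = l x * (Y x \<bullet> pd (X x) ?Z x + pd (X x) ?Y x \<bullet> Z x) + (grad l x \<bullet> X x) * (Y x \<bullet> Z x)"
    by (simp add: sgn_sphere[OF x] grad_inner[OF l(1) x])
  also have "\<dots> = l x * round_metric x (conf_connection l X Y x) (Z x) + l x * round_metric x (Y x) (conf_connection l X Z x)"
  proof -
    have t: "tangential_field a x \<bullet> Z x = a \<bullet> Z x" "Y x \<bullet> tangential_field a x = Y x \<bullet> a" for a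
      using vector_field_inner[OF v(2) x] vector_field_inner[OF v(3) x]
      by (simp_all add: tangential_field_def inner_diff_left inner_diff_right inner_commute[of x])
    have "l x * (s * inverse (2 * l x)) = s / 2" for s using lp by simp
    then have i: "l x * (inverse (2 * l x) * s) = s / 2" for s by (simp add: mult.commute)
    show ?thesis
      unfolding conf_connection_def round_metric_def inner_add_left inner_add_right inner_scaleR_left inner_scaleR_right
        t distrib_left[of "l x"] i inner_diff_left inner_diff_right
      by (simp add: inner_commute field_simps)
  qed
  finally show "sphere_deriv (\<lambda>y. l y * round_metric y (Y y) (Z y)) x (X x) =
      l x * round_metric x (conf_connection l X Y x) (Z x) + l x * round_metric x (Y x) (conf_connection l X Z x)" .
qed

lemma is_levi_civitaD:
  assumes "is_levi_civita g D" "vector_field X" "vector_field Y"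
  shows "vector_field (D X Y)" "x \<in> S6 \<Longrightarrow> D X Y x - D Y X x = lie_bracket X Y x"
    "vector_field Z \<Longrightarrow> x \<in> S6 \<Longrightarrow>
      sphere_deriv (\<lambda>y. g y (Y y) (Z y)) x (X x) = g x (D X Y x) (Z x) + g x (Y x) (D X Z x)"
proof -
  note D = assms(1)[unfolded is_levi_civita_def]
  show "vector_field (D X Y)" by (rule D[THEN conjunct1, rule_format, OF assms(2,3)])
  show "D X Y x - D Y X x = lie_bracket X Y x" if "x \<in> S6"
    by (rule D[THEN conjunct2, THEN conjunct2, THEN conjunct2, THEN conjunct2, THEN conjunct2, THEN conjunct1,
          rule_format, OF assms(2,3) that])
  show "sphere_deriv (\<lambda>y. g y (Y y) (Z y)) x (X x) = g x (D X Y x) (Z x) + g x (Y x) (D X Z x)"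
    if "vector_field Z" "x \<in> S6"
    by (rule D[THEN conjunct2, THEN conjunct2, THEN conjunct2, THEN conjunct2, THEN conjunct2, THEN conjunct2,
          rule_format, OF assms(2,3) that])
qed

text \<open>
  The difference tensor \<open>A\<close> of two Levi-Civita connections has \<open>g(A(X, Y), Z)\<close> symmetric in \<open>X\<close>, \<open>Y\<close>
  and antisymmetric in \<open>Y\<close>, \<open>Z\<close>, hence vanishes.
\<close>

lemma levi_civita_unique:
  assumes l: "\<And>x. x \<in> S6 \<Longrightarrow> l x > 0"
    and D: "is_levi_civita (conf_metric l) D"
    and D': "is_levi_civita (conf_metric l) D'"
    and X: "vector_field X" and Y: "vector_field Y" and x: "x \<in> S6"
  shows "D X Y x = D' X Y x"
proof -
  define A where "A = (\<lambda>X Y. D X Y x - D' X Y x)"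
  have lp: "l x \<noteq> 0" using l[OF x] by simp
  have tors: "D X Y x - D Y X x = lie_bracket X Y x" "D' X Y x - D' Y X x = lie_bracket X Y x"
    if "vector_field X" "vector_field Y" for X Y
    by (rule is_levi_civitaD(2)[OF D that x], rule is_levi_civitaD(2)[OF D' that x])
  have sym: "A X Y = A Y X" if "vector_field X" "vector_field Y" for X Y
    using tors[OF that] unfolding A_def by (simp add: algebra_simps)
  have met: "sphere_deriv (\<lambda>y. l y * round_metric y (Y y) (Z y)) x (X x) =
        l x * round_metric x (D X Y x) (Z x) + l x * round_metric x (Y x) (D X Z x)"
     "sphere_deriv (\<lambda>y. l y * round_metric y (Y y) (Z y)) x (X x) =
        l x * round_metric x (D' X Y x) (Z x) + l x * round_metric x (Y x) (D' X Z x)"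
    if "vector_field X" "vector_field Y" "vector_field Z" for X Y Z
    by (rule is_levi_civitaD(3)[OF D that x], rule is_levi_civitaD(3)[OF D' that x])
  have skew: "A X Y \<bullet> Z x = - (A X Z \<bullet> Y x)" if "vector_field X" "vector_field Y" "vector_field Z" for X Y Z
  proof -
    have "l x * (A X Y \<bullet> Z x + A X Z \<bullet> Y x) = 0"
      using met[OF that] unfolding A_def round_metric_def
      by (simp add: inner_diff_left inner_commute[of "Y x"] algebra_simps)
    then show ?thesis using lp by simp
  qed
  have zero: "A X Y \<bullet> Z x = 0" if Z: "vector_field Z" for Z
  proof -
    have "A X Y \<bullet> Z x = - (A X Z \<bullet> Y x)" by (rule skew[OF X Y Z])
    also have "\<dots> = - (A Z X \<bullet> Y x)" by (simp add: sym[OF X Z])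
    also have "\<dots> = A Z Y \<bullet> X x" using skew[OF Z X Y] by simp
    also have "\<dots> = A Y Z \<bullet> X x" by (simp add: sym[OF Z Y])
    also have "\<dots> = - (A Y X \<bullet> Z x)" by (rule skew[OF Y Z X])
    also have "\<dots> = - (A X Y \<bullet> Z x)" by (simp add: sym[OF X Y])
    finally show ?thesis by simp
  qed
  have "vector_field (D X Y)" "vector_field (D' X Y)"
    by (rule is_levi_civitaD(1)[OF D X Y], rule is_levi_civitaD(1)[OF D' X Y])
  then have "A X Y \<in> tangent x"
    using x by (simp add: A_def vector_field_def tangent_def inner_diff_left)
  \<comment> \<open>The test field is the projection field of the vector \<open>A X Y\<close>
    itself, whose value at \<open>x\<close> is that vector.\<close>
  then have "A X Y \<bullet> A X Y = 0"
    using zero[OF vector_field_tangential, of "A X Y"] by (simp add: tangential_field_id)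
  then show ?thesis unfolding A_def by simp
qed

lemma levi_civita_conf:
  assumes l: "smooth_on S6 l" "\<And>x. x \<in> S6 \<Longrightarrow> l x > 0"
    and X: "vector_field X" and Y: "vector_field Y" and x: "x \<in> S6"
  shows "levi_civita (conf_metric l) X Y x = conf_connection l X Y x"
proof (rule levi_civita_unique[OF l(2) _ is_levi_civita_conf_connection[OF l] X Y x])
  show "is_levi_civita (conf_metric l) (levi_civita (conf_metric l))"
    unfolding levi_civita_def by (rule someI[of "is_levi_civita _", OF is_levi_civita_conf_connection[OF l]])
qed

subsection \<open>Orthogonal almost-complex structures\<close>

lemma orthogonal_conformal_iff:
  assumes "\<And>x. x \<in> S6 \<Longrightarrow> l x > 0"
  shows "orthogonal_almost_complex (conf_metric l) J \<longleftrightarrow> orthogonal_almost_complex round_metric J"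
proof -
  have "l x * a = l x * b \<longleftrightarrow> a = b" if "x \<in> S6" for x a b using assms[OF that] by simp
  then show ?thesis unfolding orthogonal_almost_complex_def by auto
qed

locale orthogonal_structure =
  fixes J :: "real^7 \<Rightarrow> real^7 \<Rightarrow> real^7"
  assumes orthogonal: "orthogonal_almost_complex round_metric J"
begin

text \<open>The extension of \<open>J\<close> to \<open>\<real>\<^sup>7 - {0}\<close>, homogeneous of degree zero and vanishing on the radial direction.\<close>

definition K :: "real^7 \<Rightarrow> real^7 \<Rightarrow> real^7" where
  "K y v = J (sgn y) (tangential_field v (sgn y))"

abbreviation DK :: "real^7 \<Rightarrow> real^7 \<Rightarrow> real^7 \<Rightarrow> real^7" where
  "DK x u v \<equiv> pd u (\<lambda>y. K y v) x"

lemma ac: "almost_complex J"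
  using orthogonal by (simp add: orthogonal_almost_complex_def)

lemma J_tangent: "x \<in> S6 \<Longrightarrow> v \<in> tangent x \<Longrightarrow> J x v \<in> tangent x"
  using ac by (simp add: almost_complex_def)

lemma J_linear: "x \<in> S6 \<Longrightarrow> u \<in> tangent x \<Longrightarrow> v \<in> tangent x \<Longrightarrow>
    J x (a *\<^sub>R u + b *\<^sub>R v) = a *\<^sub>R J x u + b *\<^sub>R J x v"
  using ac by (simp add: almost_complex_def)

lemma J_J: "x \<in> S6 \<Longrightarrow> v \<in> tangent x \<Longrightarrow> J x (J x v) = - v"
  using ac by (simp add: almost_complex_def)

lemma J_inner: "x \<in> S6 \<Longrightarrow> u \<in> tangent x \<Longrightarrow> v \<in> tangent x \<Longrightarrow> J x u \<bullet> J x v = u \<bullet> v"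
  using orthogonal by (simp add: orthogonal_almost_complex_def round_metric_def)

lemma smooth_K: "smooth (- {0}) (\<lambda>y. K y v)"
  unfolding K_def by (rule smooth_structure_hat[OF ac])

lemma K_linear: assumes "y \<noteq> 0" shows "linear (K y)"
proof (rule linearI)
  note x = sgn_in_sphere[OF assms] and t = tangential_field_tangent[OF sgn_in_sphere[OF assms]]
  show "K y (u + v) = K y u + K y v" for u v
    using J_linear[OF x t t, of 1 u 1 v] by (simp add: K_def tangential_field_add)
  show "K y (c *\<^sub>R u) = c *\<^sub>R K y u" for c u
    using J_linear[OF x t t, of c u 0 u] by (simp add: K_def tangential_field_scale)
qed

lemma K_tangent: "y \<noteq> 0 \<Longrightarrow> K y v \<in> tangent (sgn y)"
  unfolding K_def by (rule J_tangent[OF sgn_in_sphere tangential_field_tangent[OF sgn_in_sphere]])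

lemma tangential_field_sym: "tangential_field u x \<bullet> v = u \<bullet> tangential_field v x"
  by (simp add: tangential_field_def inner_diff_left inner_diff_right inner_commute mult.commute)

lemma K_sphere: "x \<in> S6 \<Longrightarrow> v \<in> tangent x \<Longrightarrow> K x v = J x v"
  by (simp add: K_def sgn_sphere tangential_field_id)

lemma K_K: assumes "y \<noteq> 0" shows "K y (K y v) = - tangential_field v (sgn y)"
proof -
  note x = sgn_in_sphere[OF assms]
  have "K y (K y v) = J (sgn y) (K y v)"
    unfolding K_def[of y "K y v"] tangential_field_id[OF K_tangent[OF assms]] ..
  then show ?thesis unfolding K_def using J_J[OF x tangential_field_tangent[OF x]] by simp
qed

lemma K_skew: assumes "y \<noteq> 0" shows "K y u \<bullet> v = - (u \<bullet> K y v)"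
proof -
  note x = sgn_in_sphere[OF assms] and t = tangential_field_tangent[OF sgn_in_sphere[OF assms]]
  have "K y u \<bullet> v = K y u \<bullet> tangential_field v (sgn y)"
    unfolding tangential_field_sym[symmetric] tangential_field_id[OF K_tangent[OF assms]] ..
  also have "\<dots> = J (sgn y) (K y u) \<bullet> K y v"
    unfolding K_def[of y v] by (rule J_inner[OF x K_tangent[OF assms] t, symmetric])
  also have "J (sgn y) (K y u) = - tangential_field u (sgn y)"
    unfolding K_def[of y u] by (rule J_J[OF x t])
  also have "- tangential_field u (sgn y) \<bullet> K y v = - (u \<bullet> K y v)"
    by (simp add: tangential_field_sym tangential_field_id[OF K_tangent[OF assms]])
  finally show ?thesis .
qed

lemma K_tangential: "x \<in> S6 \<Longrightarrow> K x (tangential_field v x) = K x v"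
  by (simp add: K_def sgn_sphere tangential_field_id tangential_field_tangent)

lemma tangential_trace: assumes "x \<in> S6" shows "(\<Sum>b\<in>Basis. tangential_field b x \<bullet> b) = 6"
proof -
  have "(\<Sum>b\<in>Basis. tangential_field b x \<bullet> b) = (\<Sum>b\<in>(Basis :: (real^7) set). 1 - (x \<bullet> b) * (x \<bullet> b))"
    by (rule sum.cong[OF refl]) (simp only: tangential_field_def inner_diff_left inner_scaleR_left
        inner_commute[of _ x] inner_same_Basis)
  also have "\<dots> = 7 - x \<bullet> x" by (simp add: sum_subtractf euclidean_inner[of x x])
  finally show ?thesis using sphere_inner_self[OF assms] by simp
qed

lemma hermitian: assumes x: "x \<in> S6" shows "hermitian (\<lambda>v. tangential_field v x) (K x)"
proof (rule hermitian.intro)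
  have x0: "x \<noteq> 0" using x by auto
  show "linear (\<lambda>v. tangential_field v x)" by (rule linear_tangential_field)
  show "linear (K x)" by (rule K_linear[OF x0])
  show "tangential_field u x \<bullet> v = u \<bullet> tangential_field v x" for u v by (rule tangential_field_sym)
  show "tangential_field (tangential_field u x) x = tangential_field u x" for u
    by (rule tangential_field_id[OF tangential_field_tangent[OF x]])
  show "K x u \<bullet> v = - (u \<bullet> K x v)" for u v by (rule K_skew[OF x0])
  show "K x (K x u) = - tangential_field u x" for u using K_K[OF x0, of u] by (simp add: sgn_sphere[OF x])
  show "K x (tangential_field u x) = K x u" for u by (rule K_tangential[OF x])
  show "(\<Sum>b\<in>Basis. tangential_field b x \<bullet> b) = 6" by (rule tangential_trace[OF x])
qed

section \<open>First derivatives of the extended structure\<close>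

lemma DK_differentiable: "x \<noteq> 0 \<Longrightarrow> (\<lambda>y. K y v) differentiable (at x)"
  by (rule smooth_differentiable[OF smooth_K]) auto

lemma DK_linear_left: "x \<noteq> 0 \<Longrightarrow> linear (\<lambda>u. DK x u v)"
  by (rule pd_linear[OF DK_differentiable])

lemma DK_linear_right: assumes "x \<noteq> 0" shows "linear (\<lambda>v. DK x u v)"
proof (rule linearI)
  note d = differentiable_has_pd[OF DK_differentiable[OF assms]]
  have eq: "pd u f x = pd u g x" if "\<And>y. y \<in> - {0} \<Longrightarrow> f y = g y" "g differentiable (at x)" for f g :: "real^7 \<Rightarrow> real^7"
    using frechet_derivative_transform_within_open[OF that(2) open_punctured, of f] that(1) assms by auto
  show "DK x u (v + w) = DK x u v + DK x u w" for v w
  proof -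
    have "DK x u (v + w) = pd u (\<lambda>y. K y v + K y w) x"
      by (rule eq[OF _ differentiable_add[OF DK_differentiable[OF assms] DK_differentiable[OF assms]]])
        (simp add: linear_add[OF K_linear])
    also have "\<dots> = DK x u v + DK x u w" by (rule pd_eqI[OF has_derivative_add[OF d d]])
    finally show ?thesis .
  qed
  show "DK x u (c *\<^sub>R v) = c *\<^sub>R DK x u v" for c v
  proof -
    have "DK x u (c *\<^sub>R v) = pd u (\<lambda>y. c *\<^sub>R K y v) x"
      by (rule eq[OF _ differentiableI[OF has_derivative_scaleR_right[OF d]]])
        (simp add: linear_scale[OF K_linear])
    also have "\<dots> = c *\<^sub>R DK x u v" by (rule pd_eqI[OF has_derivative_scaleR_right[OF d]])
    finally show ?thesis .
  qed
qed

lemma K_homogeneous: "c > 0 \<Longrightarrow> K (c *\<^sub>R y) v = K y v"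
  by (simp add: K_def sgn_scale_pos)

lemma DK_radial: "x \<noteq> 0 \<Longrightarrow> DK x x v = 0"
  by (rule pd_radial[of "\<lambda>y. K y v", OF K_homogeneous DK_differentiable])

text \<open>Product rule when both the structure and its argument vary. Expanding the argument in
  \<open>Basis\<close> reduces it to the fields \<open>K y b\<close> with constant \<open>b\<close>,
  the only ones whose smoothness is known directly.\<close>

lemma has_derivative_K_field:
  assumes x: "x \<noteq> 0" and Z: "(Z has_derivative Z') (at x)"
  shows "((\<lambda>y. K y (Z y)) has_derivative (\<lambda>u. K x (Z' u) + DK x u (Z x))) (at x)"
proof -
  have "((\<lambda>y. \<Sum>b\<in>Basis. (Z y \<bullet> b) *\<^sub>R K y b) has_derivative
      (\<lambda>u. \<Sum>b\<in>Basis. (Z x \<bullet> b) *\<^sub>R DK x u b + (Z' u \<bullet> b) *\<^sub>R K x b)) (at x)"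
    by (rule has_derivative_sum, rule has_derivative_scaleR[OF has_derivative_inner_left[OF Z]
          differentiable_has_pd[OF DK_differentiable[OF x]]])
  moreover have "(\<Sum>b\<in>Basis. (z \<bullet> b) *\<^sub>R f b) = f z" if "linear f" for f and z :: "real^7"
    by (simp only: linear_scale[OF that, symmetric] linear_sum[OF that, symmetric] euclidean_representation)
  note e = this
  have "(\<Sum>b\<in>Basis. (Z x \<bullet> b) *\<^sub>R DK x u b + (Z' u \<bullet> b) *\<^sub>R K x b) = K x (Z' u) + DK x u (Z x)" for u
    unfolding sum.distrib e[OF DK_linear_right[OF x]] e[OF K_linear[OF x]] by (rule add.commute)
  ultimately have "((\<lambda>y. \<Sum>b\<in>Basis. (Z y \<bullet> b) *\<^sub>R K y b) has_derivative (\<lambda>u. K x (Z' u) + DK x u (Z x))) (at x)"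
    by simp
  then show ?thesis
    by (rule has_derivative_transform_within_open[OF _ open_punctured])
      (use x e[OF K_linear] in auto)
qed

lemma DK_skew: assumes x: "x \<noteq> 0" shows "DK x u v \<bullet> w = - (v \<bullet> DK x u w)"
proof -
  note d = differentiable_has_pd[OF DK_differentiable[OF x]]
  have 1: "((\<lambda>y. K y v \<bullet> w) has_derivative (\<lambda>u. DK x u v \<bullet> w)) (at x)"
    by (rule has_derivative_inner_left[OF d])
  have "((\<lambda>y. - (v \<bullet> K y w)) has_derivative (\<lambda>u. - (v \<bullet> DK x u w))) (at x)"
    by (rule has_derivative_minus[OF has_derivative_inner_right[OF d]])
  then have "((\<lambda>y. K y v \<bullet> w) has_derivative (\<lambda>u. - (v \<bullet> DK x u w))) (at x)"
    by (rule has_derivative_transform_within_open[OF _ open_punctured]) (use x K_skew in auto)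
  from fun_cong[OF has_derivative_unique[OF 1 this]] show ?thesis .
qed

text \<open>Differentiate \<open>K y y = 0\<close>. With \<open>DK_skew\<close> this determines the
  normal components of \<open>DK\<close> algebraically from \<open>K\<close>; they later account for
  the constant 6.\<close>

lemma DK_self: assumes x: "x \<noteq> 0" shows "DK x u x = - K x u"
proof -
  have 1: "((\<lambda>y. K y y) has_derivative (\<lambda>u. K x u + DK x u x)) (at x)"
    by (rule has_derivative_K_field[OF x has_derivative_ident])
  have "K y y = 0" if "y \<noteq> 0" for y
  proof -
    have "tangential_field y (sgn y) = 0"
    proof -
      have "tangential_field (norm y *\<^sub>R sgn y) (sgn y) = 0"
        unfolding tangential_field_scale tangential_field_self[OF sgn_in_sphere[OF that]] by simp
      then show ?thesis using that by (simp add: sgn_div_norm)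
    qed
    then show ?thesis using linear_0[OF K_linear[OF that]] K_def[of y y] K_def[of y 0] by (simp add: tangential_field_def)
  qed
  then have "((\<lambda>y. K y y) has_derivative (\<lambda>u. 0)) (at x)"
    by (intro has_derivative_transform_within_open[OF has_derivative_const[of 0] open_punctured]) (use x in auto)
  from fun_cong[OF has_derivative_unique[OF 1 this], of u] show ?thesis by (simp add: eq_neg_iff_add_eq_0 add.commute)
qed

lemma DK_tangential: "x \<in> S6 \<Longrightarrow> DK x (tangential_field u x) v = DK x u v"
  unfolding tangential_field_def
  by (simp add: linear_diff[OF DK_linear_left] linear_scale[OF DK_linear_left] DK_radial sphere_nonzero)

text \<open>Differentiate \<open>K K = - P\<close>. The derivative of the projection, applied to the
  tangent vector \<open>v\<close>, is normal and disappears against the tangent vector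
  \<open>w\<close>; skewness of \<open>K\<close> does the rest.\<close>

lemma DK_K:
  assumes x: "x \<in> S6" and v: "v \<in> tangent x" and w: "w \<in> tangent x"
  shows "DK x u (K x v) \<bullet> w = DK x u v \<bullet> K x w"
proof -
  have x0: "x \<noteq> 0" using x by auto
  have 1: "((\<lambda>y. K y (K y v)) has_derivative (\<lambda>u. K x (DK x u v) + DK x u (K x v))) (at x)"
    by (rule has_derivative_K_field[OF x0 differentiable_has_pd[OF DK_differentiable[OF x0]]])
  note s = has_derivative_sgn_sphere[OF x]
  have "((\<lambda>y. - (v - (v \<bullet> sgn y) *\<^sub>R sgn y)) has_derivative
      (\<lambda>u. - (0 - ((v \<bullet> sgn x) *\<^sub>R tangential_field u x + (v \<bullet> tangential_field u x) *\<^sub>R sgn x)))) (at x)"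
    by (rule has_derivative_minus[OF has_derivative_diff[OF has_derivative_const
      has_derivative_scaleR[OF has_derivative_inner_right[OF s] s]]])
  then have "((\<lambda>y. K y (K y v)) has_derivative
      (\<lambda>u. - (0 - ((v \<bullet> sgn x) *\<^sub>R tangential_field u x + (v \<bullet> tangential_field u x) *\<^sub>R sgn x)))) (at x)"
    by (rule has_derivative_transform_within_open[OF _ open_punctured])
      (use x0 K_K in \<open>auto simp: tangential_field_def\<close>)
  from fun_cong[OF has_derivative_unique[OF 1 this], of u]
  have "(K x (DK x u v) + DK x u (K x v)) \<bullet> w = 0"
    using v w by (simp add: sgn_sphere[OF x] tangent_def inner_commute[of x])
  then show ?thesis using K_skew[OF x0, of "DK x u v" w] by (simp add: inner_add_left)
qed

text \<open>This is \<open>\<nabla>\<omega>\<close> for the round metric, extended to ambient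
  vectors. The derivative slot needs no projection because \<open>DK\<close> vanishes in the radial
  direction.\<close>

definition T :: "real^7 \<Rightarrow> real^7 \<Rightarrow> real^7 \<Rightarrow> real^7 \<Rightarrow> real" where
  "T x u v w = DK x u (tangential_field v x) \<bullet> tangential_field w x"

lemma torsion_type_T:
  assumes x: "x \<in> S6" shows "hermitian.torsion_type (\<lambda>v. tangential_field v x) (K x) (T x)"
proof -
  have x0: "x \<noteq> 0" using x by auto
  interpret hermitian "\<lambda>v. tangential_field v x" "K x" by (rule hermitian[OF x])
  have t: "tangential_field v x \<in> tangent x" for v by (rule tangential_field_tangent[OF x])
  have PK: "tangential_field (K x v) x = K x v" for v by (rule P_M)
  show ?thesis unfolding torsion_type_def
  proof (intro conjI allI)
    show "T x u v w = - T x u w v" for u v w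
      using DK_skew[OF x0, where u = u and v = "tangential_field v x" and w = "tangential_field w x"]
      unfolding T_def inner_commute[of "tangential_field v x"] .
    show "T x u (K x v) w = T x u v (K x w)" for u v w
      unfolding T_def PK using DK_K[OF x t[of v] t[of w], of u] by (simp add: K_tangential[OF x])
    show "T x (tangential_field u x) v w = T x u v w" for u v w
      unfolding T_def DK_tangential[OF x] ..
    show "T x u (tangential_field v x) w = T x u v w" for u v w
      unfolding T_def P_P ..
  qed (rule linearI; simp add: T_def tangential_field_add tangential_field_scale linear_add[OF DK_linear_left[OF x0]]
      linear_scale[OF DK_linear_left[OF x0]] linear_add[OF DK_linear_right[OF x0]]
      linear_scale[OF DK_linear_right[OF x0]] inner_add_left inner_add_right)+
qed

definition nabla_tensor :: "(real^7 \<Rightarrow> real) \<Rightarrow> real^7 \<Rightarrow> real^7 \<Rightarrow> real^7 \<Rightarrow> real^7 \<Rightarrow> real" where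
  "nabla_tensor l x u v w = l x * T x u v w
     + (1 / 2) * hermitian.conf_tensor (\<lambda>v. tangential_field v x) (K x) (grad l x) u v w"

text \<open>The derivative of the factor \<open>l\<close> in the Kaehler form contributes
  \<open>(grad l x \<bullet> u) * (K x v \<bullet> w)\<close>, and the two connection corrections
  subtract half of it each. What is left of the corrections is half of
  \<open>conf_tensor\<close>.\<close>

lemma nabla_form_at_eq:
  assumes l: "smooth_on S6 l" "\<And>x. x \<in> S6 \<Longrightarrow> l x > 0" and x: "x \<in> S6"
    and u: "u \<in> tangent x" and v: "v \<in> tangent x" and w: "w \<in> tangent x"
  shows "nabla_form_at (conf_metric l)
      (kaehler_form (conf_metric l) J) x u v w = nabla_tensor l x u v w"
proof -
  interpret hermitian "\<lambda>v. tangential_field v x" "K x" by (rule hermitian[OF x])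
  let ?g = "conf_metric l" and ?h = "grad l x"
  let ?\<omega> = "kaehler_form ?g J" and ?l = "\<lambda>y. l (sgn y)"
  have x0: "x \<noteq> 0" and x0': "x \<in> - {0}" using x by auto
  have lp: "l x \<noteq> 0" using l(2)[OF x] by simp
  have h: "?h \<in> tangent x" by (rule grad_tangent[OF l(1) x])
  have \<omega>: "?\<omega> y (tangential_field v y) (tangential_field w y) = l y * (K y v \<bullet> w)" if y: "y \<in> S6" for y v w
  proof -
    have "K y v \<in> tangent y" using K_tangent[of y v] y by (simp add: sgn_sphere sphere_nonzero)
    then have "K y v \<bullet> tangential_field w y = K y v \<bullet> w"
      by (simp flip: tangential_field_sym add: tangential_field_id)
    then show ?thesis by (simp add: kaehler_form_def round_metric_def K_def sgn_sphere[OF y])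
  qed
  have "smooth (- {0}) (\<lambda>y. ?l y * (K y v \<bullet> w))"
    by (rule smooth_mult[OF smooth_hat[OF l(1)] smooth_inner[OF smooth_K smooth_const[OF open_punctured]]])
  then have "sphere_deriv (\<lambda>y. ?\<omega> y (tangential_field v y) (tangential_field w y)) x u = pd u (\<lambda>y. ?l y * (K y v \<bullet> w)) x"
    by (rule sphere_deriv_eq_pd_smooth[OF x u]) (simp add: sgn_sphere \<omega>)
  also have "\<dots> = ?l x * (DK x u v \<bullet> w) + pd u ?l x * (K x v \<bullet> w)"
    by (rule pd_eqI[OF has_derivative_mult[OF smooth_has_pd[OF smooth_hat[OF l(1)] x0']
            has_derivative_inner_left[OF differentiable_has_pd[OF DK_differentiable[OF x0]]]]])
  also have "\<dots> = l x * (DK x u v \<bullet> w) + (?h \<bullet> u) * (K x v \<bullet> w)"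
    by (simp add: sgn_sphere[OF x] grad_inner[OF l(1) x])
  finally have D: "sphere_deriv (\<lambda>y. ?\<omega> y (tangential_field v y) (tangential_field w y)) x u
      = l x * (DK x u v \<bullet> w) + (?h \<bullet> u) * (K x v \<bullet> w)" .
  define q where "q = (\<lambda>v. (?h \<bullet> u) *\<^sub>R v + (?h \<bullet> v) *\<^sub>R u - (u \<bullet> v) *\<^sub>R ?h)"
  have LC: "levi_civita ?g (tangential_field u) (tangential_field v) x = inverse (2 * l x) *\<^sub>R q v" if v: "v \<in> tangent x" for v
  proof -
    \<comment> \<open>Projection fields have a purely normal derivative at \<open>x\<close>, so only
      the conformal correction of the connection survives.\<close>
    have "tangential_field (- (u \<bullet> v) *\<^sub>R x) x = 0"
      unfolding tangential_field_scale tangential_field_self[OF x] by simp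
    moreover have "levi_civita ?g (tangential_field u) (tangential_field v) x = conf_connection l (tangential_field u) (tangential_field v) x"
      by (rule levi_civita_conf[OF l vector_field_tangential vector_field_tangential x])
    ultimately show ?thesis
      unfolding conf_connection_def q_def
        tangential_field_id[OF u] tangential_field_id[OF v] pd_tangential_field[OF x u v] by simp
  qed
  have qt: "q v \<in> tangent x" if "v \<in> tangent x" for v
    using that u h by (simp add: q_def tangent_def inner_add_left inner_diff_left)
  have \<omega>x: "?\<omega> x a b = l x * (K x a \<bullet> b)" if "a \<in> tangent x" for a b
    using that by (simp add: kaehler_form_def round_metric_def K_sphere[OF x])
  have iq: "inverse (2 * l x) *\<^sub>R q v \<in> tangent x" if "v \<in> tangent x" for v
    using qt[OF that] by (simp add: tangent_def)
  have c1: "?\<omega> x (inverse (2 * l x) *\<^sub>R q v) w = (1 / 2) * (K x (q v) \<bullet> w)"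
    unfolding \<omega>x[OF iq[OF v]] linear_scale[OF K_linear[OF x0]] using lp by simp
  have c2: "?\<omega> x v (inverse (2 * l x) *\<^sub>R q w) = (1 / 2) * (K x v \<bullet> q w)"
    unfolding \<omega>x[OF v] using lp by simp
  have Tx: "T x u v w = DK x u v \<bullet> w" by (simp add: T_def tangential_field_id[OF v] tangential_field_id[OF w])
  have "nabla_form_at ?g ?\<omega> x u v w
      = l x * (DK x u v \<bullet> w) + (?h \<bullet> u) * (K x v \<bullet> w) - (1 / 2) * (K x (q v) \<bullet> w) - (1 / 2) * (K x v \<bullet> q w)"
    unfolding nabla_form_at_def nabla_form_def tangential_field_id[OF u] tangential_field_id[OF v] tangential_field_id[OF w]
      D LC[OF v] LC[OF w] c1 c2 ..
  also have "K x (q v) \<bullet> w = (?h \<bullet> u) * (K x v \<bullet> w) + (?h \<bullet> v) * (K x u \<bullet> w) - (u \<bullet> v) * (K x ?h \<bullet> w)"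
    unfolding q_def by (simp add: linear_add[OF M_linear] linear_diff[OF M_linear] linear_scale[OF M_linear]
        inner_add_left inner_diff_left)
  also have "K x v \<bullet> q w = (?h \<bullet> u) * (K x v \<bullet> w) + (?h \<bullet> w) * (K x v \<bullet> u) - (u \<bullet> w) * (K x v \<bullet> ?h)"
    unfolding q_def by (simp add: inner_add_right inner_diff_right)
  finally show ?thesis
    unfolding nabla_tensor_def conf_tensor_def Tx tangential_field_id[OF u]
    by (simp add: inner_commute field_simps)
qed

lemma torsion_type_nabla_tensor:
  assumes "smooth_on S6 l" "x \<in> S6"
  shows "hermitian.torsion_type (\<lambda>v. tangential_field v x) (K x) (nabla_tensor l x)"
proof -
  interpret hermitian "\<lambda>v. tangential_field v x" "K x" by (rule hermitian[OF assms(2)])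
  have "nabla_tensor l x = (\<lambda>u v w. l x * T x u v w + (1 / 2) * conf_tensor (grad l x) u v w)"
    by (intro ext) (simp add: nabla_tensor_def)
  then show ?thesis
    using torsion_type_combination[OF torsion_type_T[OF assms(2)]
        torsion_type_conf_tensor[OF tangential_field_id[OF grad_tangent[OF assms]]], of "l x" "1 / 2"]
    by simp
qed

end

section \<open>The energy in terms of the round metric\<close>

lemma orthonormal_tangent_frame:
  assumes x: "x \<in> S6"
  obtains f :: "nat \<Rightarrow> real^7" where "\<And>i. i < 6 \<Longrightarrow> f i \<in> tangent x"
    "\<And>i j. i < 6 \<Longrightarrow> j < 6 \<Longrightarrow> f i \<bullet> f j = (if i = j then 1 else 0)"
proof -
  obtain B where B: "B \<subseteq> tangent x" "pairwise orthogonal B" "\<And>b. b \<in> B \<Longrightarrow> norm b = 1"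
    "independent B" "card B = dim (tangent x)" "span B = tangent x"
    by (rule orthonormal_basis_subspace[OF tangent_subspace[of x]]) (rule that)
  have "tangent x = {v. x \<bullet> v = 0}" by (simp add: tangent_def inner_commute)
  then have card: "card B = 6" using B(5) dim_hyperplane[of x] sphere_nonzero[OF x] by simp
  then have "finite B" by (intro card_ge_0_finite) simp
  then obtain f where f: "bij_betw f {0..<card B} B" using ex_bij_betw_nat_finite by blast
  have fB: "f i \<in> B" if "i < 6" for i using f that card by (auto simp: bij_betw_def)
  have inj: "f i = f j \<longleftrightarrow> i = j" if "i < 6" "j < 6" for i j
    using bij_betw_imp_inj_on[OF f] that card by (simp add: inj_on_eq_iff)
  show ?thesis
  proof (rule that[of f])
    show "f i \<in> tangent x" if "i < 6" for i using fB[OF that] B(1) by blast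
    show "f i \<bullet> f j = (if i = j then 1 else 0)" if "i < 6" "j < 6" for i j
      using B(2) B(3)[OF fB[OF that(1)]] fB[OF that(1)] fB[OF that(2)] inj[OF that]
      by (auto simp: pairwise_def orthogonal_def norm_eq_1)
  qed
qed

context orthogonal_structure
begin

text \<open>\<open>F\<close> vanishes as soon as one slot is \<open>x\<close>, so completing the
  frame by \<open>x\<close> adds nothing. The frame identity handles one index at a time; the
  exchanges of sums bring each index to the innermost place.\<close>

lemma inner3_frame:
  assumes x: "x \<in> S6" and F: "hermitian.torsion_type (\<lambda>v. tangential_field v x) (K x) F"
    and f: "\<And>i. i < 6 \<Longrightarrow> f i \<in> tangent x"
    "\<And>i j. i < 6 \<Longrightarrow> j < 6 \<Longrightarrow> f i \<bullet> f j = (if i = j then 1 else (0::real))"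
  shows "hermitian.inner3 F F = (\<Sum>i<6::nat. \<Sum>j<6. \<Sum>k<6. (F (f i) (f j) (f k))\<^sup>2)"
proof -
  interpret hermitian "\<lambda>v. tangential_field v x" "K x" by (rule hermitian[OF x])
  note D = torsion_typeD[OF F]
  have z: "F x v w = 0" "F v x w = 0" "F v w x = 0" for v w
  proof -
    show "F x v w = 0" using D(6)[of x v w] linear_0[OF D(1)] by (simp add: tangential_field_self[OF x])
    show "F v x w = 0" using D(7)[of v x w] linear_0[OF D(2)] by (simp add: tangential_field_self[OF x])
    show "F v w x = 0" using D(8)[of v w x] linear_0[OF D(3)] by (simp add: tangential_field_self[OF x])
  qed
  have frame: "(\<Sum>b\<in>Basis. (\<phi> b)\<^sup>2) = (\<Sum>i<6::nat. (\<phi> (f i))\<^sup>2)" if "linear \<phi>" "\<phi> x = 0" for \<phi> :: "real^7 \<Rightarrow> real"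
  proof -
    have "(\<Sum>b\<in>Basis. \<phi> b * \<phi> b) = (\<Sum>i\<in>{..<6}. \<phi> (f i) * \<phi> (f i)) + \<phi> x * \<phi> x"
    proof (rule sum_Basis_frame[where A = "\<lambda>u v. \<phi> u * \<phi> v" and e = f, OF x])
      show "linear (\<lambda>u. \<phi> u * \<phi> v)" "linear (\<lambda>u. \<phi> v * \<phi> u)" for v
        using that(1) by (auto intro!: linearI simp: linear_add linear_scale algebra_simps)
    qed (use f in auto)
    then show ?thesis using that(2) by (simp add: power2_eq_square)
  qed
  have "inner3 F F = (\<Sum>a\<in>Basis. \<Sum>b\<in>Basis. \<Sum>c\<in>Basis. (F a b c)\<^sup>2)"
    by (simp add: inner3_def power2_eq_square)
  also have "\<dots> = (\<Sum>a\<in>Basis. \<Sum>b\<in>Basis. \<Sum>k<6. (F a b (f k))\<^sup>2)"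
    by (simp only: frame[OF D(3) z(3)])
  also have "\<dots> = (\<Sum>a\<in>Basis. \<Sum>k<6. \<Sum>b\<in>Basis. (F a b (f k))\<^sup>2)"
    by (rule sum.cong[OF refl]) (rule sum.swap)
  also have "\<dots> = (\<Sum>a\<in>Basis. \<Sum>k<6. \<Sum>j<6. (F a (f j) (f k))\<^sup>2)"
    by (simp only: frame[OF D(2) z(2)])
  also have "\<dots> = (\<Sum>k<6. \<Sum>a\<in>Basis. \<Sum>j<6. (F a (f j) (f k))\<^sup>2)"
    by (rule sum.swap)
  also have "\<dots> = (\<Sum>k<6. \<Sum>j<6. \<Sum>a\<in>Basis. (F a (f j) (f k))\<^sup>2)"
    by (rule sum.cong[OF refl]) (rule sum.swap)
  also have "\<dots> = (\<Sum>k<6. \<Sum>j<6. \<Sum>i<6. (F (f i) (f j) (f k))\<^sup>2)"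
    by (simp only: frame[OF D(1) z(1)])
  also have "\<dots> = (\<Sum>k<6. \<Sum>i<6. \<Sum>j<6. (F (f i) (f j) (f k))\<^sup>2)"
    by (rule sum.cong[OF refl]) (rule sum.swap)
  also have "\<dots> = (\<Sum>i<6. \<Sum>k<6. \<Sum>j<6. (F (f i) (f j) (f k))\<^sup>2)"
    by (rule sum.swap)
  also have "\<dots> = (\<Sum>i<6. \<Sum>j<6. \<Sum>k<6. (F (f i) (f j) (f k))\<^sup>2)"
    by (rule sum.cong[OF refl]) (rule sum.swap)
  finally show ?thesis .
qed

abbreviation normsq :: "(real^7 \<Rightarrow> real) \<Rightarrow> real^7 \<Rightarrow> real" where
  "normsq l x \<equiv> hermitian.inner3 (nabla_tensor l x) (nabla_tensor l x)"

lemma tensor3_norm_sq_nabla: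
  assumes l: "smooth_on S6 l" "\<And>x. x \<in> S6 \<Longrightarrow> l x > 0" and x: "x \<in> S6"
  shows "tensor3_norm_sq (conf_metric l) x (nabla_form_at (conf_metric l)
      (kaehler_form (conf_metric l) J) x) = inverse (l x ^ 3) * normsq l x"
proof -
  let ?g = "conf_metric l"
  define r where "r = sqrt (l x)"
  have r: "r > 0" "r * r = l x" unfolding r_def using l(2)[OF x] by auto
  obtain f :: "nat \<Rightarrow> real^7" where f: "\<And>i. i < 6 \<Longrightarrow> f i \<in> tangent x"
    "\<And>i j. i < 6 \<Longrightarrow> j < 6 \<Longrightarrow> f i \<bullet> f j = (if i = j then 1 else 0)"
    by (rule orthonormal_tangent_frame[OF x]) (rule that)
  have "orthonormal_frame ?g x (\<lambda>i. (1 / r) *\<^sub>R f i)"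
    unfolding orthonormal_frame_def round_metric_def
  proof (intro conjI allI impI)
    show "(1 / r) *\<^sub>R f i \<in> tangent x" if "i < 6" for i using f(1)[OF that] by (simp add: tangent_def)
    show "l x * ((1 / r) *\<^sub>R f i \<bullet> (1 / r) *\<^sub>R f j) = (if i = j then 1 else 0)" if "i < 6" "j < 6" for i j
      unfolding inner_scaleR_left inner_scaleR_right f(2)[OF that] r(2)[symmetric] using r(1) by simp
  qed
  \<comment> \<open>The rescaled round frame serves only to show that the choice made in
    \<open>tensor3_norm_sq\<close> is an actual frame.\<close>
  then have fr: "orthonormal_frame ?g x (SOME e. orthonormal_frame ?g x e)" by (rule someI[where P = "orthonormal_frame ?g x"])
  define e where "e = (SOME e. orthonormal_frame ?g x e)"
  have et: "e i \<in> tangent x" if "i < 6" for i using fr that by (simp add: orthonormal_frame_def e_def)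
  have eo: "l x * (e i \<bullet> e j) = (if i = j then 1 else 0)" if "i < 6" "j < 6" for i j
    using fr that by (simp add: orthonormal_frame_def e_def round_metric_def)
  \<comment> \<open>The chosen frame is orthonormal for \<open>l x\<close> times the round metric;
    times \<open>r\<close> it is orthonormal for the round one. Three slots, squared, give
    \<open>r^6 = l x ^ 3\<close>.\<close>
  define e' where "e' = (\<lambda>i. r *\<^sub>R e i)"
  have e't: "e' i \<in> tangent x" if "i < 6" for i using et[OF that] by (simp add: e'_def tangent_def)
  have e'o: "e' i \<bullet> e' j = (if i = j then 1 else 0)" if "i < 6" "j < 6" for i j
    using eo[OF that] by (simp add: e'_def r(2) flip: mult.assoc)
  note F = torsion_type_nabla_tensor[OF l(1) x]
  note D = hermitian.torsion_typeD(1-3)[OF hermitian[OF x] F]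
  have sc: "nabla_tensor l x (e' i) (e' j) (e' k) = r ^ 3 * nabla_tensor l x (e i) (e j) (e k)" for i j k
    unfolding e'_def by (simp add: linear_scale[OF D(1)] linear_scale[OF D(2)] linear_scale[OF D(3)] power3_eq_cube)
  have "normsq l x = (\<Sum>i<6::nat. \<Sum>j<6. \<Sum>k<6. (nabla_tensor l x (e' i) (e' j) (e' k))\<^sup>2)"
    by (rule inner3_frame[OF x F e't e'o])
  also have "\<dots> = (\<Sum>i<6::nat. \<Sum>j<6. \<Sum>k<6. l x ^ 3 * (nabla_tensor l x (e i) (e j) (e k))\<^sup>2)"
    unfolding sc power_mult_distrib r(2)[symmetric] by (simp add: power_mult_distrib flip: power_mult power_add)
  also have "\<dots> = l x ^ 3 * (\<Sum>i<6::nat. \<Sum>j<6. \<Sum>k<6. (nabla_tensor l x (e i) (e j) (e k))\<^sup>2)"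
    by (simp only: sum_distrib_left)
  also have "(\<Sum>i<6::nat. \<Sum>j<6. \<Sum>k<6. (nabla_tensor l x (e i) (e j) (e k))\<^sup>2)
      = tensor3_norm_sq ?g x (nabla_form_at ?g (kaehler_form ?g J) x)"
    unfolding tensor3_norm_sq_def Let_def e_def[symmetric]
    by (intro sum.cong refl arg_cong[where f = "\<lambda>a. a\<^sup>2"], rule nabla_form_at_eq[OF l x et et et, symmetric]) auto
  finally show ?thesis using l(2)[OF x] by simp
qed

lemma continuous_normsq:
  assumes l: "smooth_on S6 l" shows "continuous_on S6 (normsq l)"
proof -
  have P: "continuous_on S6 (tangential_field v)" for v
    unfolding tangential_field_def by (intro continuous_intros)
  have K: "continuous_on S6 (\<lambda>x. K x v)" for v by (rule continuous_sphere[OF smooth_K])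
  have DK: "continuous_on S6 (\<lambda>x. DK x u v)" for u v by (rule continuous_sphere[OF smooth_pd[OF smooth_K]])
  have g: "continuous_on S6 (grad l)" by (rule continuous_sphere[OF smooth_grad[OF l]])
  note lc = smooth_on_sphere_continuous[OF l]
  have Kg: "continuous_on S6 (\<lambda>x. K x (grad l x))"
  proof (rule continuous_on_eq)
    show "continuous_on S6 (\<lambda>x. \<Sum>b\<in>Basis. (grad l x \<bullet> b) *\<^sub>R K x b)"
      by (intro continuous_on_sum continuous_on_scaleR continuous_on_inner continuous_on_const g K)
    show "(\<Sum>b\<in>Basis. (grad l x \<bullet> b) *\<^sub>R K x b) = K x (grad l x)" if "x \<in> S6" for x
    proof -
      note lin = K_linear[OF sphere_nonzero[OF that]]
      show ?thesis
        by (simp only: linear_scale[OF lin, symmetric] linear_sum[OF lin, symmetric] euclidean_representation)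
    qed
  qed
  have T: "continuous_on S6 (\<lambda>x. T x u v w)" for u v w
  proof (rule continuous_on_eq)
    show "continuous_on S6 (\<lambda>x. (DK x u v - (v \<bullet> x) *\<^sub>R (\<Sum>b\<in>Basis. (x \<bullet> b) *\<^sub>R DK x u b)) \<bullet> tangential_field w x)"
      by (intro continuous_on_inner continuous_on_diff continuous_on_scaleR continuous_on_sum
          continuous_on_const continuous_on_id DK P)
    show "(DK x u v - (v \<bullet> x) *\<^sub>R (\<Sum>b\<in>Basis. (x \<bullet> b) *\<^sub>R DK x u b)) \<bullet> tangential_field w x = T x u v w"
      if "x \<in> S6" for x
    proof -
      note lin = DK_linear_right[OF sphere_nonzero[OF that], of u]
      have "(\<Sum>b\<in>Basis. (x \<bullet> b) *\<^sub>R DK x u b) = DK x u x"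
        by (simp only: linear_scale[OF lin, symmetric] linear_sum[OF lin, symmetric] euclidean_representation)
      then show ?thesis
        unfolding T_def tangential_field_def[of v] by (simp add: linear_diff[OF lin] linear_scale[OF lin])
    qed
  qed
  have C: "continuous_on S6 (\<lambda>x. (K x v \<bullet> grad l x) * (tangential_field u x \<bullet> w) - (u \<bullet> K x v) * (grad l x \<bullet> w)
      - (v \<bullet> grad l x) * (K x u \<bullet> w) + (tangential_field u x \<bullet> v) * (K x (grad l x) \<bullet> w))" for u v w
    by (intro continuous_on_add continuous_on_diff continuous_on_mult continuous_on_inner continuous_on_const K g P Kg)
  have N: "continuous_on S6 (\<lambda>x. nabla_tensor l x u v w)" for u v w
  proof (rule continuous_on_eq)
    show "continuous_on S6 (\<lambda>x. l x * T x u v w + (1 / 2) * ((K x v \<bullet> grad l x) * (tangential_field u x \<bullet> w)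
      - (u \<bullet> K x v) * (grad l x \<bullet> w) - (v \<bullet> grad l x) * (K x u \<bullet> w) + (tangential_field u x \<bullet> v) * (K x (grad l x) \<bullet> w)))"
      by (intro continuous_on_add[OF continuous_on_mult[OF lc T] continuous_on_mult[OF continuous_on_const C]])
  qed (simp add: nabla_tensor_def hermitian.conf_tensor_def[OF hermitian])
  show ?thesis
  proof (rule continuous_on_eq)
    show "continuous_on S6 (\<lambda>x. \<Sum>a\<in>Basis. \<Sum>b\<in>Basis. \<Sum>c\<in>Basis. nabla_tensor l x a b c * nabla_tensor l x a b c)"
      by (intro continuous_on_sum continuous_on_mult N)
  qed (simp add: hermitian.inner3_def[OF hermitian])
qed

text \<open>Dimension six makes the weights cancel: \<open>l^-3\<close> from the three slots of the
  tensor against \<open>l^3\<close> from the volume element. The conformal factor survives only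
  inside \<open>nabla_tensor\<close>.\<close>

lemma energy_eq:
  assumes l: "smooth_on S6 l" "\<And>x. x \<in> S6 \<Longrightarrow> l x > 0"
  shows "energy (conf_metric l) J = (\<integral>y. rho y ^ 6 * normsq l (inv_stereo y) \<partial>lborel)"
proof -
  let ?g = "conf_metric l"
  note lc = smooth_on_sphere_continuous[OF l(1)]
  have c: "continuous_on S6 (\<lambda>x. inverse (l x ^ 3) * normsq l x)"
    by (rule continuous_on_mult[OF continuous_on_inverse[OF continuous_on_power[OF lc]] continuous_normsq[OF l(1)]])
      (use l(2) in force)
  have "energy ?g J = (\<integral>x. inverse (l x ^ 3) * normsq l x \<partial>vol ?g)"
    unfolding energy_def
    by (rule Bochner_Integration.integral_cong[OF refl], rule tensor3_norm_sq_nabla[OF l]) (simp_all only: space_vol)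
  also have "\<dots> = (\<integral>y. rho y ^ 6 * (l (inv_stereo y) ^ 3 * (inverse (l (inv_stereo y) ^ 3) * normsq l (inv_stereo y))) \<partial>lborel)"
    by (rule integral_vol[OF lc l(2) c])
  also have "\<dots> = (\<integral>y. rho y ^ 6 * normsq l (inv_stereo y) \<partial>lborel)"
  proof (rule Bochner_Integration.integral_cong[OF refl])
    fix y
    have "l (inv_stereo y) ^ 3 \<noteq> 0" using l(2)[OF inv_stereo_sphere[of y]] by simp
    then show "rho y ^ 6 * (l (inv_stereo y) ^ 3 * (inverse (l (inv_stereo y) ^ 3) * normsq l (inv_stereo y)))
        = rho y ^ 6 * normsq l (inv_stereo y)" by simp
  qed
  finally show ?thesis .
qed

end

subsection \<open>The calibration is a divergence up to terms independent of J\<close>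

context orthogonal_structure
begin

text \<open>The divergence of J, up to sign the codifferential, as an ambient contraction. By
  \<open>trace3_T\<close> it is the trace of the tangential tensor on the sphere.\<close>

definition codiff :: "real^7 \<Rightarrow> real^7" where
  "codiff y = (\<Sum>j\<in>Basis. DK y j j)"

lemma smooth_codiff: "smooth (- {0}) codiff"
  unfolding codiff_def by (rule smooth_sum[OF open_punctured]) (rule smooth_pd[OF smooth_K])

lemma smooth_DK: "smooth (- {0}) (\<lambda>y. DK y u v)"
  by (rule smooth_pd[OF smooth_K])

lemma vector_contraction:
  assumes "linear f" shows "(\<Sum>b\<in>Basis. (z \<bullet> b) *\<^sub>R f b) = f (z :: 'a::euclidean_space)"
  by (simp only: linear_scale[OF assms, symmetric] linear_sum[OF assms, symmetric] euclidean_representation)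

lemma pd_codiff: assumes "x \<noteq> 0" shows "pd u codiff x = (\<Sum>j\<in>Basis. pd u (\<lambda>y. DK y j j) x)"
  unfolding codiff_def
  by (rule pd_eqI[OF has_derivative_sum]) (rule smooth_has_pd[OF smooth_DK], use assms in simp)

lemma codiff_normal: assumes x: "x \<in> S6" shows "codiff x \<bullet> x = 0"
proof -
  have x0: "x \<noteq> 0" using x by auto
  have "DK x a a \<bullet> x = 0" for a
    using DK_skew[OF x0, of a a x] K_skew[OF x0, of a a] by (simp add: DK_self[OF x0] inner_commute)
  then show ?thesis by (simp add: codiff_def inner_sum_left)
qed

text \<open>This is the divergence of \<open>K^T K = P\<close>: the right-hand term in
  \<open>j \<bullet> y\<close> is the divergence of the projection field on R^7 minus the origin. It
  is proved at all such points, and not only on the sphere, because it is differentiated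
  again.\<close>

lemma first_order_identity:
  assumes y: "y \<noteq> 0"
  shows "(\<Sum>m\<in>Basis. K y m \<bullet> DK y m j) = - 6 * ((j \<bullet> y) * inverse (y \<bullet> y)) - codiff y \<bullet> K y j"
proof -
  let ?N = "y \<bullet> y"
  have N: "?N \<noteq> 0" using y by simp
  have der: "DK y m m \<bullet> K y j + K y m \<bullet> DK y m j
      = - (((m \<bullet> m) * (j \<bullet> y) + (m \<bullet> y) * (j \<bullet> m)) * inverse ?N - 2 * (m \<bullet> y) * (j \<bullet> y) * (y \<bullet> m) * (inverse ?N * inverse ?N))" for m
  proof -
    have 1: "((\<lambda>z. K z m \<bullet> K z j) has_derivative (\<lambda>u. K y m \<bullet> DK y u j + DK y u m \<bullet> K y j)) (at y)"
      by (rule has_derivative_inner[OF differentiable_has_pd[OF DK_differentiable[OF y]]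
            differentiable_has_pd[OF DK_differentiable[OF y]]])
    have "((\<lambda>z. m \<bullet> j - (m \<bullet> z) * (j \<bullet> z) * inverse (z \<bullet> z)) has_derivative
        (\<lambda>u. - (((m \<bullet> u) * (j \<bullet> y) + (m \<bullet> y) * (j \<bullet> u)) * inverse ?N - 2 * (m \<bullet> y) * (j \<bullet> y) * (y \<bullet> u) * (inverse ?N * inverse ?N)))) (at y)"
      using N by (auto intro!: derivative_eq_intros simp: fun_eq_iff inner_commute algebra_simps)
    then have "((\<lambda>z. K z m \<bullet> K z j) has_derivative
        (\<lambda>u. - (((m \<bullet> u) * (j \<bullet> y) + (m \<bullet> y) * (j \<bullet> u)) * inverse ?N - 2 * (m \<bullet> y) * (j \<bullet> y) * (y \<bullet> u) * (inverse ?N * inverse ?N)))) (at y)"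
    proof (rule has_derivative_transform_within_open[OF _ open_punctured])
      show "y \<in> - {0}" using y by simp
      show "m \<bullet> j - (m \<bullet> z) * (j \<bullet> z) * inverse (z \<bullet> z) = K z m \<bullet> K z j" if "z \<in> - {0}" for z
      proof -
        have z: "z \<noteq> 0" using that by simp
        have "K z m \<bullet> K z j = m \<bullet> tangential_field j (sgn z)"
          using K_skew[OF z, of m "K z j"] by (simp add: K_K[OF z])
        also have "\<dots> = m \<bullet> j - (m \<bullet> z) * (j \<bullet> z) * (inverse (norm z) * inverse (norm z))"
          by (simp add: tangential_field_def sgn_div_norm inner_diff_right)
        also have "inverse (norm z) * inverse (norm z) = inverse (z \<bullet> z)"
          by (simp add: dot_square_norm power2_eq_square)
        finally show ?thesis ..
      qed
    qed
    from fun_cong[OF has_derivative_unique[OF 1 this], of m] show ?thesis by (simp add: add.commute)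
  qed
  have s1: "(\<Sum>m\<in>Basis. (j \<bullet> m) * (y \<bullet> m)) = j \<bullet> y" by (rule euclidean_inner[symmetric])
  have s2: "(\<Sum>m\<in>Basis. (y \<bullet> m) * (y \<bullet> m)) = ?N" by (rule euclidean_inner[symmetric])
  have "codiff y \<bullet> K y j + (\<Sum>m\<in>Basis. K y m \<bullet> DK y m j) = (\<Sum>m\<in>Basis. DK y m m \<bullet> K y j + K y m \<bullet> DK y m j)"
    by (simp add: codiff_def inner_sum_left sum.distrib)
  also have "\<dots> = (\<Sum>m\<in>(Basis :: (real^7) set). - ((j \<bullet> y) * inverse ?N) - inverse ?N * ((j \<bullet> m) * (y \<bullet> m))
      + 2 * (j \<bullet> y) * (inverse ?N * inverse ?N) * ((y \<bullet> m) * (y \<bullet> m)))"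
  proof (rule sum.cong[OF refl])
    fix m :: "real^7" assume m: "m \<in> Basis"
    have alg: "- ((1 * a + b * c) * i - 2 * b * a * b * (i * i)) = - (a * i) - i * (c * b) + 2 * a * (i * i) * (b * b)"
      for a b c i :: real by (simp add: algebra_simps)
    show "DK y m m \<bullet> K y j + K y m \<bullet> DK y m j = - ((j \<bullet> y) * inverse ?N) - inverse ?N * ((j \<bullet> m) * (y \<bullet> m))
      + 2 * (j \<bullet> y) * (inverse ?N * inverse ?N) * ((y \<bullet> m) * (y \<bullet> m))"
      unfolding der inner_commute[of m y] inner_same_Basis[OF m] by (rule alg)
  qed
  also have "\<dots> = - 7 * ((j \<bullet> y) * inverse ?N) - inverse ?N * (j \<bullet> y) + 2 * (j \<bullet> y) * (inverse ?N * inverse ?N) * ?N"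
    unfolding sum.distrib sum_subtractf sum_distrib_left[symmetric] s1 s2 by simp
  also have "\<dots> = - 6 * ((j \<bullet> y) * inverse ?N)" using N by simp
  finally show ?thesis by simp
qed

definition grad_square :: "real^7 \<Rightarrow> real" where
  "grad_square x = (\<Sum>a\<in>Basis. \<Sum>b\<in>Basis. DK x a b \<bullet> DK x b a)"

definition codiff_trace :: "real^7 \<Rightarrow> real" where
  "codiff_trace x = (\<Sum>b\<in>Basis. pd b codiff x \<bullet> K x b)"

text \<open>Differentiating the first-order identity once more and commuting the second derivatives.\<close>

lemma second_order_identity:
  assumes x: "x \<in> S6"
  shows "2 * codiff_trace x = - 30 - codiff x \<bullet> codiff x - grad_square x"
proof -
  have x0: "x \<noteq> 0" and x0': "x \<in> - {0}" using x by auto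
  have xx: "x \<bullet> x = 1" by (rule sphere_inner_self[OF x])
  have der: "(\<Sum>m\<in>Basis. K x m \<bullet> pd u (\<lambda>y. DK y m j) x + DK x u m \<bullet> DK x m j)
      = - 6 * ((j \<bullet> u) - 2 * (j \<bullet> x) * (x \<bullet> u)) - (codiff x \<bullet> DK x u j + pd u codiff x \<bullet> K x j)" for u j
  proof -
    have 1: "((\<lambda>y. \<Sum>m\<in>Basis. K y m \<bullet> DK y m j) has_derivative
        (\<lambda>u. \<Sum>m\<in>Basis. K x m \<bullet> pd u (\<lambda>y. DK y m j) x + DK x u m \<bullet> DK x m j)) (at x)"
      by (rule has_derivative_sum) (rule has_derivative_inner[OF differentiable_has_pd[OF DK_differentiable[OF x0]]
            smooth_has_pd[OF smooth_DK x0']])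
    have a: "((\<lambda>y. - 6 * ((j \<bullet> y) * inverse (y \<bullet> y))) has_derivative (\<lambda>u. - 6 * ((j \<bullet> u) - 2 * (j \<bullet> x) * (x \<bullet> u)))) (at x)"
      using xx by (auto intro!: derivative_eq_intros simp: fun_eq_iff inner_commute algebra_simps)
    have b: "((\<lambda>y. codiff y \<bullet> K y j) has_derivative (\<lambda>u. codiff x \<bullet> DK x u j + pd u codiff x \<bullet> K x j)) (at x)"
      by (rule has_derivative_inner[OF smooth_has_pd[OF smooth_codiff x0'] differentiable_has_pd[OF DK_differentiable[OF x0]]])
    have "((\<lambda>y. \<Sum>m\<in>Basis. K y m \<bullet> DK y m j) has_derivative
        (\<lambda>u. - 6 * ((j \<bullet> u) - 2 * (j \<bullet> x) * (x \<bullet> u)) - (codiff x \<bullet> DK x u j + pd u codiff x \<bullet> K x j))) (at x)"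
      by (rule has_derivative_transform_within_open[OF has_derivative_diff[OF a b] open_punctured x0'])
        (simp only: first_order_identity Compl_iff singleton_iff not_False_eq_True)
    from fun_cong[OF has_derivative_unique[OF 1 this], of u] show ?thesis .
  qed
  \<comment> \<open>After the exchange, summing over \<open>j\<close> turns the second derivatives
    into derivatives of \<open>codiff\<close>. The same expression comes from the right-hand side,
    hence the factor 2 in the statement.\<close>
  have comm: "pd j (\<lambda>y. DK y m j) x = pd m (\<lambda>y. DK y j j) x" for m j
    by (rule pd_pd_commute[OF smooth_K x0'])
  have s2: "(\<Sum>j\<in>Basis. (x \<bullet> j) * (x \<bullet> j)) = 1"
    unfolding euclidean_inner[symmetric] by (rule xx)
  have "(\<Sum>j\<in>Basis. \<Sum>m\<in>Basis. K x m \<bullet> pd j (\<lambda>y. DK y m j) x) = (\<Sum>m\<in>Basis. \<Sum>j\<in>Basis. K x m \<bullet> pd m (\<lambda>y. DK y j j) x)"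
    unfolding comm by (rule sum.swap)
  also have "\<dots> = codiff_trace x"
    unfolding codiff_trace_def pd_codiff[OF x0] by (simp add: inner_sum_right inner_commute)
  finally have W: "(\<Sum>j\<in>Basis. \<Sum>m\<in>Basis. K x m \<bullet> pd j (\<lambda>y. DK y m j) x) = codiff_trace x" .
  have "codiff_trace x + grad_square x
      = (\<Sum>j\<in>Basis. \<Sum>m\<in>Basis. K x m \<bullet> pd j (\<lambda>y. DK y m j) x + DK x j m \<bullet> DK x m j)"
    unfolding W[symmetric] grad_square_def sum.distrib ..
  also have "\<dots> = (\<Sum>j\<in>(Basis :: (real^7) set). - 6 + 12 * ((x \<bullet> j) * (x \<bullet> j)) - codiff x \<bullet> DK x j j - pd j codiff x \<bullet> K x j)"
  proof (rule sum.cong[OF refl])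
    fix j :: "real^7" assume j: "j \<in> Basis"
    have alg: "- 6 * (1 - 2 * a * a) - (b + c) = - 6 + 12 * (a * a) - b - c" for a b c :: real by simp
    show "(\<Sum>m\<in>Basis. K x m \<bullet> pd j (\<lambda>y. DK y m j) x + DK x j m \<bullet> DK x m j)
        = - 6 + 12 * ((x \<bullet> j) * (x \<bullet> j)) - codiff x \<bullet> DK x j j - pd j codiff x \<bullet> K x j"
      unfolding der inner_commute[of j x] inner_same_Basis[OF j] by (rule alg)
  qed
  \<comment> \<open>The first number is -6 times the ambient dimension 7, the second uses |x| =
    1.\<close>
  also have "\<dots> = - 42 + 12 - codiff x \<bullet> codiff x - codiff_trace x"
    unfolding sum_subtractf sum.distrib sum_distrib_left[symmetric] s2
    by (simp add: codiff_trace_def codiff_def[of x] inner_sum_right)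
  finally show ?thesis by simp
qed

text \<open>Projecting the middle slot subtracts \<open>(x \<bullet> a) *\<^sub>R DK x a x\<close>,
  whose sum over \<open>a\<close> is \<open>DK x x x = 0\<close>. Projecting the last slot changes
  nothing since \<open>codiff x\<close> is tangent.\<close>

lemma trace3_T:
  assumes x: "x \<in> S6" shows "hermitian.trace3 (T x) = codiff x"
proof -
  interpret hermitian "\<lambda>v. tangential_field v x" "K x" by (rule hermitian[OF x])
  have x0: "x \<noteq> 0" using x by auto
  have "trace3 (T x) \<bullet> w = codiff x \<bullet> w" for w
  proof -
    let ?w = "tangential_field w x"
    have "T x a a w = DK x a a \<bullet> ?w - ((x \<bullet> a) *\<^sub>R DK x a x) \<bullet> ?w" for a
      unfolding T_def tangential_field_def[of a]
      by (simp add: linear_diff[OF DK_linear_right[OF x0]] linear_scale[OF DK_linear_right[OF x0]]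
          inner_diff_left inner_commute[of a x])
    then have "trace3 (T x) \<bullet> w = (\<Sum>a\<in>Basis. DK x a a) \<bullet> ?w - (\<Sum>a\<in>Basis. (x \<bullet> a) *\<^sub>R DK x a x) \<bullet> ?w"
      unfolding trace3_inner[OF torsion_type_T[OF x]] by (simp add: sum_subtractf inner_sum_left)
    also have "(\<Sum>a\<in>Basis. (x \<bullet> a) *\<^sub>R DK x a x) = 0"
      unfolding vector_contraction[OF DK_linear_left[OF x0]] by (rule DK_radial[OF x0])
    also have "(\<Sum>a\<in>Basis. DK x a a) \<bullet> ?w = codiff x \<bullet> w"
      using codiff_normal[OF x] by (simp add: codiff_def tangential_field_def inner_diff_right)
    finally show ?thesis by simp
  qed
  then show ?thesis by (metis vector_eq_rdot)
qed

text \<open>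
  The normal components of \<open>DK\<close>, given by the second fundamental form of the sphere, account for the
  constant.
\<close>

lemma inner3_swap_T:
  assumes x: "x \<in> S6"
  shows "hermitian.inner3 (T x) (\<lambda>u v w. T x v u w) = grad_square x + 6"
proof -
  interpret hermitian "\<lambda>v. tangential_field v x" "K x" by (rule hermitian[OF x])
  have x0: "x \<noteq> 0" using x by auto
  let ?P = "\<lambda>v. tangential_field v x"
  have xx: "x \<bullet> x = 1" by (rule sphere_inner_self[OF x])
  have Tc: "T x a b c = ?P (DK x a (?P b)) \<bullet> c" for a b c
    unfolding T_def by (rule tangential_field_sym[symmetric])
  have "(\<Sum>c\<in>Basis. T x a b c * T x b a c) = ?P (DK x a (?P b)) \<bullet> ?P (DK x b (?P a))" for a b
    unfolding Tc by (rule euclidean_inner[symmetric])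
  then have 1: "inner3 (T x) (\<lambda>u v w. T x v u w) = (\<Sum>a\<in>Basis. \<Sum>b\<in>Basis. ?P (DK x a (?P b)) \<bullet> ?P (DK x b (?P a)))"
    unfolding inner3_def by simp
  have n: "DK x a (?P b) \<bullet> x = K x a \<bullet> b" for a b
  proof -
    have "DK x a (?P b) \<bullet> x = - (?P b \<bullet> DK x a x)" by (rule DK_skew[OF x0])
    also have "\<dots> = ?P b \<bullet> K x a" unfolding DK_self[OF x0] by simp
    also have "\<dots> = b \<bullet> K x a" unfolding tangential_field_sym P_M ..
    also have "\<dots> = K x a \<bullet> b" by (rule inner_commute)
    finally show ?thesis .
  qed
  \<comment> \<open>The two normal components are \<open>K x a \<bullet> b\<close> and
    \<open>K x b \<bullet> a\<close>, which are opposite. Summed over the basis their product is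
    minus the squared norm of \<open>K x\<close>, that is -6.\<close>
  have 2: "DK x a (?P b) \<bullet> DK x b (?P a) = ?P (DK x a (?P b)) \<bullet> ?P (DK x b (?P a)) - (K x a \<bullet> b) * (K x a \<bullet> b)" for a b
  proof -
    have PP: "?P u \<bullet> ?P v = u \<bullet> v - (u \<bullet> x) * (v \<bullet> x)" for u v
      unfolding tangential_field_sym P_P by (simp add: tangential_field_def inner_diff_right mult.commute)
    have "K x b \<bullet> a = - (K x a \<bullet> b)" using K_skew[OF x0, of b a] unfolding inner_commute[of b] .
    then show ?thesis unfolding PP n by simp
  qed
  have 3: "DK x a b = DK x a (?P b) - (x \<bullet> b) *\<^sub>R K x a" for a b
    unfolding tangential_field_def
    by (simp add: linear_diff[OF DK_linear_right[OF x0]] linear_scale[OF DK_linear_right[OF x0]]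
        DK_self[OF x0] inner_commute[of b x])
  have "DK x a b \<bullet> DK x b a = DK x a (?P b) \<bullet> DK x b (?P a) - ((x \<bullet> a) *\<^sub>R DK x a (?P b)) \<bullet> K x b
      - K x a \<bullet> ((x \<bullet> b) *\<^sub>R DK x b (?P a)) + ((x \<bullet> a) *\<^sub>R K x a) \<bullet> ((x \<bullet> b) *\<^sub>R K x b)" for a b
    unfolding 3[of a b] 3[of b a] by (simp add: inner_diff_left inner_diff_right algebra_simps)
  then have "grad_square x = (\<Sum>a\<in>Basis. \<Sum>b\<in>Basis. DK x a (?P b) \<bullet> DK x b (?P a))
      - (\<Sum>a\<in>Basis. \<Sum>b\<in>Basis. ((x \<bullet> a) *\<^sub>R DK x a (?P b)) \<bullet> K x b)
      - (\<Sum>a\<in>Basis. K x a \<bullet> (\<Sum>b\<in>Basis. (x \<bullet> b) *\<^sub>R DK x b (?P a)))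
      + (\<Sum>a\<in>Basis. ((x \<bullet> a) *\<^sub>R K x a) \<bullet> (\<Sum>b\<in>Basis. (x \<bullet> b) *\<^sub>R K x b))"
    unfolding grad_square_def by (simp only: sum.distrib sum_subtractf inner_sum_right)
  also have "(\<Sum>a\<in>Basis. \<Sum>b\<in>Basis. ((x \<bullet> a) *\<^sub>R DK x a (?P b)) \<bullet> K x b)
      = (\<Sum>b\<in>Basis. (\<Sum>a\<in>Basis. (x \<bullet> a) *\<^sub>R DK x a (?P b)) \<bullet> K x b)"
    unfolding inner_sum_left by (rule sum.swap)
  also have "(\<Sum>b\<in>Basis. (\<Sum>a\<in>Basis. (x \<bullet> a) *\<^sub>R DK x a (?P b)) \<bullet> K x b) = 0"
    unfolding vector_contraction[OF DK_linear_left[OF x0]] DK_radial[OF x0] by simp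
  also have "(\<Sum>a\<in>Basis. K x a \<bullet> (\<Sum>b\<in>Basis. (x \<bullet> b) *\<^sub>R DK x b (?P a))) = 0"
    unfolding vector_contraction[OF DK_linear_left[OF x0]] DK_radial[OF x0] by simp
  also have "(\<Sum>b\<in>Basis. (x \<bullet> b) *\<^sub>R K x b) = 0"
    unfolding vector_contraction[OF K_linear[OF x0]]
    using K_tangential[OF x, of x] linear_0[OF K_linear[OF x0]] by (simp add: tangential_field_self[OF x])
  also have "(\<Sum>a\<in>Basis. \<Sum>b\<in>Basis. DK x a (?P b) \<bullet> DK x b (?P a))
      = inner3 (T x) (\<lambda>u v w. T x v u w) - (\<Sum>a\<in>Basis. \<Sum>b\<in>Basis. (K x a \<bullet> b) * (K x a \<bullet> b))"
    unfolding 1 2 sum_subtractf ..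
  also have "(\<Sum>a\<in>Basis. \<Sum>b\<in>Basis. (K x a \<bullet> b) * (K x a \<bullet> b)) = 6"
    unfolding euclidean_inner[symmetric] M_M_inner by (rule tangential_trace[OF x])
  finally show ?thesis by simp
qed

definition flux :: "(real^7 \<Rightarrow> real) \<Rightarrow> real^7 \<Rightarrow> real^7" where
  "flux l y = (- 2 * (l (sgn y) * l (sgn y))) *\<^sub>R K y (codiff y)"

lemma smooth_flux: assumes l: "smooth_on S6 l" shows "smooth (- {0}) (flux l)"
proof (rule smooth_cong)
  show "smooth (- {0}) (\<lambda>y. (- 2 * (l (sgn y) * l (sgn y))) *\<^sub>R (\<Sum>b\<in>Basis. (codiff y \<bullet> b) *\<^sub>R K y b))"
    by (rule smooth_scaleR[OF smooth_mult[OF smooth_const[OF open_punctured] smooth_mult[OF smooth_hat[OF l] smooth_hat[OF l]]]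
          smooth_sum[OF open_punctured smooth_scaleR[OF smooth_inner[OF smooth_codiff smooth_const[OF open_punctured]] smooth_K]]])
  show "(- 2 * (l (sgn y) * l (sgn y))) *\<^sub>R (\<Sum>b\<in>Basis. (codiff y \<bullet> b) *\<^sub>R K y b) = flux l y" if "y \<in> - {0}" for y
    using vector_contraction[OF K_linear[of y]] that by (simp add: flux_def)
qed

lemma flux_normal: assumes "y \<noteq> 0" shows "flux l y \<bullet> y = 0"
proof -
  have "K y v \<bullet> sgn y = 0" for v using K_tangent[OF assms, of v] by (simp add: tangent_def)
  then have "K y v \<bullet> y = 0" for v using assms by (simp add: sgn_div_norm)
  then show ?thesis by (simp add: flux_def)
qed

text \<open>In the divergence of \<open>flux\<close>, a derivative falling on
  \<open>l\<^sup>2\<close> produces exactly the cross term between \<open>T\<close> and the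
  conformal part in \<open>calib_combination\<close>. A derivative falling on J produces
  second-order terms that \<open>second_order_identity\<close> removes, leaving 30 - 6 = 24.\<close>

lemma calib_eq_divergence:
  assumes l: "smooth_on S6 l" and x: "x \<in> S6"
  shows "hermitian.calib (nabla_tensor l x)
    = (\<Sum>b\<in>Basis. pd b (flux l) x \<bullet> b) + (24 * (l x)\<^sup>2 + 4 * (grad l x \<bullet> grad l x))"
proof -
  interpret hermitian "\<lambda>v. tangential_field v x" "K x" by (rule hermitian[OF x])
  have x0: "x \<noteq> 0" and x0': "x \<in> - {0}" using x by auto
  let ?t = "codiff x" and ?h = "grad l x"
  have d: "(flux l has_derivative (\<lambda>u. (- 2 * (l (sgn x) * l (sgn x))) *\<^sub>R (K x (pd u codiff x) + DK x u ?t)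
      + (- 2 * (l (sgn x) * pd u (\<lambda>y. l (sgn y)) x + pd u (\<lambda>y. l (sgn y)) x * l (sgn x))) *\<^sub>R K x ?t)) (at x)"
    unfolding flux_def
    by (rule has_derivative_scaleR[OF has_derivative_mult_right[OF has_derivative_mult[OF smooth_has_pd[OF smooth_hat[OF l] x0']
            smooth_has_pd[OF smooth_hat[OF l] x0']]] has_derivative_K_field[OF x0 smooth_has_pd[OF smooth_codiff x0']]])
  have "pd b (flux l) x \<bullet> b = (- 2 * (l x * l x)) * (K x (pd b codiff x) \<bullet> b + DK x b ?t \<bullet> b)
      - 4 * l x * ((?h \<bullet> b) * (K x ?t \<bullet> b))" for b
    unfolding pd_eqI[OF d] by (simp add: sgn_sphere[OF x] grad_inner[OF l x] inner_add_left algebra_simps)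
  note fl = this
  have sk: "K x (pd b codiff x) \<bullet> b = - (pd b codiff x \<bullet> K x b)" "DK x b ?t \<bullet> b = - (?t \<bullet> DK x b b)" for b
    by (rule K_skew[OF x0], rule DK_skew[OF x0])
  have "pd b (flux l) x \<bullet> b = (2 * (l x * l x)) * (pd b codiff x \<bullet> K x b + ?t \<bullet> DK x b b)
      - 4 * l x * ((?h \<bullet> b) * (K x ?t \<bullet> b))" for b
    unfolding fl sk by (simp add: algebra_simps)
  then have "(\<Sum>b\<in>Basis. pd b (flux l) x \<bullet> b) = (\<Sum>b\<in>Basis. (2 * (l x * l x)) * (pd b codiff x \<bullet> K x b + ?t \<bullet> DK x b b)
      - 4 * l x * ((?h \<bullet> b) * (K x ?t \<bullet> b)))"
    by (simp only:)
  also have "\<dots> = (2 * (l x * l x)) * (codiff_trace x + ?t \<bullet> ?t) - 4 * l x * (?h \<bullet> K x ?t)"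
    unfolding sum_subtractf sum_distrib_left[symmetric] sum.distrib euclidean_inner[of ?h "K x ?t"]
      codiff_trace_def inner_sum_right[symmetric] codiff_def[of x, symmetric] ..
  also have "?h \<bullet> K x ?t = - (?t \<bullet> K x ?h)" using K_skew[OF x0, of ?t ?h] by (simp add: inner_commute)
  finally have div: "(\<Sum>b\<in>Basis. pd b (flux l) x \<bullet> b)
      = (l x * l x) * (2 * codiff_trace x + 2 * (?t \<bullet> ?t)) + 4 * l x * (?t \<bullet> K x ?h)"
    by (simp add: algebra_simps)
  have "calib (nabla_tensor l x) = (l x)\<^sup>2 * calib (T x) + 4 * l x * (?t \<bullet> K x ?h) + 4 * (?h \<bullet> ?h)"
  proof -
    have "nabla_tensor l x = (\<lambda>u v w. l x * T x u v w + (1 / 2) * conf_tensor ?h u v w)"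
      by (intro ext) (simp add: nabla_tensor_def)
    then show ?thesis
      using calib_combination[OF torsion_type_T[OF x] tangential_field_id[OF grad_tangent[OF l x]], of "l x"]
      unfolding trace3_T[OF x] by simp
  qed
  also have "calib (T x) = ?t \<bullet> ?t - (grad_square x + 6)"
    unfolding calib_def trace3_T[OF x] inner3_swap_T[OF x] ..
  finally show ?thesis
    unfolding div second_order_identity[OF x] by (simp add: power2_eq_square algebra_simps)
qed

section \<open>Integration of the calibration\<close>

lemma integrable_normsq:
  "smooth_on S6 l \<Longrightarrow> integrable lborel (\<lambda>y. rho y ^ 6 * normsq l (inv_stereo y))"
  by (rule continuous_imp_integrable_chart[OF continuous_normsq])

lemma integral_calib:
  assumes l: "smooth_on S6 l"
  shows "integrable lborel (\<lambda>y. rho y ^ 6 * hermitian.calib (nabla_tensor l (inv_stereo y)))"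
    and "(\<integral>y. rho y ^ 6 * hermitian.calib (nabla_tensor l (inv_stereo y)) \<partial>lborel)
      = (\<integral>y. rho y ^ 6 * (24 * (l (inv_stereo y))\<^sup>2 + 4 * (grad l (inv_stereo y) \<bullet> grad l (inv_stereo y))) \<partial>lborel)"
proof -
  let ?x = inv_stereo
  note lc = smooth_on_sphere_continuous[OF l]
  have g: "continuous_on S6 (grad l)" by (rule continuous_sphere[OF smooth_grad[OF l]])
  have C: "integrable lborel (\<lambda>y. rho y ^ 6 * (24 * (l (?x y))\<^sup>2 + 4 * (grad l (?x y) \<bullet> grad l (?x y))))"
    by (rule continuous_imp_integrable_chart[where f = "\<lambda>x. 24 * (l x)\<^sup>2 + 4 * (grad l x \<bullet> grad l x)"])
      (intro continuous_on_add continuous_on_mult continuous_on_const continuous_on_power continuous_on_inner lc g)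
  note D = sphere_divergence[OF smooth_flux[OF l] flux_normal]
  have eq: "rho y ^ 6 * hermitian.calib (nabla_tensor l (?x y)) = rho y ^ 6 * (\<Sum>b\<in>Basis. pd b (flux l) (?x y) \<bullet> b)
      + rho y ^ 6 * (24 * (l (?x y))\<^sup>2 + 4 * (grad l (?x y) \<bullet> grad l (?x y)))" for y
    unfolding calib_eq_divergence[OF l inv_stereo_sphere] distrib_left ..
  show "integrable lborel (\<lambda>y. rho y ^ 6 * hermitian.calib (nabla_tensor l (?x y)))"
    unfolding eq by (rule Bochner_Integration.integrable_add[OF D(1) C])
  let ?C = "\<lambda>x. 24 * (l x)\<^sup>2 + 4 * (grad l x \<bullet> grad l x)"
  have "(\<integral>y. rho y ^ 6 * hermitian.calib (nabla_tensor l (?x y)) \<partial>lborel)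
      = (\<integral>y. rho y ^ 6 * (\<Sum>b\<in>Basis. pd b (flux l) (?x y) \<bullet> b) \<partial>lborel) + (\<integral>y. rho y ^ 6 * ?C (?x y) \<partial>lborel)"
    unfolding eq by (rule Bochner_Integration.integral_add[OF D(1) C])
  also have "(\<integral>y. rho y ^ 6 * (\<Sum>b\<in>Basis. pd b (flux l) (?x y) \<bullet> b) \<partial>lborel) = 0" by (rule D(2))
  finally show "(\<integral>y. rho y ^ 6 * hermitian.calib (nabla_tensor l (?x y)) \<partial>lborel) = (\<integral>y. rho y ^ 6 * ?C (?x y) \<partial>lborel)"
    by simp
qed

lemma energy_lower_bound:
  assumes l: "smooth_on S6 l" "\<And>x. x \<in> S6 \<Longrightarrow> l x > 0"
  shows "(\<integral>y. rho y ^ 6 * (24 * (l (inv_stereo y))\<^sup>2 + 4 * (grad l (inv_stereo y) \<bullet> grad l (inv_stereo y))) \<partial>lborel)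
    \<le> energy (conf_metric l) J"
proof -
  have "(\<integral>y. rho y ^ 6 * hermitian.calib (nabla_tensor l (inv_stereo y)) \<partial>lborel) \<le> (\<integral>y. rho y ^ 6 * normsq l (inv_stereo y) \<partial>lborel)"
  proof (rule integral_mono[OF integral_calib(1)[OF l(1)] integrable_normsq[OF l(1)]])
    fix y
    have "hermitian.calib (nabla_tensor l (inv_stereo y)) \<le> normsq l (inv_stereo y)"
      by (rule hermitian.calib_le[OF hermitian torsion_type_nabla_tensor[OF l(1)]]) (rule inv_stereo_sphere)+
    then show "rho y ^ 6 * hermitian.calib (nabla_tensor l (inv_stereo y)) \<le> rho y ^ 6 * normsq l (inv_stereo y)"
      by (rule mult_left_mono) (use rho_pos[of y] in simp)
  qed
  also have "\<dots> = energy (conf_metric l) J" by (rule energy_eq[OF l, symmetric])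
  finally show ?thesis unfolding integral_calib(2)[OF l(1)] .
qed

lemma energy_of_calibrated:
  assumes l: "smooth_on S6 l" "\<And>x. x \<in> S6 \<Longrightarrow> l x > 0"
    and cal: "\<And>x. x \<in> S6 \<Longrightarrow> hermitian.calib (nabla_tensor l x) = normsq l x"
  shows "energy (conf_metric l) J
    = (\<integral>y. rho y ^ 6 * (24 * (l (inv_stereo y))\<^sup>2 + 4 * (grad l (inv_stereo y) \<bullet> grad l (inv_stereo y))) \<partial>lborel)"
proof -
  have "energy (conf_metric l) J = (\<integral>y. rho y ^ 6 * normsq l (inv_stereo y) \<partial>lborel)"
    by (rule energy_eq[OF l])
  also have "\<dots> = (\<integral>y. rho y ^ 6 * hermitian.calib (nabla_tensor l (inv_stereo y)) \<partial>lborel)"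
    unfolding cal[OF inv_stereo_sphere] ..
  also note integral_calib(2)[OF l(1)]
  finally show ?thesis .
qed

end

subsection \<open>The Cayley cross product\<close>

text \<open>Once the Cayley-Dickson products are unfolded into coordinates, the identities for the
  cross product below are polynomial identities in them.\<close>

lemma cayley_cross_nth:
  "cayley_cross a b $ 1 = a$2 * b$3 - a$3 * b$2 + a$4 * b$5 - a$5 * b$4 - a$6 * b$7 + a$7 * b$6"
  "cayley_cross a b $ 2 = a$3 * b$1 - a$1 * b$3 + a$4 * b$6 - a$6 * b$4 + a$5 * b$7 - a$7 * b$5"
  "cayley_cross a b $ 3 = a$1 * b$2 - a$2 * b$1 + a$4 * b$7 - a$7 * b$4 - a$5 * b$6 + a$6 * b$5"
  "cayley_cross a b $ 4 = a$5 * b$1 - a$1 * b$5 + a$6 * b$2 - a$2 * b$6 + a$7 * b$3 - a$3 * b$7"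
  "cayley_cross a b $ 5 = a$1 * b$4 - a$4 * b$1 + a$7 * b$2 - a$2 * b$7 + a$3 * b$6 - a$6 * b$3"
  "cayley_cross a b $ 6 = a$1 * b$7 - a$7 * b$1 + a$2 * b$4 - a$4 * b$2 + a$5 * b$3 - a$3 * b$5"
  "cayley_cross a b $ 7 = a$6 * b$1 - a$1 * b$6 + a$2 * b$5 - a$5 * b$2 + a$3 * b$4 - a$4 * b$3"
  by (simp_all add: cayley_cross_def oct_im_def oct_mult_def oct_of_im_def quat_mult_def quat_cnj_def
      vector_7 algebra_simps)

lemmas cross_simps = inner_vec_def sum_7 cayley_cross_nth

lemma bounded_bilinear_cross: "bounded_bilinear cayley_cross"
  unfolding bilinear_conv_bounded_bilinear[symmetric] bilinear_def
  by (intro conjI allI linearI) (simp_all add: vec_eq_iff forall_7 cayley_cross_nth algebra_simps)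

lemma cross_self: "cayley_cross a a = 0"
  by (simp add: vec_eq_iff forall_7 cayley_cross_nth)

lemma cross_inner_left: "cayley_cross a b \<bullet> c = - (b \<bullet> cayley_cross a c)"
  by (simp add: cross_simps algebra_simps)

lemma cross_normal: "cayley_cross a b \<bullet> a = 0"
  by (simp add: cross_simps algebra_simps)

lemma cross_cross: "cayley_cross a (cayley_cross a b) = (a \<bullet> b) *\<^sub>R a - (a \<bullet> a) *\<^sub>R b"
  by (simp add: vec_eq_iff forall_7 cross_simps) (simp add: algebra_simps)

lemma cross_inner_cross:
  assumes "x \<in> S6" "u \<bullet> x = 0" shows "cayley_cross x u \<bullet> cayley_cross x v = u \<bullet> v"
  unfolding cross_inner_left[of x u] cross_cross using assms
  by (simp add: inner_diff_right sphere_inner_self)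

subsection \<open>Structures conformally equivalent to the Cayley structure\<close>

lemma has_derivative_pd_field:
  fixes f :: "'a::euclidean_space \<Rightarrow> 'b::real_normed_vector"
  assumes f: "smooth U f" and x: "x \<in> U" and Z: "(Z has_derivative Z') (at x)"
  shows "((\<lambda>y. pd (Z y) f y) has_derivative (\<lambda>u. pd (Z' u) f x + pd u (pd (Z x) f) x)) (at x)"
proof -
  note df = smooth_differentiable[OF f] and op = smooth_open[OF f]
  have "((\<lambda>y. \<Sum>b\<in>Basis. (z \<bullet> b) *\<^sub>R pd b f y) has_derivative (\<lambda>u. \<Sum>b\<in>Basis. (z \<bullet> b) *\<^sub>R pd u (pd b f) x)) (at x)" for z
    by (rule has_derivative_sum) (rule has_derivative_scaleR_right[OF smooth_has_pd[OF smooth_pd[OF f] x]])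
  then have dz: "(pd z f has_derivative (\<lambda>u. \<Sum>b\<in>Basis. (z \<bullet> b) *\<^sub>R pd u (pd b f) x)) (at x)" for z
    by (rule has_derivative_transform_within_open[OF _ op x]) (rule pd_basis_expansion[OF df, symmetric])
  have e: "(\<Sum>b\<in>Basis. (z \<bullet> b) *\<^sub>R pd u (pd b f) x) = pd u (pd z f) x" for z u
    by (rule pd_eqI[OF dz, symmetric])
  have "((\<lambda>y. \<Sum>b\<in>Basis. (Z y \<bullet> b) *\<^sub>R pd b f y) has_derivative
      (\<lambda>u. \<Sum>b\<in>Basis. (Z x \<bullet> b) *\<^sub>R pd u (pd b f) x + (Z' u \<bullet> b) *\<^sub>R pd b f x)) (at x)"
    by (rule has_derivative_sum) (rule has_derivative_scaleR[OF has_derivative_inner_left[OF Z] smooth_has_pd[OF smooth_pd[OF f] x]])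
  moreover have "(\<Sum>b\<in>Basis. (Z x \<bullet> b) *\<^sub>R pd u (pd b f) x + (Z' u \<bullet> b) *\<^sub>R pd b f x)
      = pd (Z' u) f x + pd u (pd (Z x) f) x" for u
    unfolding sum.distrib e pd_basis_expansion[OF df[OF x], of "Z' u"] by (rule add.commute)
  ultimately have "((\<lambda>y. \<Sum>b\<in>Basis. (Z y \<bullet> b) *\<^sub>R pd b f y) has_derivative
      (\<lambda>u. pd (Z' u) f x + pd u (pd (Z x) f) x)) (at x)" by simp
  then show ?thesis
    by (rule has_derivative_transform_within_open[OF _ op x]) (rule pd_basis_expansion[OF df, symmetric])
qed

lemma dim_tangent: "x \<in> S6 \<Longrightarrow> dim (tangent x) = 6"
proof -
  assume "x \<in> S6"
  moreover have "tangent x = {v. x \<bullet> v = 0}" by (simp add: tangent_def inner_commute)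
  ultimately show ?thesis using dim_hyperplane[of x] sphere_nonzero by simp
qed

locale conformal_pullback =
  fixes J :: "real^7 \<Rightarrow> real^7 \<Rightarrow> real^7" and \<phi> :: "real^7 \<Rightarrow> real^7" and \<mu> :: "real^7 \<Rightarrow> real"
  assumes J_ac: "almost_complex J" and maps: "\<And>x. x \<in> S6 \<Longrightarrow> \<phi> x \<in> S6" and smooth_\<phi>: "smooth_on S6 \<phi>"
    and \<mu>_pos: "\<And>x. x \<in> S6 \<Longrightarrow> \<mu> x > 0"
    and conformal: "\<And>x u v. x \<in> S6 \<Longrightarrow> u \<in> tangent x \<Longrightarrow> v \<in> tangent x \<Longrightarrow>
      sphere_deriv \<phi> x u \<bullet> sphere_deriv \<phi> x v = \<mu> x * (u \<bullet> v)"
    and pullback: "\<And>x v. x \<in> S6 \<Longrightarrow> v \<in> tangent x \<Longrightarrow> J x v = pullback_structure \<phi> cayley_structure x v"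
begin

abbreviation \<psi> :: "real^7 \<Rightarrow> real^7" where "\<psi> y \<equiv> \<phi> (sgn y)"

lemma smooth_\<psi>: "smooth (- {0}) \<psi>" by (rule smooth_hat[OF smooth_\<phi>])

lemma \<psi>_differentiable: "y \<noteq> 0 \<Longrightarrow> \<psi> differentiable (at y)"
  by (rule smooth_differentiable[OF smooth_\<psi>]) simp

lemma sphere_deriv_\<psi>: "x \<in> S6 \<Longrightarrow> v \<in> tangent x \<Longrightarrow> sphere_deriv \<phi> x v = pd v \<psi> x"
  by (rule sphere_deriv_hat[OF smooth_\<phi>])

lemma pd_\<psi>_inner: "x \<in> S6 \<Longrightarrow> u \<in> tangent x \<Longrightarrow> v \<in> tangent x \<Longrightarrow> pd u \<psi> x \<bullet> pd v \<psi> x = \<mu> x * (u \<bullet> v)"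
  using conformal[of x u v] by (simp only: sphere_deriv_\<psi>)

lemma pd_\<psi>_tangent: assumes "x \<in> S6" shows "pd v \<psi> x \<in> tangent (\<phi> x)"
proof -
  have x0: "x \<noteq> 0" using assms by auto
  note d = differentiable_has_pd[OF \<psi>_differentiable[OF x0]]
  have 1: "((\<lambda>y. \<psi> y \<bullet> \<psi> y) has_derivative (\<lambda>v. \<psi> x \<bullet> pd v \<psi> x + pd v \<psi> x \<bullet> \<psi> x)) (at x)"
    by (rule has_derivative_inner[OF d d])
  have "((\<lambda>y. \<psi> y \<bullet> \<psi> y) has_derivative (\<lambda>v. 0)) (at x)"
    by (rule has_derivative_transform_within_open[OF has_derivative_const open_punctured])
      (use x0 sphere_inner_self[OF maps[OF sgn_in_sphere]] in auto)
  from fun_cong[OF has_derivative_unique[OF 1 this], of v]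
  show ?thesis by (simp add: tangent_def sgn_sphere[OF assms] inner_commute)
qed

text \<open>The pullback is defined with \<open>inv_into\<close>, so its value is meaningful only
  when the argument lies in the image. Conformality gives injectivity, and equality of dimensions
  gives the rest.\<close>

lemma surjective_differential:
  assumes x: "x \<in> S6" shows "sphere_deriv \<phi> x ` tangent x = tangent (\<phi> x)"
proof -
  have x0: "x \<noteq> 0" using x by auto
  note lin = pd_linear[OF \<psi>_differentiable[OF x0]]
  have inj: "inj_on (\<lambda>v. pd v \<psi> x) (span (tangent x))"
    unfolding span_eq_iff[THEN iffD2, OF tangent_subspace] linear_injective_on_subspace_0[OF lin tangent_subspace]
  proof (intro ballI impI)
    fix v assume v: "v \<in> tangent x" "pd v \<psi> x = 0"
    then have "\<mu> x * (v \<bullet> v) = 0" using pd_\<psi>_inner[OF x v(1) v(1)] by simp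
    then show "v = 0" using \<mu>_pos[OF x] by simp
  qed
  have "(\<lambda>v. pd v \<psi> x) ` tangent x = tangent (\<phi> x)"
  proof (rule subspace_dim_equal)
    show "subspace ((\<lambda>v. pd v \<psi> x) ` tangent x)" by (rule linear_subspace_image[OF lin tangent_subspace])
    show "subspace (tangent (\<phi> x))" by (rule tangent_subspace)
    show "(\<lambda>v. pd v \<psi> x) ` tangent x \<subseteq> tangent (\<phi> x)" using pd_\<psi>_tangent[OF x] by auto
    show "dim (tangent (\<phi> x)) \<le> dim ((\<lambda>v. pd v \<psi> x) ` tangent x)"
      unfolding dim_image_eq[OF lin inj] dim_tangent[OF x] dim_tangent[OF maps[OF x]] by simp
  qed
  then show ?thesis using sphere_deriv_\<psi>[OF x] by (simp cong: image_cong_simp)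
qed

text \<open>The definition of the pullback, freed from the inverse. As an intertwining relation it
  can be differentiated.\<close>

lemma pd_\<psi>_J:
  assumes x: "x \<in> S6" and v: "v \<in> tangent x"
  shows "pd (J x v) \<psi> x = cayley_cross (\<phi> x) (pd v \<psi> x)"
proof -
  have "cayley_cross (\<phi> x) (pd v \<psi> x) \<in> tangent (\<phi> x)" using cross_normal by (simp add: tangent_def)
  then have im: "cayley_structure (\<phi> x) (sphere_deriv \<phi> x v) \<in> sphere_deriv \<phi> x ` tangent x"
    unfolding surjective_differential[OF x] cayley_structure_def sphere_deriv_\<psi>[OF x v] .
  have Jt: "J x v \<in> tangent x" using J_ac x v by (simp add: almost_complex_def)
  have "sphere_deriv \<phi> x (J x v) = cayley_structure (\<phi> x) (sphere_deriv \<phi> x v)"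
    unfolding pullback[OF x v] pullback_structure_def by (rule f_inv_into_f[OF im])
  then show ?thesis unfolding sphere_deriv_\<psi>[OF x v] sphere_deriv_\<psi>[OF x Jt] cayley_structure_def .
qed

lemma J_orthogonal: "orthogonal_almost_complex round_metric J"
  unfolding orthogonal_almost_complex_def round_metric_def
proof (intro conjI ballI J_ac)
  fix x u v assume x: "x \<in> S6" and u: "u \<in> tangent x" and v: "v \<in> tangent x"
  have Jt: "J x u \<in> tangent x" "J x v \<in> tangent x" using J_ac x u v by (simp_all add: almost_complex_def)
  have "pd u \<psi> x \<bullet> \<phi> x = 0" using pd_\<psi>_tangent[OF x, of u] by (simp add: tangent_def)
  from cross_inner_cross[OF maps[OF x] this, of "pd v \<psi> x"]
  have "\<mu> x * (J x u \<bullet> J x v) = \<mu> x * (u \<bullet> v)"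
    unfolding pd_\<psi>_inner[OF x Jt, symmetric] pd_\<psi>_inner[OF x u v, symmetric] pd_\<psi>_J[OF x u] pd_\<psi>_J[OF x v] .
  then show "J x u \<bullet> J x v = u \<bullet> v" using \<mu>_pos[OF x] by simp
qed

end

sublocale conformal_pullback \<subseteq> orthogonal_structure J
  by (rule orthogonal_structure.intro[OF J_orthogonal])

context conformal_pullback
begin

section \<open>First and second derivatives of the extended conformal map\<close>

lemma pd_\<psi>_sgn: assumes y: "y \<noteq> 0" shows "pd v \<psi> y = (1 / norm y) *\<^sub>R pd v \<psi> (sgn y)"
proof -
  have s0: "sgn y \<noteq> 0" using y by (simp add: sgn_zero_iff)
  have hom: "\<psi> (norm y *\<^sub>R z) = \<psi> z" for z using sgn_scale_pos[of "norm y" z] y by simp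
  have "pd v \<psi> (norm y *\<^sub>R sgn y) = (1 / norm y) *\<^sub>R pd v \<psi> (sgn y)"
    by (rule pd_homogeneous[OF hom _ \<psi>_differentiable[OF s0]]) (use y in simp)
  moreover have "norm y *\<^sub>R sgn y = y" using y by (simp add: sgn_div_norm)
  ultimately show ?thesis by simp
qed

lemma pd_\<psi>_tangential: "x \<in> S6 \<Longrightarrow> pd (tangential_field v x) \<psi> x = pd v \<psi> x"
  by (rule pd_hat_tangential[OF smooth_\<phi>])

lemma cross_scale: "cayley_cross a (c *\<^sub>R b) = c *\<^sub>R cayley_cross a b"
  by (rule bounded_bilinear.scaleR_right[OF bounded_bilinear_cross])

text \<open>Both sides scale with degree -1 in \<open>y\<close>, so the relation on the sphere
  extends to an open set, where it may be differentiated.\<close>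

lemma pd_\<psi>_K: assumes y: "y \<noteq> 0" shows "pd (K y v) \<psi> y = cayley_cross (\<psi> y) (pd v \<psi> y)"
proof -
  note x = sgn_in_sphere[OF y]
  have "pd (K y v) \<psi> (sgn y) = cayley_cross (\<phi> (sgn y)) (pd (tangential_field v (sgn y)) \<psi> (sgn y))"
    unfolding K_def by (rule pd_\<psi>_J[OF x tangential_field_tangent[OF x]])
  then show ?thesis unfolding pd_\<psi>_sgn[OF y, of "K y v"] pd_\<psi>_sgn[OF y, of v] cross_scale pd_\<psi>_tangential[OF x] by simp
qed

text \<open>The function \<open>\<mu>\<close> is given by its existence alone. This sixth of the
  trace of the pulled back metric agrees with \<open>\<mu>\<close> on the sphere and is visibly
  smooth.\<close>

definition factor :: "real^7 \<Rightarrow> real" where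
  "factor y = (1 / 6) * (\<Sum>b\<in>Basis. pd b \<psi> y \<bullet> pd b \<psi> y)"

lemma smooth_factor: "smooth (- {0}) factor"
  unfolding factor_def
  by (rule smooth_mult[OF smooth_const[OF open_punctured] smooth_sum[OF open_punctured smooth_inner[OF smooth_pd[OF smooth_\<psi>] smooth_pd[OF smooth_\<psi>]]]])

lemma pd_\<psi>_inner_punctured:
  assumes y: "y \<noteq> 0"
  shows "pd v \<psi> y \<bullet> pd w \<psi> y = factor y * (v \<bullet> w - (v \<bullet> y) * (w \<bullet> y) * inverse (y \<bullet> y))"
proof -
  note x = sgn_in_sphere[OF y]
  let ?P = "\<lambda>v. tangential_field v (sgn y)"
  have n: "inverse (norm y) * inverse (norm y) = inverse (y \<bullet> y)"
    by (simp add: dot_square_norm power2_eq_square)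
  have 1: "pd v \<psi> y \<bullet> pd w \<psi> y = (\<mu> (sgn y) * inverse (y \<bullet> y)) * (?P v \<bullet> w)" for v w
  proof -
    have "pd v \<psi> y \<bullet> pd w \<psi> y = inverse (y \<bullet> y) * (pd v \<psi> (sgn y) \<bullet> pd w \<psi> (sgn y))"
      unfolding pd_\<psi>_sgn[OF y, of v] pd_\<psi>_sgn[OF y, of w] n[symmetric] by (simp add: divide_inverse)
    also have "pd v \<psi> (sgn y) \<bullet> pd w \<psi> (sgn y) = \<mu> (sgn y) * (?P v \<bullet> ?P w)"
      using pd_\<psi>_inner[OF x tangential_field_tangent[OF x] tangential_field_tangent[OF x], of v w]
      unfolding pd_\<psi>_tangential[OF x] .
    also have "?P v \<bullet> ?P w = ?P v \<bullet> w"
      unfolding tangential_field_sym[symmetric] tangential_field_id[OF tangential_field_tangent[OF x]] ..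
    finally show ?thesis by simp
  qed
  have "factor y = \<mu> (sgn y) * inverse (y \<bullet> y)"
    unfolding factor_def 1 sum_distrib_left[symmetric] tangential_trace[OF x] by simp
  moreover have "?P v \<bullet> w = v \<bullet> w - (v \<bullet> y) * (w \<bullet> y) * inverse (y \<bullet> y)"
    unfolding n[symmetric] by (simp add: tangential_field_def inner_diff_left sgn_div_norm inner_commute[of y w])
  ultimately show ?thesis unfolding 1 by simp
qed

lemma factor_pos: assumes x: "x \<in> S6" shows "factor x > 0"
proof -
  obtain f :: "nat \<Rightarrow> real^7" where f: "\<And>i. i < 6 \<Longrightarrow> f i \<in> tangent x"
    "\<And>i j. i < 6 \<Longrightarrow> j < 6 \<Longrightarrow> f i \<bullet> f j = (if i = j then 1 else 0)"
    by (rule orthonormal_tangent_frame[OF x]) (rule that)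
  have t: "f 0 \<in> tangent x" and n: "f 0 \<bullet> f 0 = 1" using f(1)[of 0] f(2)[of 0 0] by auto
  have "pd (f 0) \<psi> x \<bullet> pd (f 0) \<psi> x = factor x"
    using pd_\<psi>_inner_punctured[of x "f 0" "f 0"] t n sphere_nonzero[OF x] by (simp add: tangent_def)
  moreover have "pd (f 0) \<psi> x \<bullet> pd (f 0) \<psi> x = \<mu> x" using pd_\<psi>_inner[OF x t t] n by simp
  ultimately show ?thesis using \<mu>_pos[OF x] by simp
qed

abbreviation Hess :: "real^7 \<Rightarrow> real^7 \<Rightarrow> real^7 \<Rightarrow> real^7" where
  "Hess x u v \<equiv> pd u (pd v \<psi>) x"

lemma Hess_commute: "x \<noteq> 0 \<Longrightarrow> Hess x u v = Hess x v u"
  by (rule pd_pd_commute[OF smooth_\<psi>]) simp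

text \<open>Differentiate \<open>pd_\<psi>_inner_punctured\<close>. The projection term there is a
  product of two factors vanishing at \<open>x\<close>, so only the derivative of
  \<open>factor\<close> contributes.\<close>

lemma Hess_metric:
  assumes x: "x \<in> S6" and u: "u \<in> tangent x" and v: "v \<in> tangent x" and w: "w \<in> tangent x"
  shows "Hess x u v \<bullet> pd w \<psi> x + Hess x u w \<bullet> pd v \<psi> x = pd u factor x * (v \<bullet> w)"
proof -
  have x0: "x \<noteq> 0" and x0': "x \<in> - {0}" using x by auto
  have xx: "x \<bullet> x = 1" by (rule sphere_inner_self[OF x])
  have vx: "v \<bullet> x = 0" "w \<bullet> x = 0" using v w by (simp_all add: tangent_def)
  have 1: "((\<lambda>y. pd v \<psi> y \<bullet> pd w \<psi> y) has_derivative (\<lambda>u. pd v \<psi> x \<bullet> Hess x u w + Hess x u v \<bullet> pd w \<psi> x)) (at x)"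
    by (rule has_derivative_inner[OF smooth_has_pd[OF smooth_pd[OF smooth_\<psi>] x0'] smooth_has_pd[OF smooth_pd[OF smooth_\<psi>] x0']])
  have p: "((\<lambda>y. v \<bullet> w - (v \<bullet> y) * (w \<bullet> y) * inverse (y \<bullet> y)) has_derivative (\<lambda>u. 0)) (at x)"
    using xx vx by (auto intro!: derivative_eq_intros simp: fun_eq_iff)
  have "((\<lambda>y. pd v \<psi> y \<bullet> pd w \<psi> y) has_derivative
      (\<lambda>u. factor x * 0 + pd u factor x * (v \<bullet> w - (v \<bullet> x) * (w \<bullet> x) * inverse (x \<bullet> x)))) (at x)"
    by (rule has_derivative_transform_within_open[OF has_derivative_mult[OF smooth_has_pd[OF smooth_factor x0'] p] open_punctured x0'])
      (simp only: pd_\<psi>_inner_punctured Compl_iff singleton_iff not_False_eq_True)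
  from fun_cong[OF has_derivative_unique[OF 1 this], of u] show ?thesis
    by (simp add: vx inner_commute add.commute)
qed

text \<open>The Koszul argument: the tangential Hessian of a conformal map is determined by its factor.\<close>

lemma Hess_inner:
  assumes x: "x \<in> S6" and u: "u \<in> tangent x" and v: "v \<in> tangent x" and w: "w \<in> tangent x"
  shows "2 * (Hess x u v \<bullet> pd w \<psi> x) = pd u factor x * (v \<bullet> w) + pd v factor x * (u \<bullet> w) - pd w factor x * (u \<bullet> v)"
  using Hess_metric[OF x u v w] Hess_metric[OF x v w u] Hess_metric[OF x w u v]
    Hess_commute[OF sphere_nonzero[OF x], of u v] Hess_commute[OF sphere_nonzero[OF x], of u w]
    Hess_commute[OF sphere_nonzero[OF x], of v w]
  by (simp add: inner_commute[of w u])

text \<open>Differentiate the intertwining relation along \<open>u\<close> with argument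
  \<open>u\<close>. The variation of the Cayley structure appears as \<open>pd u \<psi> x\<close>
  crossed with itself and vanishes; this is the infinitesimal form of its totally skew
  \<open>\<nabla>\<omega>\<close>.\<close>

lemma pd_\<psi>_DK:
  assumes x: "x \<in> S6"
  shows "pd (DK x u u) \<psi> x = cayley_cross (\<phi> x) (Hess x u u) - Hess x u (K x u)"
proof -
  have x0: "x \<noteq> 0" and x0': "x \<in> - {0}" using x by auto
  have 1: "((\<lambda>y. pd (K y u) \<psi> y) has_derivative (\<lambda>v. pd (DK x v u) \<psi> x + Hess x v (K x u))) (at x)"
    by (rule has_derivative_pd_field[OF smooth_\<psi> x0' differentiable_has_pd[OF DK_differentiable[OF x0]]])
  have "((\<lambda>y. cayley_cross (\<psi> y) (pd u \<psi> y)) has_derivative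
      (\<lambda>v. cayley_cross (\<psi> x) (Hess x v u) + cayley_cross (pd v \<psi> x) (pd u \<psi> x))) (at x)"
    by (rule bounded_bilinear.FDERIV[OF bounded_bilinear_cross smooth_has_pd[OF smooth_\<psi> x0'] smooth_has_pd[OF smooth_pd[OF smooth_\<psi>] x0']])
  then have "((\<lambda>y. pd (K y u) \<psi> y) has_derivative
      (\<lambda>v. cayley_cross (\<psi> x) (Hess x v u) + cayley_cross (pd v \<psi> x) (pd u \<psi> x))) (at x)"
    by (rule has_derivative_transform_within_open[OF _ open_punctured x0'])
      (simp only: pd_\<psi>_K Compl_iff singleton_iff not_False_eq_True)
  from fun_cong[OF has_derivative_unique[OF 1 this], of u] show ?thesis
    by (simp add: cross_self sgn_sphere[OF x] eq_diff_eq)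
qed

text \<open>This is -1/2 times J applied to the gradient of log \<open>factor\<close>. The value is
  read off from the Koszul formula for the Hessian in \<open>T_diagonal\<close>.\<close>

definition lee :: "real^7 \<Rightarrow> real^7" where
  "lee x = - (1 / (2 * factor x)) *\<^sub>R K x (\<Sum>b\<in>Basis. pd b factor x *\<^sub>R b)"

lemma lee_inner:
  assumes x: "x \<in> S6" shows "lee x \<bullet> v = pd (K x v) factor x / (2 * factor x)"
proof -
  have x0: "x \<noteq> 0" and x0': "x \<in> - {0}" using x by auto
  have "(\<Sum>b\<in>Basis. pd b factor x *\<^sub>R b) \<bullet> w = pd w factor x" for w
    using pd_basis_expansion[OF smooth_differentiable[OF smooth_factor x0'], of w]
    by (simp add: inner_sum_left inner_commute[of w] mult.commute)
  then show ?thesis unfolding lee_def by (simp add: K_skew[OF x0])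
qed

text \<open>The differential of \<open>\<psi>\<close> scales inner products of tangent vectors by
  \<open>factor\<close>, so \<open>T\<close> can be computed in the image, where
  \<open>pd_\<psi>_DK\<close> expresses it by Hessians and \<open>Hess_inner\<close> by derivatives
  of \<open>factor\<close> alone.\<close>

lemma T_diagonal:
  assumes x: "x \<in> S6" and u: "u \<in> tangent x" and w: "w \<in> tangent x"
  shows "2 * T x u u w = hermitian.conf_sym (\<lambda>v. tangential_field v x) (K x) (lee x) u u w"
proof -
  interpret hermitian "\<lambda>v. tangential_field v x" "K x" by (rule hermitian[OF x])
  have x0: "x \<noteq> 0" and x0': "x \<in> - {0}" using x by auto
  note lf = pd_linear[OF smooth_differentiable[OF smooth_factor x0']]
  have Kt: "K x v \<in> tangent x" for v using K_tangent[OF x0, of v] by (simp add: sgn_sphere[OF x])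
  have ux: "w \<bullet> x = 0" using w by (simp add: tangent_def)
  have uKu: "u \<bullet> K x u = 0" using K_skew[OF x0, of u u] by (simp add: inner_commute)
  let ?d = "\<lambda>v. pd v factor x"
  have "pd (DK x u u) \<psi> x \<bullet> pd w \<psi> x = factor x * T x u u w"
    unfolding pd_\<psi>_inner_punctured[OF x0] by (simp add: ux T_def tangential_field_id[OF u] tangential_field_id[OF w])
  then have "2 * (factor x * T x u u w)
      = 2 * (cayley_cross (\<phi> x) (Hess x u u) \<bullet> pd w \<psi> x) - 2 * (Hess x u (K x u) \<bullet> pd w \<psi> x)"
    unfolding pd_\<psi>_DK[OF x] by (simp add: inner_diff_left)
  \<comment> \<open>Skewness moves the cross product to the other argument, where intertwining turns
    it into \<open>K x w\<close>. Every Hessian is then paired with the image of a tangent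
    vector.\<close>
  also have "cayley_cross (\<phi> x) (Hess x u u) \<bullet> pd w \<psi> x = - (Hess x u u \<bullet> pd (K x w) \<psi> x)"
    unfolding cross_inner_left pd_\<psi>_K[OF x0] sgn_sphere[OF x] ..
  also have "2 * - (Hess x u u \<bullet> pd (K x w) \<psi> x) - 2 * (Hess x u (K x u) \<bullet> pd w \<psi> x)
      = - (?d u * (u \<bullet> K x w) + ?d u * (u \<bullet> K x w) - ?d (K x w) * (u \<bullet> u))
        - (?d u * (K x u \<bullet> w) + ?d (K x u) * (u \<bullet> w) - ?d w * (u \<bullet> K x u))"
    unfolding Hess_inner[OF x u u Kt, symmetric] Hess_inner[OF x u Kt w, symmetric] by simp
  also have "\<dots> = ?d u * (K x u \<bullet> w) - ?d (K x u) * (u \<bullet> w) + ?d (K x w) * (u \<bullet> u)"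
    unfolding uKu K_skew[OF x0, of u w] by simp
  finally have main: "2 * (factor x * T x u u w) = ?d u * (K x u \<bullet> w) - ?d (K x u) * (u \<bullet> w) + ?d (K x w) * (u \<bullet> u)" .
  have f0: "factor x \<noteq> 0" using factor_pos[OF x] by simp
  have KK: "?d (K x (K x u)) = - ?d u"
    unfolding M_M tangential_field_id[OF u] by (rule linear_neg[OF lf])
  have cs: "conf_sym (lee x) u u w = 2 * (u \<bullet> u) * (lee x \<bullet> w) - 2 * (lee x \<bullet> u) * (u \<bullet> w) - 2 * (lee x \<bullet> K x u) * (K x u \<bullet> w)"
    unfolding conf_sym_def tangential_field_id[OF u] by (simp add: inner_commute[of _ "lee x"])
  have "factor x * conf_sym (lee x) u u w = ?d (K x w) * (u \<bullet> u) - ?d (K x u) * (u \<bullet> w) + ?d u * (K x u \<bullet> w)"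
    unfolding cs lee_inner[OF x] KK using f0 by (simp add: field_simps)
  with main have "factor x * (2 * T x u u w) = factor x * conf_sym (lee x) u u w" by simp
  with f0 show ?thesis by simp
qed

text \<open>Polarization of the diagonal identity, followed by removal of the projections, through
  which both sides factor.\<close>

lemma T_symmetrized:
  assumes x: "x \<in> S6"
  shows "T x u v w + T x v u w = hermitian.conf_sym (\<lambda>v. tangential_field v x) (K x) (lee x) u v w"
proof -
  interpret hermitian "\<lambda>v. tangential_field v x" "K x" by (rule hermitian[OF x])
  let ?P = "\<lambda>v. tangential_field v x" and ?cs = "conf_sym (lee x)"
  note D = torsion_typeD[OF torsion_type_T[OF x]]
  have t: "?P v \<in> tangent x" for v by (rule tangential_field_tangent[OF x])
  have tt: "?P u + ?P v \<in> tangent x" for u v using t[of u] t[of v] by (simp add: tangent_def inner_add_left)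
  have bil: "?cs (a + b) (a + b) w = ?cs a a w + 2 * ?cs a b w + ?cs b b w" for a b w
  proof -
    have "?cs (a + b) (a + b) w = ?cs a a w + ?cs a b w + ?cs b a w + ?cs b b w"
      unfolding conf_sym_def tangential_field_add linear_add[OF M_linear] inner_add_left inner_add_right
      by (simp add: algebra_simps)
    then show ?thesis using conf_sym_commute[of "lee x" b a w] by simp
  qed
  have "2 * T x (?P u + ?P v) (?P u + ?P v) (?P w) = ?cs (?P u + ?P v) (?P u + ?P v) (?P w)"
    by (rule T_diagonal[OF x tt t])
  then have "T x (?P u) (?P v) (?P w) + T x (?P v) (?P u) (?P w) = ?cs (?P u) (?P v) (?P w)"
    using T_diagonal[OF x t t, of u w] T_diagonal[OF x t t, of v w]
    unfolding bil linear_add[OF D(1)] linear_add[OF D(2)] by simp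
  moreover have "?cs (?P u) (?P v) (?P w) = ?cs u v w"
  proof -
    have Pl: "?P (lee x) = lee x"
      unfolding lee_def tangential_field_scale P_M ..
    have "?P u \<bullet> ?P v = ?P u \<bullet> v" "?P u \<bullet> ?P w = ?P u \<bullet> w" "?P v \<bullet> ?P w = ?P v \<bullet> w"
      unfolding P_sym[symmetric] P_P by (rule refl)+
    moreover have "lee x \<bullet> ?P w = lee x \<bullet> w" "?P u \<bullet> lee x = u \<bullet> lee x" "?P v \<bullet> lee x = v \<bullet> lee x"
      using P_sym[of "lee x" w] P_sym[of u "lee x"] P_sym[of v "lee x"] unfolding Pl by simp_all
    moreover have "K x a \<bullet> ?P w = K x a \<bullet> w" for a
      using P_sym[of "K x a" w] unfolding P_M by simp
    ultimately show ?thesis unfolding conf_sym_def P_P M_P by simp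
  qed
  ultimately show ?thesis by (simp only: D(6) D(7) D(8))
qed

lemma calibrated:
  assumes l: "smooth_on S6 l" and x: "x \<in> S6"
  shows "hermitian.calib (nabla_tensor l x) = normsq l x"
proof -
  interpret hermitian "\<lambda>v. tangential_field v x" "K x" by (rule hermitian[OF x])
  have h: "tangential_field (grad l x) x = grad l x" by (rule tangential_field_id[OF grad_tangent[OF l x]])
  \<comment> \<open>\<open>conf_sym\<close> is linear in its vector argument, so the symmetrization
    from the conformal map and the one from the conformal change of metric add up to one of the same
    type.\<close>
  let ?\<alpha> = "l x *\<^sub>R lee x + (1 / 2) *\<^sub>R K x (grad l x)"
  show ?thesis
  proof (rule calib_eq[OF torsion_type_nabla_tensor[OF l x], where \<alpha> = ?\<alpha>])
    show "tangential_field ?\<alpha> x = ?\<alpha>"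
      unfolding tangential_field_add tangential_field_scale lee_def P_M ..
    show "nabla_tensor l x u v w + nabla_tensor l x v u w = conf_sym ?\<alpha> u v w" for u v w
    proof -
      have "nabla_tensor l x u v w + nabla_tensor l x v u w
          = l x * (T x u v w + T x v u w) + (1 / 2) * (conf_tensor (grad l x) u v w + conf_tensor (grad l x) v u w)"
        by (simp add: nabla_tensor_def algebra_simps)
      also have "\<dots> = conf_sym ?\<alpha> u v w"
        unfolding T_symmetrized[OF x] conf_sym_eq[OF h]
        unfolding conf_sym_def inner_add_left inner_add_right inner_scaleR_left inner_scaleR_right
        by (simp add: algebra_simps)
      finally show ?thesis .
    qed
  qed
qed

end

lemma conformally_equivalent_pullback:
  assumes "almost_complex J" "conformally_equivalent J cayley_structure"
  shows "\<exists>\<phi> \<mu>. conformal_pullback J \<phi> \<mu>"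
proof -
  from assms(2) obtain \<phi> where \<phi>: "conformal_diffeo \<phi>"
    "\<forall>x\<in>S6. \<forall>v\<in>tangent x. J x v = pullback_structure \<phi> cayley_structure x v"
    unfolding conformally_equivalent_def by (elim exE conjE)
  from \<phi>(1) obtain \<mu> where \<mu>: "\<forall>x\<in>S6. \<mu> x > 0 \<and> (\<forall>u\<in>tangent x. \<forall>v\<in>tangent x.
        round_metric (\<phi> x) (sphere_deriv \<phi> x u) (sphere_deriv \<phi> x v) = \<mu> x * round_metric x u v)"
    and bij: "bij_betw \<phi> S6 S6" and sm: "smooth_on S6 \<phi>"
    unfolding conformal_diffeo_def by (elim exE conjE)
  have "conformal_pullback J \<phi> \<mu>"
  proof (rule conformal_pullback.intro[OF assms(1)])
    show "\<phi> x \<in> S6" if "x \<in> S6" for x by (rule bij_betwE[OF bij, rule_format, OF that])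
    show "smooth_on S6 \<phi>" by (rule sm)
    show "\<mu> x > 0" if "x \<in> S6" for x using bspec[OF \<mu> that] by (rule conjunct1)
    show "sphere_deriv \<phi> x u \<bullet> sphere_deriv \<phi> x v = \<mu> x * (u \<bullet> v)"
      if "x \<in> S6" "u \<in> tangent x" "v \<in> tangent x" for x u v
      using bspec[OF bspec[OF conjunct2[OF bspec[OF \<mu> that(1)]] that(2)] that(3)] by (simp only: round_metric_def)
    show "J x v = pullback_structure \<phi> cayley_structure x v" if "x \<in> S6" "v \<in> tangent x" for x v
      by (rule bspec[OF bspec[OF \<phi>(2) that(1)] that(2)])
  qed
  then show ?thesis by (intro exI)
qed

theorem theorem2:
  fixes J :: "real^7 \<Rightarrow> real^7 \<Rightarrow> real^7" and l :: "real^7 \<Rightarrow> real"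
  assumes "almost_complex J"
    and "conformally_equivalent J cayley_structure"
    and "smooth_on S6 l"
    and "\<forall>x\<in>S6. l x > 0"
  shows "energy_minimizer (\<lambda>x u v. l x * round_metric x u v) J"
proof -
  note l = assms(3) bspec[OF assms(4)]
  from conformally_equivalent_pullback[OF assms(1,2)]
  obtain \<phi> \<mu> where "conformal_pullback J \<phi> \<mu>" by (elim exE)
  then interpret conformal_pullback J \<phi> \<mu> .
  show ?thesis
    unfolding energy_minimizer_def
  proof (intro conjI allI impI)
    show "orthogonal_almost_complex (conf_metric l) J"
      by (rule orthogonal_conformal_iff[OF l(2), THEN iffD2, OF _ J_orthogonal])
    fix J' assume "orthogonal_almost_complex (conf_metric l) J'"
    then have "orthogonal_structure J'"
      by (intro orthogonal_structure.intro orthogonal_conformal_iff[OF l(2), THEN iffD1])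
    from orthogonal_structure.energy_lower_bound[OF this l] energy_of_calibrated[OF l calibrated[OF l(1)]]
    show "energy (conf_metric l) J \<le> energy (conf_metric l) J'"
      by (simp only:)
  qed
qed

end
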